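(* Consider the high-dimensional setting described in the context, with $s_0=o(\sqrt n)$. Assume: (i) there is a constant $C_0>0$ (not depending on $n$) such that the eigenvalues $0<\lambda_1(\Sigma)\le\cdots\le\lambda_p(\Sigma)$ of $\Sigma$ satisfy $C_0\le\lambda_1(\Sigma)\le\lambda_p(\Sigma)\le C_0^{-1}$; (ii) there is a constant $K_1>0$ (not depending on $n$) such that $\|\Sigma\|_1\le K_1$. Let $i\in\{1,\dots,p\}$ (possibly depending on $n$), let $m=(m_1,\dots,m_{s_0})^T\in\mathbb R^{s_0}$ be a nonzero deterministic vector (possibly depending on $n$), write $m^T\Omega_i=(a_1,\dots,a_{s_0})$, and assume $a_k=O(1)$ for $k=1,\dots,s_0$ (uniformly in $k$ and $n$). Then, as $n\to\infty$, $$\frac{\sqrt n}{\sqrt h}\,m^T(\hat w_{i1}-w_{i1})\xrightarrow{d}N(0,1),\qquad\text{where } h=\mathrm{Var}\big(m^T\Omega_iX_{1B_i}X_{1B_i}^T\Omega_i\mathbf f_i\big).$$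
   Context: Asymptotic setting: everything is indexed by the sample size $n\to\infty$; the dimension $p=p_n$ (which may grow with $n$), the sparsity $s_0=s_{0,n}\ge 1$, and the matrices below may depend on $n$. $X_1,\dots,X_n$ are i.i.d. random vectors from $N(0,\Sigma)$ in $\mathbb R^p$, with $\Sigma$ symmetric positive definite, and $\Omega=\Sigma^{-1}$ is the precision matrix, with columns $w_1,\dots,w_p$. The positions of the nonzero entries of $\Omega$ are known, and each column of $\Omega$ has exactly $s_0$ nonzero entries. For $i=1,\dots,p$, let $w_{i1}\in\mathbb R^{s_0}$ be the vector of the nonzero entries of $w_i$ (in their order of appearance), and let $B_i$ be the $p\times s_0$ zero-one matrix whose columns are the standard basis vectors of $\mathbb R^p$ indexed by the support of $w_i$, in increasing order, so that $B_iw_{i1}=w_i$. Put $X_{kB_i}=B_i^TX_k\in\mathbb R^{s_0}$, $\Sigma_i=B_i^T\Sigma B_i$ and $\Omega_i=\Sigma_i^{-1}$. Let $e_i$ be the $i$-th standard basis vector of $\mathbb R^p$ and $\mathbf f_i=B_i^Te_i\in\mathbb R^{s_0}$. Let $\bar X=\frac1n\sum_{k=1}^nX_k$, let $S_n=\frac1{n-1}\sum_{k=1}^n(X_k-\bar X)(X_k-\bar X)^T$ be the sample covariance matrix, and $S_{ni}=B_i^TS_nB_i$ (almost surely invertible when $n>s_0$). The estimator of $w_{i1}$ is $\hat w_{i1}=(B_i^TS_nB_i)^{-1}B_i^Te_i=S_{ni}^{-1}\mathbf f_i$. For a matrix $A=(a_{ij})$, $\|A\|_1=\max_j\sum_i|a_{ij}|$.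 *)

theory Defs
  imports
    "HOL-Probability.Probability"
    "HOL-Library.Landau_Symbols"
    "Jordan_Normal_Form.Spectral_Radius"
    "Jordan_Normal_Form.Gauss_Jordan_Elimination"
begin

unbundle no inner_syntax
unbundle no vec_syntax
hide_const (open) Finite_Cartesian_Product.vec Finite_Cartesian_Product.mat
  Finite_Cartesian_Product.transpose Finite_Cartesian_Product.row Determinants.det
hide_type (open) Finite_Cartesian_Product.vec

text \<open>On singular matrices the value is the zero matrix.\<close>

definition inv_mat :: "real mat \<Rightarrow> real mat" where
  "inv_mat A = (case mat_inverse A of Some B \<Rightarrow> B | None \<Rightarrow> 0\<^sub>m (dim_row A) (dim_col A))"

definition pos_def_mat :: "real mat \<Rightarrow> bool" where
  "pos_def_mat A \<longleftrightarrow> square_mat A \<and> transpose_mat A = A \<and>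
     (\<forall>v\<in>carrier_vec (dim_row A). v \<noteq> 0\<^sub>v (dim_row A) \<longrightarrow> v \<bullet> (A *\<^sub>v v) > 0)"

text \<open>The norm \<open>\<parallel>A\<parallel>\<^sub>1\<close>; only meaningful if there is at least one column.\<close>

definition max_col_sum :: "real mat \<Rightarrow> real" where
  "max_col_sum A = Max ((\<lambda>j. \<Sum>i<dim_row A. \<bar>A $$ (i, j)\<bar>) ` {..<dim_col A})"

definition outer_prod :: "real vec \<Rightarrow> real vec \<Rightarrow> real mat" where
  "outer_prod v w = mat (dim_vec v) (dim_vec w) (\<lambda>(i, j). v $ i * w $ j)"

definition supp_list :: "real vec \<Rightarrow> nat list" where
  "supp_list w = filter (\<lambda>j. w $ j \<noteq> 0) [0..<dim_vec w]"

text \<open>Entries and columns are in increasing order of the support, so that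
  \<open>selection_mat w *\<^sub>v nonzero_part w = w\<close>.\<close>

definition nonzero_part :: "real vec \<Rightarrow> real vec" where
  "nonzero_part w = vec_of_list (map (($) w) (supp_list w))"

definition selection_mat :: "real vec \<Rightarrow> real mat" where
  "selection_mat w = mat_of_cols (dim_vec w) (map (unit_vec (dim_vec w)) (supp_list w))"

text \<open>Lebesgue measure on the Borel sets of \<open>carrier_vec p\<close>: the product measure carried over
  along \<open>vec p\<close>, which is a bijection from the extensional functions on \<open>{..<p}\<close> onto
  \<open>carrier_vec p\<close>.\<close>

definition lborel_vec :: "nat \<Rightarrow> real vec measure" where
  "lborel_vec p = embed_measure (\<Pi>\<^sub>M j\<in>{..<p}. lborel) (vec p)"

text \<open>The density of \<open>N(0, \<Sigma>)\<close> with respect to \<open>lborel_vec\<close>; only meaningful for positive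
  definite \<open>\<Sigma>\<close>.\<close>

definition mvn_density :: "real mat \<Rightarrow> real vec \<Rightarrow> real" where
  "mvn_density \<Sigma> x =
     exp (- (x \<bullet> (inv_mat \<Sigma> *\<^sub>v x)) / 2) / sqrt ((2 * pi) ^ dim_row \<Sigma> * det \<Sigma>)"

text \<open>The sample is \<open>x 1, \<dots>, x n\<close>, each in \<open>carrier_vec p\<close>.\<close>

definition sample_mean :: "nat \<Rightarrow> nat \<Rightarrow> (nat \<Rightarrow> real vec) \<Rightarrow> real vec" where
  "sample_mean p n x = vec p (\<lambda>j. (\<Sum>k=1..n. x k $ j) / real n)"

definition sample_cov :: "nat \<Rightarrow> nat \<Rightarrow> (nat \<Rightarrow> real vec) \<Rightarrow> real mat" where
  "sample_cov p n x = mat p p (\<lambda>ij.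
     (\<Sum>k=1..n. outer_prod (x k - sample_mean p n x) (x k - sample_mean p n x) $$ ij)
       / (real n - 1))"

end

theory Submission
  imports Defs "HOL-Real_Asymp.Real_Asymp"
begin

text \<open>
  Write \<open>cov u v = u \<bullet> (\<Sigma> v)\<close>, let \<open>S\<close> be the sample covariance, and denote by \<open>\<Sigma>\<^sub>B = B\<^sup>T \<Sigma> B\<close> and
  \<open>S\<^sub>B = B\<^sup>T S B\<close> the restrictions to the known support of the column \<open>w\<close>. As \<open>B w\<^sub>1 = w\<close> and
  \<open>\<Sigma> w = e\<^sub>i\<close>, the vector of nonzero entries solves \<open>\<Sigma>\<^sub>B w\<^sub>1 = f\<close>, while its estimator solves
  \<open>S\<^sub>B w\<^sub>1' = f\<close>. With \<open>m = \<Sigma>\<^sub>B a\<close> and \<open>E = S\<^sub>B - \<Sigma>\<^sub>B\<close> this gives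
  \<open>m \<bullet> (w\<^sub>1' - w\<^sub>1) = - a \<bullet> (E w\<^sub>1) + a \<bullet> (E S\<^sub>B\<^sup>-\<^sup>1 E w\<^sub>1)\<close>.

  The linear term is, up to an error of order \<open>1 / n\<close>, minus the centered average of the independent
  products \<open>(B a \<bullet> X\<^sub>k) (w \<bullet> X\<^sub>k)\<close>, whose common variance is \<open>h\<close>. Normalized by \<open>\<surd>n / \<surd>h\<close> it tends to
  \<open>N(0, 1)\<close>: this is a central limit theorem for a triangular array, and holds because the third
  absolute moments of the normalized products are bounded by an absolute constant
  (\<open>char_normalized_sum\<close>, \<open>char_prod_mean\<close>).

  The quadratic term is negligible. Everything is bilinear in \<open>a\<close> and \<open>w\<^sub>1\<close> and invariant under linear
  maps, so that one may take both vectors of unit variance and compute in a basis of the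
  \<open>s\<close>-dimensional space that is orthonormal for \<open>\<Sigma>\<^sub>B\<close> (\<open>orthonormal_basis_exists\<close>). In such a basis every
  entry of \<open>E\<close>, and every coordinate of \<open>E a\<close> and \<open>E w\<^sub>1\<close>, has second moment at most \<open>48 / n\<close>
  (\<open>cov_error_second_moment\<close>). Hence the squared Frobenius norm of \<open>E\<close> is of order \<open>s\<^sup>2 / n\<close>, so that
  with probability tending to one \<open>S\<^sub>B\<close> is within \<open>1 / 2\<close> of the identity and its inverse is bounded
  (\<open>inverse_perturbation\<close>); the quadratic term is then of order \<open>s / n\<close>. After multiplication by \<open>\<surd>n\<close> it is
  of order \<open>s / \<surd>n\<close>, which tends to zero (\<open>estimator_linearization\<close>). A perturbation that tends to zero
  in probability does not change the limit law (\<open>weak_conv_std_normal_perturbation\<close>).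

  All moments derive from the fact that a linear form \<open>u \<bullet> X\<^sub>k\<close> is normal with variance \<open>cov u u\<close>
  (\<open>distributed_linear_form\<close>). It is obtained from the density by the substitution \<open>x = L z\<close> with a
  Cholesky factor \<open>L\<close> of \<open>\<Sigma>\<close>, for which the transformation formula reduces to one-dimensional
  integrals (\<open>nn_integral_lower_triangular\<close>).
\<close>

section \<open>Linear algebra: inverses, Cholesky factors, quadratic forms\<close>

lemma det_pos_def_nonzero:
  assumes "A \<in> carrier_mat n n" "pos_def_mat A"
  shows "det A \<noteq> 0"
proof
  assume "det A = 0"
  then obtain v where v: "v \<in> carrier_vec n" "v \<noteq> 0\<^sub>v n" "A *\<^sub>v v = 0\<^sub>v n"
    using det_0_iff_vec_prod_zero[OF assms(1)] by blast
  have "v \<bullet> (A *\<^sub>v v) > 0"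
    using v assms unfolding pos_def_mat_def by auto
  then show False using v by simp
qed

lemma mult_mat_zero_vec:
  fixes A :: "'a :: comm_ring_1 mat"
  assumes "A \<in> carrier_mat r c"
  shows "A *\<^sub>v 0\<^sub>v c = 0\<^sub>v r"
  using assms by (intro eq_vecI) auto

lemma inv_mat_inverts:
  assumes A: "A \<in> carrier_mat n n" and d: "det A \<noteq> 0"
  shows "inv_mat A \<in> carrier_mat n n" "A * inv_mat A = 1\<^sub>m n" "inv_mat A * A = 1\<^sub>m n"
proof -
  have "A \<in> Units (ring_mat TYPE(real) n ())"
    using det_non_zero_imp_unit[OF A d] .
  then obtain B where "mat_inverse A = Some B"
    using mat_inverse(1)[OF A, of "()"] by (cases "mat_inverse A") auto
  with mat_inverse(2)[OF A this]
  show "inv_mat A \<in> carrier_mat n n" "A * inv_mat A = 1\<^sub>m n" "inv_mat A * A = 1\<^sub>m n"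
    by (auto simp: inv_mat_def)
qed

lemma inv_mat_carrier [simp]:
  assumes A: "A \<in> carrier_mat n n"
  shows "inv_mat A \<in> carrier_mat n n"
  using mat_inverse(2)[OF A] A by (auto simp: inv_mat_def split: option.splits)

text \<open>Cramer's rule. It exhibits the entries as rational functions of the entries of \<open>A\<close>, from which
  measurability follows; when \<open>det A = 0\<close> the value is the zero default of \<^const>\<open>inv_mat\<close>.\<close>

lemma inv_mat_entry:
  assumes A: "A \<in> carrier_mat n n" and ij: "i < n" "j < n"
  shows "inv_mat A $$ (i, j) = (if det A = 0 then 0 else cofactor A j i / det A)"
proof (cases "det A = 0")
  case True
  have "mat_inverse A = None"
  proof (rule ccontr)
    assume "mat_inverse A \<noteq> None"
    then obtain B where "mat_inverse A = Some B" by auto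
    from mat_inverse(2)[OF A this] have B: "A * B = 1\<^sub>m n" "B \<in> carrier_mat n n" by auto
    have "det A * det B = 1"
      using det_mult[OF A B(2)] B(1) by simp
    with True show False by simp
  qed
  then show ?thesis using True A ij by (simp add: inv_mat_def)
next
  case False
  note inv = inv_mat_inverts[OF A False]
  note adj = adj_mat[OF A]
  have "adj_mat A = adj_mat A * (A * inv_mat A)"
    unfolding inv(2) using right_mult_one_mat[OF adj(1)] by simp
  also have "\<dots> = (adj_mat A * A) * inv_mat A"
    by (rule assoc_mult_mat[OF adj(1) A inv(1), symmetric])
  also have "\<dots> = det A \<cdot>\<^sub>m inv_mat A"
    using inv adj mult_smult_assoc_mat[of "1\<^sub>m n" n n "inv_mat A" n "det A"] by simp
  finally have "adj_mat A $$ (i, j) = det A * inv_mat A $$ (i, j)"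
    using inv ij by simp
  moreover have "adj_mat A $$ (i, j) = cofactor A j i"
    using A ij by (simp add: adj_mat_def)
  ultimately show ?thesis using False by simp
qed

definition lower_triangular_pos :: "nat \<Rightarrow> real mat \<Rightarrow> bool" where
  "lower_triangular_pos n L \<longleftrightarrow> L \<in> carrier_mat n n \<and>
     (\<forall>i<n. \<forall>j<n. i < j \<longrightarrow> L $$ (i, j) = 0) \<and> (\<forall>i<n. 0 < L $$ (i, i))"

lemma det_lower_triangular_pos:
  assumes "lower_triangular_pos n L"
  shows "det L = (\<Prod>i<n. L $$ (i, i))" and "0 < det L"
proof -
  have "det L = prod_list (diag_mat L)"
    by (rule det_lower_triangular[of n]) (use assms in \<open>auto simp: lower_triangular_pos_def\<close>)
  also have "\<dots> = (\<Prod>i<n. L $$ (i, i))"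
    using assms by (auto simp: prod_list_diag_prod lower_triangular_pos_def atLeast0LessThan)
  finally show d: "det L = (\<Prod>i<n. L $$ (i, i))" .
  show "0 < det L"
    unfolding d using assms by (auto simp: lower_triangular_pos_def intro!: prod_pos)
qed

lemma scalar_prod_transpose_mult:
  fixes M :: "'a :: comm_ring_1 mat"
  assumes "M \<in> carrier_mat r c" "u \<in> carrier_vec r" "v \<in> carrier_vec c"
  shows "u \<bullet> (M *\<^sub>v v) = (transpose_mat M *\<^sub>v u) \<bullet> v"
proof -
  have "u \<bullet> (M *\<^sub>v v) = (\<Sum>i<r. \<Sum>j<c. u $ i * (M $$ (i, j) * v $ j))"
    using assms by (simp add: scalar_prod_def atLeast0LessThan sum_distrib_left)
  also have "\<dots> = (\<Sum>j<c. \<Sum>i<r. u $ i * (M $$ (i, j) * v $ j))"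
    by (rule sum.swap)
  also have "\<dots> = (transpose_mat M *\<^sub>v u) \<bullet> v"
    using assms by (simp add: scalar_prod_def atLeast0LessThan sum_distrib_right sum_distrib_left mult_ac)
  finally show ?thesis .
qed

lemma quadratic_form_sum:
  fixes A :: "real mat"
  assumes "A \<in> carrier_mat n n" "u \<in> carrier_vec n" "v \<in> carrier_vec n"
  shows "u \<bullet> (A *\<^sub>v v) = (\<Sum>i<n. \<Sum>j<n. u $ i * A $$ (i, j) * v $ j)"
  using assms by (simp add: scalar_prod_def atLeast0LessThan sum_distrib_left mult_ac)

text \<open>Induction on the dimension. If \<open>L L\<^sup>T\<close> is the decomposition of the leading block, \<open>b\<close> the rest
  of the last column and \<open>y = L\<^sup>-\<^sup>1 b\<close>, then the new row is \<open>(y, r)\<close> with \<open>r\<^sup>2\<close> the Schur complement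
  \<open>d - y \<bullet> y\<close> of the last diagonal entry \<open>d\<close>. The Schur complement is positive because it is the
  value of the quadratic form at the vector \<open>(x, 1)\<close> with \<open>L\<^sup>T x = - y\<close>.\<close>

lemma cholesky_decomposition:
  assumes "A \<in> carrier_mat n n" "pos_def_mat A"
  shows "\<exists>L. lower_triangular_pos n L \<and> A = L * transpose_mat L"
  using assms
proof (induction n arbitrary: A)
  case 0
  show ?case
    by (rule exI[of _ "1\<^sub>m 0"]) (use 0 in \<open>auto simp: lower_triangular_pos_def\<close>)
next
  case (Suc n)
  have sym: "A $$ (j, i) = A $$ (i, j)" if "i < Suc n" "j < Suc n" for i j
  proof -
    have "A = transpose_mat A" using Suc.prems by (simp add: pos_def_mat_def)
    then have "A $$ (j, i) = transpose_mat A $$ (j, i)" by simp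
    also have "\<dots> = A $$ (i, j)" using that Suc.prems(1) by simp
    finally show ?thesis .
  qed
  define A1 where "A1 = mat n n (\<lambda>(i, j). A $$ (i, j))"
  define b where "b = vec n (\<lambda>i. A $$ (i, n))"
  define ext where "ext x c = vec (Suc n) (\<lambda>i. if i < n then x $ i else c)" for x :: "real vec" and c
  have A1: "A1 \<in> carrier_mat n n" and b: "b \<in> carrier_vec n" by (auto simp: A1_def b_def)
  have form: "ext x c \<bullet> (A *\<^sub>v ext x c) = x \<bullet> (A1 *\<^sub>v x) + 2 * c * (b \<bullet> x) + c\<^sup>2 * A $$ (n, n)"
    if x: "x \<in> carrier_vec n" for x c
  proof -
    have "ext x c \<bullet> (A *\<^sub>v ext x c) =
        (\<Sum>i<Suc n. \<Sum>j<Suc n. ext x c $ i * A $$ (i, j) * ext x c $ j)"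
      by (rule quadratic_form_sum) (use Suc.prems in \<open>auto simp: ext_def\<close>)
    also have "\<dots> = (\<Sum>i<n. \<Sum>j<n. x $ i * A $$ (i, j) * x $ j)
        + c * (\<Sum>i<n. A $$ (i, n) * x $ i) + c * (\<Sum>i<n. A $$ (n, i) * x $ i) + c\<^sup>2 * A $$ (n, n)"
      by (simp add: ext_def sum.distrib sum_distrib_left algebra_simps power2_eq_square)
    also have "(\<Sum>i<n. A $$ (n, i) * x $ i) = (\<Sum>i<n. A $$ (i, n) * x $ i)"
      by (intro sum.cong refl) (simp add: sym[of n])
    also have "(\<Sum>i<n. A $$ (i, n) * x $ i) = b \<bullet> x"
      using x by (simp add: b_def scalar_prod_def atLeast0LessThan)
    also have "(\<Sum>i<n. \<Sum>j<n. x $ i * A $$ (i, j) * x $ j) = x \<bullet> (A1 *\<^sub>v x)"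
      unfolding quadratic_form_sum[OF A1 x x] by (simp add: A1_def)
    finally show ?thesis by simp
  qed
  have pos: "ext x c \<bullet> (A *\<^sub>v ext x c) > 0" if "ext x c \<noteq> 0\<^sub>v (Suc n)" for x c
    using Suc.prems that by (auto simp: pos_def_mat_def ext_def)
  have "pos_def_mat A1"
    unfolding pos_def_mat_def
  proof (intro conjI ballI impI)
    show "square_mat A1" using A1 by auto
    show "transpose_mat A1 = A1"
      by (rule eq_matI) (use sym in \<open>auto simp: A1_def\<close>)
    fix v :: "real vec" assume v: "v \<in> carrier_vec (dim_row A1)" "v \<noteq> 0\<^sub>v (dim_row A1)"
    then have v': "v \<in> carrier_vec n" "v \<noteq> 0\<^sub>v n" using A1 by auto
    have "ext v 0 \<noteq> 0\<^sub>v (Suc n)"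
    proof
      assume eq: "ext v 0 = 0\<^sub>v (Suc n)"
      have "v = 0\<^sub>v n"
      proof (rule eq_vecI)
        fix i assume "i < dim_vec (0\<^sub>v n :: real vec)"
        then have i: "i < n" by simp
        have "ext v 0 $ i = v $ i" using i by (simp add: ext_def)
        with eq i show "v $ i = 0\<^sub>v n $ i" by simp
      qed (use v' in auto)
      with v' show False by simp
    qed
    from pos[OF this] form[OF v'(1), of 0] show "v \<bullet> (A1 *\<^sub>v v) > 0" by simp
  qed
  with Suc.IH[OF A1] obtain L where L: "lower_triangular_pos n L" "A1 = L * transpose_mat L" by blast
  then have Lc: "L \<in> carrier_mat n n" by (simp add: lower_triangular_pos_def)
  have Li: "inv_mat L \<in> carrier_mat n n" "L * inv_mat L = 1\<^sub>m n" "inv_mat L * L = 1\<^sub>m n"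
    using inv_mat_inverts[OF Lc] det_lower_triangular_pos(2)[OF L(1)] by auto
  define y where "y = inv_mat L *\<^sub>v b"
  have y: "y \<in> carrier_vec n" using Li b by (simp add: y_def)
  have Ly: "L *\<^sub>v y = b"
  proof -
    have "L *\<^sub>v y = (L * inv_mat L) *\<^sub>v b"
      unfolding y_def using Lc Li(1) b by (intro assoc_mult_mat_vec[symmetric])
    then show ?thesis using Li b by simp
  qed
  \<comment> \<open>minimizes the quadratic form over the vectors with last entry \<open>1\<close>; the minimum is the Schur
    complement\<close>
  define x where "x = transpose_mat (inv_mat L) *\<^sub>v (- y)"
  have x: "x \<in> carrier_vec n" using Li y by (simp add: x_def)
  have Lx: "transpose_mat L *\<^sub>v x = - y"
  proof -
    have "transpose_mat L *\<^sub>v x = (transpose_mat L * transpose_mat (inv_mat L)) *\<^sub>v (- y)"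
      unfolding x_def using Lc Li y by (intro assoc_mult_mat_vec[symmetric]) auto
    also have "transpose_mat L * transpose_mat (inv_mat L) = transpose_mat (inv_mat L * L)"
      using transpose_mult[OF Li(1) Lc] by simp
    finally show ?thesis using Li y by simp
  qed
  have "x \<bullet> (A1 *\<^sub>v x) = y \<bullet> y"
  proof -
    have "A1 *\<^sub>v x = L *\<^sub>v (transpose_mat L *\<^sub>v x)"
      unfolding L(2) using Lc x by (intro assoc_mult_mat_vec) auto
    then have "x \<bullet> (A1 *\<^sub>v x) = (transpose_mat L *\<^sub>v x) \<bullet> (transpose_mat L *\<^sub>v x)"
      using scalar_prod_transpose_mult[OF Lc x, of "transpose_mat L *\<^sub>v x"] Lc x by simp
    then show ?thesis unfolding Lx using y by simp
  qed
  moreover have "b \<bullet> x = - (y \<bullet> y)"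
  proof -
    have "b \<bullet> x = x \<bullet> (L *\<^sub>v y)" using Ly comm_scalar_prod[OF b x] by simp
    also have "\<dots> = (transpose_mat L *\<^sub>v x) \<bullet> y" by (rule scalar_prod_transpose_mult[OF Lc x y])
    finally show ?thesis unfolding Lx using y by simp
  qed
  moreover have "ext x 1 \<noteq> 0\<^sub>v (Suc n)"
  proof
    assume "ext x 1 = 0\<^sub>v (Suc n)"
    moreover have "ext x 1 $ n = 1" by (simp add: ext_def)
    ultimately show False by simp
  qed
  ultimately have d: "A $$ (n, n) - y \<bullet> y > 0"
    using pos[of x 1] form[OF x, of 1] by simp
  define r where "r = sqrt (A $$ (n, n) - y \<bullet> y)"
  have r: "r > 0" "r * r = A $$ (n, n) - y \<bullet> y" using d by (auto simp: r_def)
  define L' where "L' = mat (Suc n) (Suc n) (\<lambda>(i, j). if i < n then if j < n then L $$ (i, j) else 0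
     else if j < n then y $ j else r)"
  have "lower_triangular_pos (Suc n) L'"
    using L(1) r by (auto simp: lower_triangular_pos_def L'_def)
  moreover have "A = L' * transpose_mat L'"
  proof (rule eq_matI)
    fix i j assume "i < dim_row (L' * transpose_mat L')" "j < dim_col (L' * transpose_mat L')"
    then have ij: "i < Suc n" "j < Suc n" by (auto simp: L'_def)
    have "(L' * transpose_mat L') $$ (i, j) = (\<Sum>k<Suc n. L' $$ (i, k) * L' $$ (j, k))"
      using ij by (simp add: L'_def scalar_prod_def atLeast0LessThan)
    also have "\<dots> = A $$ (i, j)"
    proof -
      have 1: "(\<Sum>k<n. L $$ (i, k) * L $$ (j, k)) = A $$ (i, j)" if "i < n" "j < n" for i j
      proof -
        have "A $$ (i, j) = A1 $$ (i, j)" using that by (simp add: A1_def)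
        also have "\<dots> = (\<Sum>k<n. L $$ (i, k) * L $$ (j, k))"
          unfolding L(2) using that Lc by (simp add: scalar_prod_def atLeast0LessThan)
        finally show ?thesis by simp
      qed
      have 2: "(\<Sum>k<n. L $$ (i, k) * y $ k) = A $$ (i, n)" if "i < n" for i
      proof -
        have "A $$ (i, n) = (L *\<^sub>v y) $ i" unfolding Ly using that by (simp add: b_def)
        then show ?thesis using that Lc y by (simp add: scalar_prod_def atLeast0LessThan)
      qed
      have 3: "(\<Sum>k<n. y $ k * y $ k) = y \<bullet> y"
        using y by (simp add: scalar_prod_def atLeast0LessThan)
      consider "i < n" "j < n" | "i < n" "j = n" | "i = n" "j < n" | "i = n" "j = n"
        using ij by linarith
      then show ?thesis
      proof cases
        case 3
        then have "(\<Sum>k<Suc n. L' $$ (i, k) * L' $$ (j, k)) = (\<Sum>k<n. L $$ (j, k) * y $ k)"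
          by (simp add: L'_def mult.commute)
        with 2[of j] 3 sym[of i j] ij show ?thesis by simp
      qed (use 1 2 3 r in \<open>simp_all add: L'_def\<close>)
    qed
    finally show "A $$ (i, j) = (L' * transpose_mat L') $$ (i, j)" by simp
  qed (use Suc.prems in \<open>auto simp: L'_def\<close>)
  ultimately show ?case by blast
qed

section \<open>Linear change of variables in a product of Lebesgue measures\<close>

interpretation lborel_prod: product_sigma_finite "\<lambda>_::nat. lborel :: real measure"
  by standard

text \<open>The substitution formula for a triangular linear map, by induction on the number of variables:
  for fixed earlier variables, the last output coordinate is an affine function of the last input
  variable with slope \<open>L n n\<close>, so the one-dimensional formula applies to the inner integral of
  Fubini's theorem. Triangularity spares any appeal to a general determinant formula, and it
  suffices because every covariance matrix has a Cholesky factor.\<close>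

lemma nn_integral_lower_triangular:
  fixes L :: "nat \<Rightarrow> nat \<Rightarrow> real"
  assumes "\<And>i. i < n \<Longrightarrow> 0 < L i i" "F \<in> borel_measurable (Pi\<^sub>M {..<n} (\<lambda>_. lborel))"
  shows "(\<integral>\<^sup>+ x. F x \<partial>Pi\<^sub>M {..<n} (\<lambda>_. lborel)) = ennreal (\<Prod>i<n. L i i) *
    (\<integral>\<^sup>+ z. F (\<lambda>i\<in>{..<n}. \<Sum>j\<le>i. L i j * z j) \<partial>Pi\<^sub>M {..<n} (\<lambda>_. lborel))"
  using assms
proof (induction n arbitrary: F)
  case 0
  show ?case
    by (simp add: PiM_empty nn_integral_count_space_finite)
next
  case (Suc n)
  let ?P = "\<lambda>n. Pi\<^sub>M {..<n} (\<lambda>_. lborel) :: (nat \<Rightarrow> real) measure"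
  let ?T = "\<lambda>n z. \<lambda>i\<in>{..<n}. \<Sum>j\<le>i. L i j * z j"
  have ins: "{..<Suc n} = insert n {..<n}" by auto
  have F [measurable]: "F \<in> borel_measurable (Pi\<^sub>M (insert n {..<n}) (\<lambda>_. lborel))"
    using Suc.prems(2) by (simp add: ins)
  have T [measurable]: "?T m \<in> measurable (?P m) (?P m)" for m
  proof (rule measurable_restrict)
    fix i assume i: "i \<in> {..<m}"
    show "(\<lambda>z. \<Sum>j\<le>i. L i j * z j) \<in> measurable (?P m) lborel"
      unfolding measurable_lborel1
      by (intro borel_measurable_sum borel_measurable_times borel_measurable_const
        measurable_component_singleton[of _ "{..<m}" "\<lambda>_. lborel", simplified]) (use i in auto)
  qed
  have upd: "F (?T (Suc n) (z(n := y))) = F ((?T n z)(n := (\<Sum>j<n. L n j * z j) + L n n * y))" for z y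
  proof -
    have "?T (Suc n) (z(n := y)) = (?T n z)(n := (\<Sum>j<n. L n j * z j) + L n n * y)"
    proof (rule ext)
      fix i
      consider "i < n" | "i = n" | "i > n" by linarith
      then show "?T (Suc n) (z(n := y)) i = ((?T n z)(n := (\<Sum>j<n. L n j * z j) + L n n * y)) i"
      proof cases
        case 2
        have "{..n} = insert n {..<n}" by auto
        with 2 show ?thesis by simp
      qed (auto intro!: sum.cong)
    qed
    then show ?thesis by simp
  qed
  \<comment> \<open>integrating out the last variable leaves a function of the first \<open>n\<close> variables, to which the
    induction hypothesis applies\<close>
  define g where "g x = (\<integral>\<^sup>+ y. F (x(n := y)) \<partial>lborel)" for x
  have g [measurable]: "g \<in> borel_measurable (?P n)"
    unfolding g_def by measurable
  have "(\<integral>\<^sup>+ x. F x \<partial>?P (Suc n)) = (\<integral>\<^sup>+ x. g x \<partial>?P n)"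
    unfolding ins g_def by (rule lborel_prod.product_nn_integral_insert) auto
  also have "\<dots> = ennreal (\<Prod>i<n. L i i) * (\<integral>\<^sup>+ z. g (?T n z) \<partial>?P n)"
    by (rule Suc.IH) (use Suc.prems g in auto)
  also have "(\<integral>\<^sup>+ z. g (?T n z) \<partial>?P n) =
      (\<integral>\<^sup>+ z. L n n * (\<integral>\<^sup>+ y. F (?T (Suc n) (z(n := y))) \<partial>lborel) \<partial>?P n)"
  proof (rule nn_integral_cong)
    fix z assume z: "z \<in> space (?P n)"
    have Tz: "?T n z \<in> space (?P n)" using measurable_space[OF T z] .
    have m: "(\<lambda>y. F ((?T n z)(n := y))) \<in> borel_measurable borel"
      using measurable_comp[OF measurable_component_update[OF Tz] F] by (simp add: comp_def)
    show "g (?T n z) = L n n * (\<integral>\<^sup>+ y. F (?T (Suc n) (z(n := y))) \<partial>lborel)"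
      unfolding g_def upd
      using nn_integral_real_affine[OF m, of "L n n" "\<Sum>j<n. L n j * z j"] Suc.prems(1)[of n] by simp
  qed
  also have "\<dots> = L n n * (\<integral>\<^sup>+ z. (\<integral>\<^sup>+ y. F (?T (Suc n) (z(n := y))) \<partial>lborel) \<partial>?P n)"
  proof (rule nn_integral_cmult)
    have "(\<lambda>x. F (?T (Suc n) x)) \<in> borel_measurable (?P (Suc n))"
      using measurable_comp[OF T[of "Suc n"] Suc.prems(2)] by (simp add: comp_def)
    then have [measurable]: "(\<lambda>x. F (?T (Suc n) x)) \<in> borel_measurable (Pi\<^sub>M (insert n {..<n}) (\<lambda>_. lborel))"
      by (simp add: ins)
    show "(\<lambda>z. \<integral>\<^sup>+ y. F (?T (Suc n) (z(n := y))) \<partial>lborel) \<in> borel_measurable (?P n)"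
      by measurable
  qed
  also have "(\<integral>\<^sup>+ z. (\<integral>\<^sup>+ y. F (?T (Suc n) (z(n := y))) \<partial>lborel) \<partial>?P n) =
      (\<integral>\<^sup>+ z. F (?T (Suc n) z) \<partial>?P (Suc n))"
    unfolding ins
    by (rule lborel_prod.product_nn_integral_insert[symmetric])
      (use measurable_comp[OF T[of "Suc n"] Suc.prems(2)] in \<open>auto simp: comp_def ins\<close>)
  finally have "(\<integral>\<^sup>+ x. F x \<partial>?P (Suc n)) = ennreal (\<Prod>i<n. L i i) * (ennreal (L n n) *
      (\<integral>\<^sup>+ z. F (?T (Suc n) z) \<partial>?P (Suc n)))" .
  moreover have "ennreal (\<Prod>i<Suc n. L i i) = ennreal (\<Prod>i<n. L i i) * ennreal (L n n)"
    unfolding prod.lessThan_Suc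
    by (rule ennreal_mult) (use Suc.prems(1) in \<open>auto intro!: prod_nonneg simp: less_imp_le simp del: prod.lessThan_Suc\<close>)
  ultimately show ?case by (simp only: mult.assoc)
qed

lemma PiM_std_normal:
  "Pi\<^sub>M {..<p::nat} (\<lambda>_. std_normal_distribution) =
     density (Pi\<^sub>M {..<p} (\<lambda>_. lborel)) (\<lambda>z. ennreal (\<Prod>i<p. std_normal_density (z i)))"
proof -
  interpret N: prob_space std_normal_distribution
    by (rule prob_space_normal_density) simp
  interpret product_prob_space "\<lambda>_::nat. std_normal_distribution" "{..<p}"
    by standard
  show ?thesis
  proof (rule PiM_eqI[symmetric])
    show "sets (density (Pi\<^sub>M {..<p} (\<lambda>_. lborel)) (\<lambda>z. ennreal (\<Prod>i<p. std_normal_density (z i)))) =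
      sets (Pi\<^sub>M {..<p} (\<lambda>_. std_normal_distribution))"
      by (simp cong: sets_PiM_cong)
  next
    fix A :: "nat \<Rightarrow> real set" assume "\<And>i. i \<in> {..<p} \<Longrightarrow> A i \<in> sets std_normal_distribution"
    then have A [measurable]: "\<And>i. i \<in> {..<p} \<Longrightarrow> A i \<in> sets borel" by simp
    have "emeasure (density (Pi\<^sub>M {..<p} (\<lambda>_. lborel)) (\<lambda>z. ennreal (\<Prod>i<p. std_normal_density (z i)))) (Pi\<^sub>E {..<p} A)
       = (\<integral>\<^sup>+ z. ennreal (\<Prod>i<p. std_normal_density (z i)) * indicator (Pi\<^sub>E {..<p} A) z \<partial>Pi\<^sub>M {..<p} (\<lambda>_. lborel))"
      by (rule emeasure_density) (use A in \<open>auto intro!: sets_PiM_I_finite\<close>)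
    also have "\<dots> = (\<integral>\<^sup>+ z. (\<Prod>i<p. ennreal (std_normal_density (z i)) * indicator (A i) (z i)) \<partial>Pi\<^sub>M {..<p} (\<lambda>_. lborel))"
    proof (rule nn_integral_cong)
      fix z :: "nat \<Rightarrow> real" assume z: "z \<in> space (Pi\<^sub>M {..<p} (\<lambda>_. lborel))"
      have "(indicator (Pi\<^sub>E {..<p} A) z :: ennreal) = (\<Prod>i<p. indicator (A i) (z i))"
      proof (cases "z \<in> Pi\<^sub>E {..<p} A")
        case True
        then have "\<forall>i<p. z i \<in> A i" by auto
        then show ?thesis using True by simp
      next
        case False
        then obtain i where i: "i < p" "z i \<notin> A i" using z by (auto simp: PiE_iff space_PiM)
        then have "(\<Prod>i<p. indicator (A i) (z i)) = (0 :: ennreal)"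
          by (intro prod_zero) (auto intro!: bexI[of _ i])
        then show ?thesis using False by simp
      qed
      then show "ennreal (\<Prod>i<p. std_normal_density (z i)) * indicator (Pi\<^sub>E {..<p} A) z =
          (\<Prod>i<p. ennreal (std_normal_density (z i)) * indicator (A i) (z i))"
        by (simp add: prod.distrib prod_ennreal)
    qed
    also have "\<dots> = (\<Prod>i<p. \<integral>\<^sup>+ x. ennreal (std_normal_density x) * indicator (A i) x \<partial>lborel)"
      by (rule lborel_prod.product_nn_integral_prod) auto
    also have "\<dots> = (\<Prod>i<p. emeasure std_normal_distribution (A i))"
      by (intro prod.cong refl emeasure_density[symmetric]) auto
    finally show "emeasure (density (Pi\<^sub>M {..<p} (\<lambda>_. lborel)) (\<lambda>z. ennreal (\<Prod>i<p. std_normal_density (z i)))) (Pi\<^sub>E {..<p} A)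
      = (\<Prod>i<p. emeasure std_normal_distribution (A i))" .
  qed simp
qed

text \<open>A sum of independent normal variables. Indices with \<open>c j = 0\<close> are dropped, as their summands
  have no density.\<close>

lemma distributed_linear_form_std_normal:
  assumes "\<exists>j<p. c j \<noteq> 0"
  shows "distributed (Pi\<^sub>M {..<p::nat} (\<lambda>_. std_normal_distribution)) lborel
    (\<lambda>z. \<Sum>j<p. c j * z j) (normal_density 0 (sqrt (\<Sum>j<p. (c j)\<^sup>2)))"
proof -
  interpret N: prob_space std_normal_distribution
    by (rule prob_space_normal_density) simp
  interpret product_prob_space "\<lambda>_::nat. std_normal_distribution" "{..<p}"
    by standard
  let ?P = "Pi\<^sub>M {..<p} (\<lambda>_. std_normal_distribution)"
  let ?J = "{j\<in>{..<p}. c j \<noteq> 0}"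
  have ne: "{..<p} \<noteq> {}" "?J \<noteq> {}" using assms by auto
  have comp: "distr ?P std_normal_distribution (\<lambda>z. z j) = std_normal_distribution" if "j < p" for j
    using that by (intro PiM_component) auto
  have "P.indep_vars (\<lambda>_. std_normal_distribution) (\<lambda>j z. z j) {..<p}"
  proof (subst P.indep_vars_iff_distr_eq_PiM')
    have "distr ?P ?P (\<lambda>x. \<lambda>i\<in>{..<p}. x i) = distr ?P ?P (\<lambda>x. x)"
      by (rule distr_cong) (auto simp: space_PiM PiE_def extensional_restrict)
    also have "\<dots> = (\<Pi>\<^sub>M i\<in>{..<p}. distr ?P std_normal_distribution (\<lambda>z. z i))"
      by (simp, rule PiM_cong) (simp_all add: comp)
    finally show "distr ?P ?P (\<lambda>x. \<lambda>i\<in>{..<p}. x i) =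
      (\<Pi>\<^sub>M i\<in>{..<p}. distr ?P std_normal_distribution (\<lambda>z. z i))" .
  qed (use ne in auto)
  then have "P.indep_vars (\<lambda>_. std_normal_distribution) (\<lambda>j z. z j) ?J"
    by (rule P.indep_vars_subset) auto
  then have ind: "P.indep_vars (\<lambda>_. borel) (\<lambda>j z. c j * z j) ?J"
    by (rule P.indep_vars_compose2) auto
  have "distributed ?P lborel (\<lambda>z. \<Sum>j\<in>?J. c j * z j)
     (normal_density (\<Sum>j\<in>?J. 0) (sqrt (\<Sum>j\<in>?J. \<bar>c j\<bar>\<^sup>2)))"
  proof (rule P.sum_indep_normal)
    fix j assume j: "j \<in> ?J"
    have "distributed ?P lborel (\<lambda>z. z j) std_normal_density"
    proof -
      have "distr ?P lborel (\<lambda>z. z j) = distr ?P std_normal_distribution (\<lambda>z. z j)"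
        by (rule distr_cong) auto
      then show ?thesis using comp[of j] j
        by (auto simp: distributed_def intro!: measurable_component_singleton[of _ "{..<p}" "\<lambda>_. std_normal_distribution", simplified])
    qed
    from P.normal_density_affine[OF this, of "c j" 0] j
    show "distributed ?P lborel (\<lambda>z. c j * z j) (normal_density 0 \<bar>c j\<bar>)" by simp
  qed (use ne ind in auto)
  moreover have "(\<Sum>j\<in>?J. c j * z j) = (\<Sum>j<p. c j * z j)" for z
    by (rule sum.mono_neutral_left) auto
  moreover have "(\<Sum>j\<in>?J. \<bar>c j\<bar>\<^sup>2) = (\<Sum>j<p. (c j)\<^sup>2)"
    unfolding power2_abs by (rule sum.mono_neutral_left) auto
  ultimately show ?thesis by simp
qed

section \<open>Linear forms of a multivariate normal vector\<close>

lemma inj_on_vec: "inj_on (vec p) (space (Pi\<^sub>M {..<p} (\<lambda>_. lborel :: real measure)))"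
proof (rule inj_onI)
  fix x y :: "nat \<Rightarrow> real"
  assume xy: "x \<in> space (Pi\<^sub>M {..<p} (\<lambda>_. lborel))" "y \<in> space (Pi\<^sub>M {..<p} (\<lambda>_. lborel))"
    and eq: "vec p x = vec p y"
  have "x i = y i" if "i < p" for i
    using arg_cong[OF eq, of "\<lambda>v. v $ i"] that by simp
  with xy show "x = y"
    by (auto simp: space_PiM PiE_def intro!: extensionalityI[of _ "{..<p}"])
qed

lemma nn_integral_lborel_vec:
  "g \<in> borel_measurable (lborel_vec p) \<Longrightarrow>
   (\<integral>\<^sup>+ x. g x \<partial>lborel_vec p) = (\<integral>\<^sup>+ z. g (vec p z) \<partial>Pi\<^sub>M {..<p} (\<lambda>_. lborel))"
  unfolding lborel_vec_def by (rule nn_integral_embed_measure'[OF inj_on_vec])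

lemma space_lborel_vec: "space (lborel_vec p) \<subseteq> carrier_vec p"
  by (auto simp: lborel_vec_def space_embed_measure)

lemma measurable_linear_form [measurable]:
  "(\<lambda>x. u \<bullet> x) \<in> borel_measurable (lborel_vec p)"
  unfolding lborel_vec_def
proof (rule measurable_embed_measure1)
  have "(\<lambda>z. u \<bullet> vec p z) = (\<lambda>z. \<Sum>i\<in>{0..<p}. u $ i * z i)"
    by (simp add: scalar_prod_def fun_eq_iff)
  also have "\<dots> \<in> borel_measurable (Pi\<^sub>M {..<p} (\<lambda>_. lborel))"
    by (intro borel_measurable_sum borel_measurable_times borel_measurable_const
        measurable_component_singleton[of _ "{..<p}" "\<lambda>_. lborel", simplified]) auto
  finally show "(\<lambda>z. u \<bullet> vec p z) \<in> borel_measurable (Pi\<^sub>M {..<p} (\<lambda>_. lborel))" .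
qed

lemma mult_transpose_quadratic_form:
  fixes L :: "real mat"
  assumes "L \<in> carrier_mat n k" "u \<in> carrier_vec n" "v \<in> carrier_vec n"
  shows "u \<bullet> ((L * transpose_mat L) *\<^sub>v v) = (transpose_mat L *\<^sub>v u) \<bullet> (transpose_mat L *\<^sub>v v)"
proof -
  have "(L * transpose_mat L) *\<^sub>v v = L *\<^sub>v (transpose_mat L *\<^sub>v v)"
    using assms by (intro assoc_mult_mat_vec) auto
  then show ?thesis
    using scalar_prod_transpose_mult[OF assms(1,2), of "transpose_mat L *\<^sub>v v"] assms by simp
qed

text \<open>For \<open>\<Sigma> = L L\<^sup>T\<close> one has \<open>L\<^sup>T \<Sigma>\<^sup>-\<^sup>1 L = 1\<close>: the map \<open>L\<close> turns the exponent of the density of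
  \<open>N(0, \<Sigma>)\<close> into that of the standard normal distribution.\<close>

lemma cholesky_inverse_quadratic_form:
  assumes L: "lower_triangular_pos p L" and \<Sigma>: "\<Sigma> = L * transpose_mat L" and z: "z \<in> carrier_vec p"
  shows "(L *\<^sub>v z) \<bullet> (inv_mat \<Sigma> *\<^sub>v (L *\<^sub>v z)) = z \<bullet> z"
proof -
  have Lc: "L \<in> carrier_mat p p" using L by (simp add: lower_triangular_pos_def)
  have Sc: "\<Sigma> \<in> carrier_mat p p" using Lc by (simp add: \<Sigma>)
  have "det \<Sigma> = det L * det L"
    unfolding \<Sigma> using det_mult[of L p "transpose_mat L"] det_transpose[OF Lc] Lc by simp
  then have d: "det \<Sigma> \<noteq> 0" "det (transpose_mat L) \<noteq> 0"
    using det_lower_triangular_pos(2)[OF L] det_transpose[OF Lc] by auto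
  note Si = inv_mat_inverts[OF Sc d(1)]
  have Ltc: "transpose_mat L \<in> carrier_mat p p" using Lc by simp
  note Lti = inv_mat_inverts[OF Ltc d(2)]
  define y where "y = inv_mat (transpose_mat L) *\<^sub>v z"
  have y: "y \<in> carrier_vec p" using Lti z by (simp add: y_def)
  have Ly: "transpose_mat L *\<^sub>v y = z"
  proof -
    have "transpose_mat L *\<^sub>v y = (transpose_mat L * inv_mat (transpose_mat L)) *\<^sub>v z"
      unfolding y_def using Ltc Lti(1) z by (intro assoc_mult_mat_vec[symmetric])
    then show ?thesis using Lti z by simp
  qed
  have "\<Sigma> *\<^sub>v y = L *\<^sub>v (transpose_mat L *\<^sub>v y)"
    unfolding \<Sigma> using Lc y by (intro assoc_mult_mat_vec) auto
  then have "L *\<^sub>v z = \<Sigma> *\<^sub>v y" by (simp add: Ly)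
  moreover have "inv_mat \<Sigma> *\<^sub>v (\<Sigma> *\<^sub>v y) = y"
  proof -
    have "inv_mat \<Sigma> *\<^sub>v (\<Sigma> *\<^sub>v y) = (inv_mat \<Sigma> * \<Sigma>) *\<^sub>v y"
      using Sc Si(1) y by (intro assoc_mult_mat_vec[symmetric])
    then show ?thesis using Si y by simp
  qed
  ultimately have "(L *\<^sub>v z) \<bullet> (inv_mat \<Sigma> *\<^sub>v (L *\<^sub>v z)) = (\<Sigma> *\<^sub>v y) \<bullet> y" by simp
  also have "\<dots> = y \<bullet> (\<Sigma> *\<^sub>v y)"
    using Sc y by (intro comm_scalar_prod[of _ p]) auto
  also have "\<dots> = z \<bullet> z"
    unfolding \<Sigma> mult_transpose_quadratic_form[OF Lc y y] Ly ..
  finally show ?thesis .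
qed

lemma mvn_density_cholesky:
  assumes L: "lower_triangular_pos p L" and \<Sigma>: "\<Sigma> = L * transpose_mat L"
  shows "det L * mvn_density \<Sigma> (L *\<^sub>v vec p z) = (\<Prod>i<p. std_normal_density (z i))"
proof -
  have Lc: "L \<in> carrier_mat p p" using L by (simp add: lower_triangular_pos_def)
  have d: "det L > 0" by (rule det_lower_triangular_pos[OF L])
  have "det \<Sigma> = (det L)\<^sup>2"
    unfolding \<Sigma> using det_mult[of L p "transpose_mat L"] det_transpose[OF Lc] Lc
    by (simp add: power2_eq_square)
  then have "sqrt ((2 * pi) ^ dim_row \<Sigma> * det \<Sigma>) = sqrt (2 * pi) ^ p * det L"
    using d Lc by (simp add: \<Sigma> real_sqrt_mult real_sqrt_power power_mult_distrib)
  moreover have "vec p z \<bullet> vec p z = (\<Sum>i<p. (z i)\<^sup>2)"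
    by (simp add: scalar_prod_def atLeast0LessThan power2_eq_square)
  moreover have "(\<Prod>i<p. std_normal_density (z i)) = exp (- (\<Sum>i<p. (z i)\<^sup>2) / 2) / sqrt (2 * pi) ^ p"
    by (simp add: std_normal_density_def prod_dividef exp_sum[symmetric] sum_negf sum_divide_distrib)
  ultimately show ?thesis
    using d by (simp add: mvn_density_def cholesky_inverse_quadratic_form[OF L \<Sigma>])
qed

text \<open>Substituting \<open>x = L z\<close> with the Cholesky factor \<open>L\<close> of \<open>\<Sigma>\<close> shows that \<open>X\<close> has the law of \<open>L Z\<close> with
  independent standard normal coordinates \<open>Z\<close>. Hence \<open>u \<bullet> X\<close> has the law of \<open>(L\<^sup>T u) \<bullet> Z\<close>, whose
  variance is \<open>(L\<^sup>T u) \<bullet> (L\<^sup>T u) = u \<bullet> (\<Sigma> u)\<close>. All later estimates use only these one-dimensional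
  marginals.\<close>

lemma (in prob_space) distributed_linear_form:
  assumes \<Sigma>: "\<Sigma> \<in> carrier_mat p p" "pos_def_mat \<Sigma>"
    and X: "distributed M (lborel_vec p) X (\<lambda>x. ennreal (mvn_density \<Sigma> x))"
    and u: "u \<in> carrier_vec p" "u \<noteq> 0\<^sub>v p"
  shows "distributed M lborel (\<lambda>\<omega>. u \<bullet> X \<omega>) (normal_density 0 (sqrt (u \<bullet> (\<Sigma> *\<^sub>v u))))"
proof -
  obtain L where L: "lower_triangular_pos p L" and SL: "\<Sigma> = L * transpose_mat L"
    using cholesky_decomposition[OF \<Sigma>] by blast
  have Lc: "L \<in> carrier_mat p p" using L by (simp add: lower_triangular_pos_def)
  note X_meas [measurable] = distributed_measurable[OF X]
  note dens_meas [measurable] = distributed_borel_measurable[OF X]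
  define c where "c j = (transpose_mat L *\<^sub>v u) $ j" for j
  let ?P = "Pi\<^sub>M {..<p} (\<lambda>_. lborel :: real measure)"
  let ?T = "\<lambda>z. \<lambda>i\<in>{..<p}. \<Sum>j\<le>i. L $$ (i, j) * z j"
  have T: "vec p (?T z) = L *\<^sub>v vec p z" for z
  proof (rule eq_vecI)
    fix i assume "i < dim_vec (L *\<^sub>v vec p z)"
    then have i: "i < p" using Lc by simp
    have "(\<Sum>j<p. L $$ (i, j) * z j) = (\<Sum>j\<le>i. L $$ (i, j) * z j)"
      by (rule sum.mono_neutral_right) (use i L in \<open>auto simp: lower_triangular_pos_def not_le\<close>)
    then show "vec p (?T z) $ i = (L *\<^sub>v vec p z) $ i"
      using i Lc by (simp add: scalar_prod_def atLeast0LessThan)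
  qed (use Lc in auto)
  have uT: "u \<bullet> (L *\<^sub>v vec p z) = (\<Sum>j<p. c j * z j)" for z
    using scalar_prod_transpose_mult[OF Lc u(1), of "vec p z"] 
    by (simp add: scalar_prod_def atLeast0LessThan c_def)
  have quad: "u \<bullet> (\<Sigma> *\<^sub>v u) = (\<Sum>j<p. (c j)\<^sup>2)"
    unfolding SL mult_transpose_quadratic_form[OF Lc u(1) u(1)]
    using Lc by (simp add: scalar_prod_def atLeast0LessThan c_def power2_eq_square)
  have "u \<bullet> (\<Sigma> *\<^sub>v u) > 0"
    using \<Sigma> u by (auto simp: pos_def_mat_def)
  then have ex: "\<exists>j<p. c j \<noteq> 0"
    unfolding quad by (rule contrapos_pp) auto
  have "distr M lborel (\<lambda>\<omega>. u \<bullet> X \<omega>) =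
      distr (Pi\<^sub>M {..<p} (\<lambda>_. std_normal_distribution)) lborel (\<lambda>z. \<Sum>j<p. c j * z j)"
  proof (rule measure_eqI)
    fix A assume "A \<in> sets (distr M lborel (\<lambda>\<omega>. u \<bullet> X \<omega>))"
    then have A [measurable]: "A \<in> sets borel" by simp
    have "emeasure (distr M lborel (\<lambda>\<omega>. u \<bullet> X \<omega>)) A = (\<integral>\<^sup>+ \<omega>. indicator A (u \<bullet> X \<omega>) \<partial>M)"
      by (subst nn_integral_distr[of _ M lborel, symmetric]) simp_all
    also have "\<dots> = (\<integral>\<^sup>+ x. ennreal (mvn_density \<Sigma> x) * indicator A (u \<bullet> x) \<partial>lborel_vec p)"
      by (rule distributed_nn_integral[OF X, symmetric]) measurable
    also have "\<dots> = (\<integral>\<^sup>+ z. ennreal (mvn_density \<Sigma> (vec p z)) * indicator A (u \<bullet> vec p z) \<partial>?P)"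
      by (rule nn_integral_lborel_vec) measurable
    also have "\<dots> = ennreal (\<Prod>i<p. L $$ (i, i)) *
       (\<integral>\<^sup>+ z. ennreal (mvn_density \<Sigma> (vec p (?T z))) * indicator A (u \<bullet> vec p (?T z)) \<partial>?P)"
    proof (rule nn_integral_lower_triangular)
      have [measurable]: "vec p \<in> measurable ?P (lborel_vec p)"
        unfolding lborel_vec_def by (rule measurable_embed_measure2'[OF inj_on_vec])
      show "(\<lambda>z. ennreal (mvn_density \<Sigma> (vec p z)) * indicator A (u \<bullet> vec p z)) \<in> borel_measurable ?P"
        by measurable
    qed (use L in \<open>auto simp: lower_triangular_pos_def\<close>)
    also have "\<dots> = (\<integral>\<^sup>+ z. ennreal (det L * mvn_density \<Sigma> (L *\<^sub>v vec p z)) *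
        indicator A (\<Sum>j<p. c j * z j) \<partial>?P)"
    proof (subst nn_integral_cmult[symmetric])
      have [measurable]: "(\<lambda>z. mvn_density \<Sigma> (L *\<^sub>v vec p z)) \<in> borel_measurable ?P"
      proof -
        have "(\<lambda>z. mvn_density \<Sigma> (L *\<^sub>v vec p z)) = (\<lambda>z. (\<Prod>i<p. std_normal_density (z i)) / det L)"
          using mvn_density_cholesky[OF L SL] det_lower_triangular_pos(2)[OF L] by (auto simp: field_simps fun_eq_iff)
        then show ?thesis by simp
      qed
      show "(\<lambda>z. ennreal (mvn_density \<Sigma> (vec p (?T z))) * indicator A (u \<bullet> vec p (?T z))) \<in> borel_measurable ?P"
        unfolding T uT by measurable
    qed (use det_lower_triangular_pos[OF L] in \<open>simp only: T uT mult.assoc[symmetric] ennreal_mult'[OF less_imp_le]\<close>)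
    also have "\<dots> = (\<integral>\<^sup>+ z. ennreal (\<Prod>i<p. std_normal_density (z i)) *
        indicator A (\<Sum>j<p. c j * z j) \<partial>?P)"
      by (simp only: mvn_density_cholesky[OF L SL])
    also have "\<dots> = (\<integral>\<^sup>+ z. indicator A (\<Sum>j<p. c j * z j) \<partial>Pi\<^sub>M {..<p} (\<lambda>_. std_normal_distribution))"
      unfolding PiM_std_normal by (rule nn_integral_density[symmetric]) measurable
    also have "\<dots> = (\<integral>\<^sup>+ x. indicator A x \<partial>distr (Pi\<^sub>M {..<p} (\<lambda>_. std_normal_distribution)) lborel (\<lambda>z. \<Sum>j<p. c j * z j))"
      by (rule nn_integral_distr[symmetric])
        (simp_all add: distributed_measurable[OF distributed_linear_form_std_normal[OF ex]])
    also have "\<dots> = emeasure (distr (Pi\<^sub>M {..<p} (\<lambda>_. std_normal_distribution)) lborel (\<lambda>z. \<Sum>j<p. c j * z j)) A"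
      by simp
    finally show "emeasure (distr M lborel (\<lambda>\<omega>. u \<bullet> X \<omega>)) A =
      emeasure (distr (Pi\<^sub>M {..<p} (\<lambda>_. std_normal_distribution)) lborel (\<lambda>z. \<Sum>j<p. c j * z j)) A" .
  qed simp
  then show ?thesis
    using distributed_linear_form_std_normal[OF ex] by (simp add: distributed_def quad)
qed

section \<open>Moments of products of linear forms\<close>

lemma (in prob_space) normal_even_moment:
  assumes "distributed M lborel Y (normal_density 0 \<sigma>)" "0 < \<sigma>"
  shows "integrable M (\<lambda>\<omega>. (Y \<omega>) ^ (2 * k))"
    and "expectation (\<lambda>\<omega>. (Y \<omega>) ^ (2 * k)) = fact (2 * k) / (2 ^ k * fact k) * (\<sigma>\<^sup>2) ^ k"
proof -
  have "(\<lambda>x::real. x ^ (2 * k)) \<in> borel_measurable lborel" by simp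
  note D = distributed_integrable[OF assms(1) this] distributed_integral[OF assms(1) this]
  have i: "integrable lborel (\<lambda>x. normal_density 0 \<sigma> x * x ^ (2 * k))"
    using integrable_normal_moment[OF assms(2), of 0 "2 * k"] by simp
  then show "integrable M (\<lambda>\<omega>. (Y \<omega>) ^ (2 * k))"
    using D(1) by simp
  have "expectation (\<lambda>\<omega>. (Y \<omega>) ^ (2 * k)) = (\<integral>x. normal_density 0 \<sigma> x * x ^ (2 * k) \<partial>lborel)"
    using D(2) by simp
  also have "\<dots> = fact (2 * k) / ((2 / \<sigma>\<^sup>2)^k * fact k)"
    using integral_normal_moment_even[OF assms(2), of 0 k] by simp
  also have "\<dots> = fact (2 * k) / (2 ^ k * fact k) * (\<sigma>\<^sup>2) ^ k"
    using assms(2) by (simp add: power_divide field_simps)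
  finally show "expectation (\<lambda>\<omega>. (Y \<omega>) ^ (2 * k)) = fact (2 * k) / (2 ^ k * fact k) * (\<sigma>\<^sup>2) ^ k" .
qed

lemma le_one_plus_even_power:
  fixes x :: real assumes "k \<le> 2 * m" shows "\<bar>x\<bar> ^ k \<le> 1 + x ^ (2 * m)"
proof (cases "\<bar>x\<bar> \<le> 1")
  case True
  then have "\<bar>x\<bar> ^ k \<le> 1" by (simp add: power_le_one)
  moreover have "0 \<le> x ^ (2 * m)" by (simp add: zero_le_even_power)
  ultimately show ?thesis by linarith
next
  case False
  then have "\<bar>x\<bar> ^ k \<le> \<bar>x\<bar> ^ (2 * m)" using assms by (intro power_increasing) auto
  then show ?thesis by (simp add: power_even_abs)
qed

locale gaussian_sample = prob_space M for M :: "'a measure" +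
  fixes p n :: nat and \<Sigma> :: "real mat" and X :: "nat \<Rightarrow> 'a \<Rightarrow> real vec"
  assumes \<Sigma>_carrier: "\<Sigma> \<in> carrier_mat p p"
    and \<Sigma>_pos_def: "pos_def_mat \<Sigma>"
    and X_indep: "indep_vars (\<lambda>_. lborel_vec p) X {1..n}"
    and X_normal: "\<And>k. k \<in> {1..n} \<Longrightarrow>
      distributed M (lborel_vec p) (X k) (\<lambda>x. ennreal (mvn_density \<Sigma> x))"
    and n_ge_2: "2 \<le> n"
begin

abbreviation cov :: "real vec \<Rightarrow> real vec \<Rightarrow> real" where
  "cov u v \<equiv> u \<bullet> (\<Sigma> *\<^sub>v v)"

lemma cov_sum: "u \<in> carrier_vec p \<Longrightarrow> v \<in> carrier_vec p \<Longrightarrow>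
  cov u v = (\<Sum>i<p. \<Sum>j<p. u $ i * \<Sigma> $$ (i, j) * v $ j)"
  by (rule quadratic_form_sum[OF \<Sigma>_carrier])

lemma \<Sigma>_sym: "i < p \<Longrightarrow> j < p \<Longrightarrow> \<Sigma> $$ (i, j) = \<Sigma> $$ (j, i)"
  using \<Sigma>_pos_def \<Sigma>_carrier unfolding pos_def_mat_def
  by (metis carrier_matD index_transpose_mat(1))

lemma cov_commute:
  assumes "u \<in> carrier_vec p" "v \<in> carrier_vec p" shows "cov u v = cov v u"
proof -
  have "cov u v = (\<Sum>j<p. \<Sum>i<p. u $ i * \<Sigma> $$ (i, j) * v $ j)"
    unfolding cov_sum[OF assms] by (rule sum.swap)
  also have "\<dots> = cov v u"
    unfolding cov_sum[OF assms(2,1)] by (intro sum.cong refl) (simp add: \<Sigma>_sym)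
  finally show ?thesis .
qed

lemma cov_pos: "u \<in> carrier_vec p \<Longrightarrow> u \<noteq> 0\<^sub>v p \<Longrightarrow> 0 < cov u u"
  using \<Sigma>_pos_def \<Sigma>_carrier by (auto simp: pos_def_mat_def)

lemma cov_nonneg: "u \<in> carrier_vec p \<Longrightarrow> 0 \<le> cov u u"
  using cov_pos[of u] \<Sigma>_carrier by (cases "u = 0\<^sub>v p") auto

lemma X_meas [measurable]: "k \<in> {1..n} \<Longrightarrow> X k \<in> measurable M (lborel_vec p)"
  using X_normal distributed_measurable by blast

lemma X_carrier: "k \<in> {1..n} \<Longrightarrow> \<omega> \<in> space M \<Longrightarrow> X k \<omega> \<in> carrier_vec p"
  using measurable_space[OF X_meas] space_lborel_vec by blast

lemma form_meas [measurable]: "k \<in> {1..n} \<Longrightarrow> (\<lambda>\<omega>. u \<bullet> X k \<omega>) \<in> borel_measurable M"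
  using measurable_compose[OF X_meas measurable_linear_form] .

lemma form_normal:
  "k \<in> {1..n} \<Longrightarrow> u \<in> carrier_vec p \<Longrightarrow> u \<noteq> 0\<^sub>v p \<Longrightarrow>
   distributed M lborel (\<lambda>\<omega>. u \<bullet> X k \<omega>) (normal_density 0 (sqrt (cov u u)))"
  using distributed_linear_form[OF \<Sigma>_carrier \<Sigma>_pos_def X_normal] .

lemma form_even_moment:
  assumes "k \<in> {1..n}" "u \<in> carrier_vec p"
  shows "integrable M (\<lambda>\<omega>. (u \<bullet> X k \<omega>) ^ (2 * r))"
    and "expectation (\<lambda>\<omega>. (u \<bullet> X k \<omega>) ^ (2 * r)) = fact (2 * r) / (2 ^ r * fact r) * cov u u ^ r"
proof -
  have "integrable M (\<lambda>\<omega>. (u \<bullet> X k \<omega>) ^ (2 * r)) \<and>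
    expectation (\<lambda>\<omega>. (u \<bullet> X k \<omega>) ^ (2 * r)) = fact (2 * r) / (2 ^ r * fact r) * cov u u ^ r"
  proof (cases "u = 0\<^sub>v p")
    case True
    have "(u \<bullet> X k \<omega>) ^ (2 * r) = 0 ^ (2 * r)" if "\<omega> \<in> space M" for \<omega>
      using X_carrier[OF assms(1) that] True by simp
    then have "integrable M (\<lambda>\<omega>. (u \<bullet> X k \<omega>) ^ (2 * r)) = integrable M (\<lambda>\<omega>. 0 ^ (2 * r) :: real)"
      "expectation (\<lambda>\<omega>. (u \<bullet> X k \<omega>) ^ (2 * r)) = expectation (\<lambda>\<omega>. 0 ^ (2 * r))"
      by (intro Bochner_Integration.integrable_cong Bochner_Integration.integral_cong refl; simp)+
    moreover have "cov u u = 0" using True \<Sigma>_carrier by simp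
    ultimately show ?thesis by (cases r) (auto simp: prob_space)
  next
    case False
    have "sqrt (cov u u) > 0" using cov_pos[OF assms(2) False] by simp
    from normal_even_moment[OF form_normal[OF assms False] this] cov_nonneg[OF assms(2)]
    show ?thesis by simp
  qed
  then show "integrable M (\<lambda>\<omega>. (u \<bullet> X k \<omega>) ^ (2 * r))"
    and "expectation (\<lambda>\<omega>. (u \<bullet> X k \<omega>) ^ (2 * r)) = fact (2 * r) / (2 ^ r * fact r) * cov u u ^ r"
    by auto
qed

lemma form_add:
  assumes "k \<in> {1..n}" "\<omega> \<in> space M" "u \<in> carrier_vec p" "v \<in> carrier_vec p"
  shows "(u + v) \<bullet> X k \<omega> = u \<bullet> X k \<omega> + v \<bullet> X k \<omega>" "(u - v) \<bullet> X k \<omega> = u \<bullet> X k \<omega> - v \<bullet> X k \<omega>"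
  using X_carrier[OF assms(1,2)] assms(3,4)
  by (auto simp: add_scalar_prod_distrib minus_scalar_prod_distrib)

lemma cov_add:
  assumes "u \<in> carrier_vec p" "v \<in> carrier_vec p"
  shows "cov (u + v) (u + v) = cov u u + 2 * cov u v + cov v v"
    and "cov (u - v) (u - v) = cov u u - 2 * cov u v + cov v v"
proof -
  have S: "\<Sigma> *\<^sub>v u \<in> carrier_vec p" "\<Sigma> *\<^sub>v v \<in> carrier_vec p"
    using assms \<Sigma>_carrier by auto
  have "cov (u + v) (u + v) = cov u u + cov u v + (cov v u + cov v v)"
    using assms S \<Sigma>_carrier
    by (simp add: mult_add_distrib_mat_vec[OF \<Sigma>_carrier assms] add_scalar_prod_distrib[of _ p]
        scalar_prod_add_distrib[of _ p])
  then show "cov (u + v) (u + v) = cov u u + 2 * cov u v + cov v v"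
    using cov_commute[OF assms] by simp
  have "cov (u - v) (u - v) = cov u u - cov u v - (cov v u - cov v v)"
    using assms S \<Sigma>_carrier
    by (simp add: mult_minus_distrib_mat_vec[OF \<Sigma>_carrier assms] minus_scalar_prod_distrib[of _ p]
        scalar_prod_minus_distrib[of _ p])
  then show "cov (u - v) (u - v) = cov u u - 2 * cov u v + cov v v"
    using cov_commute[OF assms] by simp
qed

text \<open>Joint moments of the pair of forms come from one-dimensional ones by polarization:
  \<open>4 U V = (U + V)\<^sup>2 - (U - V)\<^sup>2\<close> and \<open>12 U\<^sup>2 V\<^sup>2 = (U + V)\<^sup>4 + (U - V)\<^sup>4 - 2 U\<^sup>4 - 2 V\<^sup>4\<close>. The last
  bound uses \<open>2 U\<^sup>4 V\<^sup>4 \<le> U\<^sup>8 + V\<^sup>8\<close> and the eighth moment \<open>105\<close> of the standard normal law.\<close>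

lemma product_moments:
  assumes k: "k \<in> {1..n}" and u: "u \<in> carrier_vec p" and v: "v \<in> carrier_vec p"
    and unit: "cov u u = 1" "cov v v = 1"
  shows "integrable M (\<lambda>\<omega>. (u \<bullet> X k \<omega>) * (v \<bullet> X k \<omega>))"
    and "expectation (\<lambda>\<omega>. (u \<bullet> X k \<omega>) * (v \<bullet> X k \<omega>)) = cov u v"
    and "integrable M (\<lambda>\<omega>. ((u \<bullet> X k \<omega>) * (v \<bullet> X k \<omega>))\<^sup>2)"
    and "expectation (\<lambda>\<omega>. ((u \<bullet> X k \<omega>) * (v \<bullet> X k \<omega>))\<^sup>2) = 1 + 2 * (cov u v)\<^sup>2"
    and "integrable M (\<lambda>\<omega>. ((u \<bullet> X k \<omega>) * (v \<bullet> X k \<omega>)) ^ 4)"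
    and "expectation (\<lambda>\<omega>. ((u \<bullet> X k \<omega>) * (v \<bullet> X k \<omega>)) ^ 4) \<le> 105"
proof -
  let ?U = "\<lambda>\<omega>. u \<bullet> X k \<omega>" and ?V = "\<lambda>\<omega>. v \<bullet> X k \<omega>"
  have uv: "u + v \<in> carrier_vec p" "u - v \<in> carrier_vec p" using u v by auto
  have m2: "integrable M (\<lambda>\<omega>. (x \<bullet> X k \<omega>)\<^sup>2)" "expectation (\<lambda>\<omega>. (x \<bullet> X k \<omega>)\<^sup>2) = cov x x"
    if "x \<in> carrier_vec p" for x
    using form_even_moment[OF k that, of 1] by simp_all
  have m4: "integrable M (\<lambda>\<omega>. (x \<bullet> X k \<omega>) ^ 4)" "expectation (\<lambda>\<omega>. (x \<bullet> X k \<omega>) ^ 4) = 3 * (cov x x)\<^sup>2"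
    if "x \<in> carrier_vec p" for x
    using form_even_moment[OF k that, of 2] by (simp_all add: fact_numeral)
  have m8: "integrable M (\<lambda>\<omega>. (x \<bullet> X k \<omega>) ^ 8)" "expectation (\<lambda>\<omega>. (x \<bullet> X k \<omega>) ^ 8) = 105 * (cov x x) ^ 4"
    if "x \<in> carrier_vec p" for x
    using form_even_moment[OF k that, of 4] by (simp_all add: fact_numeral)
  have e1: "?U \<omega> * ?V \<omega> = (((u + v) \<bullet> X k \<omega>)\<^sup>2 - ((u - v) \<bullet> X k \<omega>)\<^sup>2) / 4" if "\<omega> \<in> space M" for \<omega>
    unfolding form_add[OF k that u v] by (simp add: power2_eq_square algebra_simps)
  have e2: "(?U \<omega> * ?V \<omega>)\<^sup>2 = (((u + v) \<bullet> X k \<omega>) ^ 4 + ((u - v) \<bullet> X k \<omega>) ^ 4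
      - 2 * (?U \<omega>) ^ 4 - 2 * (?V \<omega>) ^ 4) / 12" if "\<omega> \<in> space M" for \<omega>
    unfolding form_add[OF k that u v] by (simp add: power2_eq_square power4_eq_xxxx algebra_simps)
  have i1: "has_bochner_integral M (\<lambda>\<omega>. ?U \<omega> * ?V \<omega>) (cov u v)"
  proof (subst has_bochner_integral_cong[OF refl e1 refl])
    show "has_bochner_integral M (\<lambda>\<omega>. (((u + v) \<bullet> X k \<omega>)\<^sup>2 - ((u - v) \<bullet> X k \<omega>)\<^sup>2) / 4) (cov u v)"
      using m2[OF uv(1)] m2[OF uv(2)] by (simp add: has_bochner_integral_iff cov_add[OF u v])
  qed
  then show "integrable M (\<lambda>\<omega>. ?U \<omega> * ?V \<omega>)" "expectation (\<lambda>\<omega>. ?U \<omega> * ?V \<omega>) = cov u v"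
    by (auto simp: has_bochner_integral_iff)
  have i2: "has_bochner_integral M (\<lambda>\<omega>. (?U \<omega> * ?V \<omega>)\<^sup>2) (1 + 2 * (cov u v)\<^sup>2)"
  proof (subst has_bochner_integral_cong[OF refl e2 refl])
    show "has_bochner_integral M (\<lambda>\<omega>. (((u + v) \<bullet> X k \<omega>) ^ 4 + ((u - v) \<bullet> X k \<omega>) ^ 4
        - 2 * (?U \<omega>) ^ 4 - 2 * (?V \<omega>) ^ 4) / 12) (1 + 2 * (cov u v)\<^sup>2)"
      using m4[OF uv(1)] m4[OF uv(2)] m4[OF u] m4[OF v]
      by (simp add: has_bochner_integral_iff cov_add[OF u v] unit power2_eq_square algebra_simps)
  qed
  then show "integrable M (\<lambda>\<omega>. (?U \<omega> * ?V \<omega>)\<^sup>2)"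
    "expectation (\<lambda>\<omega>. (?U \<omega> * ?V \<omega>)\<^sup>2) = 1 + 2 * (cov u v)\<^sup>2"
    by (auto simp: has_bochner_integral_iff)
  have le: "(?U \<omega> * ?V \<omega>) ^ 4 \<le> (?U \<omega> ^ 8 + ?V \<omega> ^ 8) / 2" for \<omega>
  proof -
    have "0 \<le> (?U \<omega> ^ 4 - ?V \<omega> ^ 4)\<^sup>2" by simp
    also have "\<dots> = ?U \<omega> ^ 8 + ?V \<omega> ^ 8 - 2 * (?U \<omega> * ?V \<omega>) ^ 4"
      by (simp add: power2_diff power_mult_distrib flip: power_mult)
    finally show ?thesis by simp
  qed
  have int: "integrable M (\<lambda>\<omega>. (?U \<omega> ^ 8 + ?V \<omega> ^ 8) / 2)" using m8[OF u] m8[OF v] by simp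
  show i4: "integrable M (\<lambda>\<omega>. (?U \<omega> * ?V \<omega>) ^ 4)"
    by (rule Bochner_Integration.integrable_bound[OF int])
      (use k le in \<open>auto simp: zero_le_even_power abs_of_nonneg\<close>)
  have "expectation (\<lambda>\<omega>. (?U \<omega> * ?V \<omega>) ^ 4) \<le> expectation (\<lambda>\<omega>. (?U \<omega> ^ 8 + ?V \<omega> ^ 8) / 2)"
    by (rule integral_mono[OF i4 int le])
  also have "\<dots> = 105" using m8[OF u] m8[OF v] by (simp add: unit)
  finally show "expectation (\<lambda>\<omega>. (?U \<omega> * ?V \<omega>) ^ 4) \<le> 105" .
qed

lemma cov_le_1:
  assumes "u \<in> carrier_vec p" "v \<in> carrier_vec p" "cov u u = 1" "cov v v = 1"
  shows "\<bar>cov u v\<bar> \<le> 1"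
  using cov_add[OF assms(1,2)] cov_nonneg[of "u + v"] cov_nonneg[of "u - v"] assms by auto

end

section \<open>Fluctuations of the sample covariance\<close>

text \<open>The variance of a sum of independent centered variables, by induction: each new summand is
  independent of the partial sum, so the cross term has mean zero.\<close>

lemma (in prob_space) square_expectation_sum_indep:
  fixes Y :: "'i \<Rightarrow> 'a \<Rightarrow> real"
  assumes "finite I" "indep_vars (\<lambda>_. borel) Y I"
    and "\<And>k. k \<in> I \<Longrightarrow> integrable M (\<lambda>\<omega>. (Y k \<omega>)\<^sup>2)" "\<And>k. k \<in> I \<Longrightarrow> expectation (Y k) = 0"
  shows "integrable M (\<lambda>\<omega>. (\<Sum>k\<in>I. Y k \<omega>)\<^sup>2)"
    and "expectation (\<lambda>\<omega>. (\<Sum>k\<in>I. Y k \<omega>)\<^sup>2) = (\<Sum>k\<in>I. expectation (\<lambda>\<omega>. (Y k \<omega>)\<^sup>2))"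
proof -
  have "integrable M (\<lambda>\<omega>. (\<Sum>k\<in>I. Y k \<omega>)\<^sup>2) \<and>
    expectation (\<lambda>\<omega>. (\<Sum>k\<in>I. Y k \<omega>)\<^sup>2) = (\<Sum>k\<in>I. expectation (\<lambda>\<omega>. (Y k \<omega>)\<^sup>2))"
    using assms
  proof (induction I rule: finite_induct)
    case empty then show ?case by simp
  next
    case (insert i I)
    let ?S = "\<lambda>\<omega>. \<Sum>k\<in>I. Y k \<omega>"
    have meas: "random_variable borel (Y k)" if "k \<in> insert i I" for k
      using insert.prems(1) that by (auto simp: indep_vars_def2)
    have int: "integrable M (Y k)" if "k \<in> insert i I" for k
      using square_integrable_imp_integrable[OF meas[OF that] insert.prems(2)[OF that]] .
    have sub: "indep_vars (\<lambda>_. borel) Y I"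
      using insert.prems(1) by (rule indep_vars_subset) auto
    have IH: "integrable M (\<lambda>\<omega>. (?S \<omega>)\<^sup>2)"
      "expectation (\<lambda>\<omega>. (?S \<omega>)\<^sup>2) = (\<Sum>k\<in>I. expectation (\<lambda>\<omega>. (Y k \<omega>)\<^sup>2))"
      using insert.IH[OF sub] insert.prems by auto
    have ind: "indep_var borel (Y i) borel ?S"
      using insert by (intro indep_vars_sum)
    have iS: "integrable M ?S" using int by auto
    have prod: "integrable M (\<lambda>\<omega>. Y i \<omega> * ?S \<omega>)" "expectation (\<lambda>\<omega>. Y i \<omega> * ?S \<omega>) = 0"
      using indep_var_integrable[OF ind int iS] indep_var_lebesgue_integral[OF ind int iS]
        insert.prems(3)[of i] by auto
    have eq: "(\<Sum>k\<in>insert i I. Y k \<omega>)\<^sup>2 = (Y i \<omega>)\<^sup>2 + (?S \<omega>)\<^sup>2 + 2 * (Y i \<omega> * ?S \<omega>)" for \<omega>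
      using insert.hyps by (simp add: power2_sum)
    show ?case
      unfolding eq using insert.prems(2)[of i] IH prod insert.hyps by simp
  qed
  then show "integrable M (\<lambda>\<omega>. (\<Sum>k\<in>I. Y k \<omega>)\<^sup>2)"
    and "expectation (\<lambda>\<omega>. (\<Sum>k\<in>I. Y k \<omega>)\<^sup>2) = (\<Sum>k\<in>I. expectation (\<lambda>\<omega>. (Y k \<omega>)\<^sup>2))" by auto
qed

lemma sum_centered_products:
  fixes U V :: "nat \<Rightarrow> real"
  assumes "n > 0"
  shows "(\<Sum>k=1..n. (U k - (\<Sum>l=1..n. U l) / n) * (V k - (\<Sum>l=1..n. V l) / n)) =
    (\<Sum>k=1..n. U k * V k) - n * ((\<Sum>l=1..n. U l) / n * ((\<Sum>l=1..n. V l) / n))"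
proof -
  define a where "a = (\<Sum>l=1..n. U l) / n"
  define b where "b = (\<Sum>l=1..n. V l) / n"
  have s: "(\<Sum>l=1..n. U l) = n * a" "(\<Sum>l=1..n. V l) = n * b"
    using assms by (simp_all add: a_def b_def)
  have "(\<Sum>k=1..n. (U k - a) * (V k - b)) = (\<Sum>k=1..n. U k * V k - a * V k - b * U k + a * b)"
    by (intro sum.cong refl) (simp add: algebra_simps)
  also have "\<dots> = (\<Sum>k=1..n. U k * V k) - n * (a * b)"
    by (simp add: sum.distrib sum_subtractf s[unfolded One_nat_def] flip: sum_distrib_left)
  finally show ?thesis by (simp add: a_def b_def)
qed

lemma sample_cov_carrier [simp]: "sample_cov p n x \<in> carrier_mat p p"
  by (simp add: sample_cov_def)

text \<open>Reduces the sample covariance matrix to two scalar samples, so that the moments of linear forms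
  suffice to control it.\<close>

lemma sample_cov_form:
  assumes x: "\<And>k. k \<in> {1..n} \<Longrightarrow> x k \<in> carrier_vec p" and n: "n > 0"
    and u: "u \<in> carrier_vec p" and v: "v \<in> carrier_vec p"
  shows "u \<bullet> (sample_cov p n x *\<^sub>v v) =
    ((\<Sum>k=1..n. (u \<bullet> x k) * (v \<bullet> x k)) - n * ((\<Sum>k=1..n. u \<bullet> x k) / n * ((\<Sum>k=1..n. v \<bullet> x k) / n))) / (real n - 1)"
proof -
  define d where "d k i = x k $ i - (\<Sum>l=1..n. x l $ i) / n" for k i
  have ent: "sample_cov p n x $$ (i, j) = (\<Sum>k=1..n. d k i * d k j) / (real n - 1)"
    if "i < p" "j < p" for i j
  proof -
    have "outer_prod (x k - sample_mean p n x) (x k - sample_mean p n x) $$ (i, j) = d k i * d k j"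
      if "k \<in> {1..n}" for k
      using x[OF that] \<open>i < p\<close> \<open>j < p\<close> by (simp add: outer_prod_def sample_mean_def d_def)
    then show ?thesis using that by (simp add: sample_cov_def)
  qed
  have form: "(\<Sum>i<p. w $ i * d k i) = w \<bullet> x k - (\<Sum>l=1..n. w \<bullet> x l) / n"
    if w: "w \<in> carrier_vec p" and k: "k \<in> {1..n}" for w k
  proof -
    have wx: "w \<bullet> x l = (\<Sum>i<p. w $ i * x l $ i)" if "l \<in> {1..n}" for l
      using x[OF that] by (simp add: scalar_prod_def atLeast0LessThan)
    have "(\<Sum>i<p. w $ i * (\<Sum>l=1..n. x l $ i)) = (\<Sum>i<p. \<Sum>l=1..n. w $ i * x l $ i)"
      by (simp add: sum_distrib_left)
    also have "\<dots> = (\<Sum>l=1..n. \<Sum>i<p. w $ i * x l $ i)" by (rule sum.swap)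
    also have "\<dots> = (\<Sum>l=1..n. w \<bullet> x l)" by (intro sum.cong refl) (simp add: wx)
    finally have "(\<Sum>i<p. w $ i * ((\<Sum>l=1..n. x l $ i) / n)) = (\<Sum>l=1..n. w \<bullet> x l) / n"
      by (simp add: sum_divide_distrib[symmetric])
    then show ?thesis
      by (simp add: d_def right_diff_distrib sum_subtractf wx[OF k])
  qed
  have "u \<bullet> (sample_cov p n x *\<^sub>v v) = (\<Sum>i<p. \<Sum>j<p. \<Sum>k=1..n. (u $ i * d k i) * (v $ j * d k j)) / (real n - 1)"
    unfolding quadratic_form_sum[OF sample_cov_carrier u v] sum_divide_distrib
    by (intro sum.cong refl)
      (simp add: ent sum_distrib_left sum_distrib_right sum_divide_distrib[symmetric] mult_ac)
  also have "(\<Sum>i<p. \<Sum>j<p. \<Sum>k=1..n. (u $ i * d k i) * (v $ j * d k j)) =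
      (\<Sum>k=1..n. \<Sum>i<p. \<Sum>j<p. (u $ i * d k i) * (v $ j * d k j))"
  proof -
    have "(\<Sum>i<p. \<Sum>j<p. \<Sum>k=1..n. (u $ i * d k i) * (v $ j * d k j)) =
      (\<Sum>i<p. \<Sum>k=1..n. \<Sum>j<p. (u $ i * d k i) * (v $ j * d k j))"
      by (intro sum.cong refl sum.swap)
    also have "\<dots> = (\<Sum>k=1..n. \<Sum>i<p. \<Sum>j<p. (u $ i * d k i) * (v $ j * d k j))"
      by (rule sum.swap)
    finally show ?thesis .
  qed
  also have "\<dots> = (\<Sum>k=1..n. (u \<bullet> x k - (\<Sum>l=1..n. u \<bullet> x l) / n) * (v \<bullet> x k - (\<Sum>l=1..n. v \<bullet> x l) / n))"
    by (intro sum.cong refl) (simp add: form[OF u] form[OF v] flip: sum_product)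
  finally show ?thesis
    unfolding sum_centered_products[OF n] .
qed

context gaussian_sample
begin

definition prod_mean :: "real vec \<Rightarrow> real vec \<Rightarrow> 'a \<Rightarrow> real" where
  "prod_mean u v \<omega> = (\<Sum>k=1..n. (u \<bullet> X k \<omega>) * (v \<bullet> X k \<omega>)) / n"

definition form_mean :: "real vec \<Rightarrow> 'a \<Rightarrow> real" where
  "form_mean u \<omega> = (\<Sum>k=1..n. u \<bullet> X k \<omega>) / n"

definition cov_error :: "real vec \<Rightarrow> real vec \<Rightarrow> 'a \<Rightarrow> real" where
  "cov_error u v \<omega> = u \<bullet> (sample_cov p n (\<lambda>k. X k \<omega>) *\<^sub>v v) - cov u v"

text \<open>Splits the error into the centered average of products, which carries the limit law, and terms
  of order \<open>1 / n\<close>: the effect of dividing by \<open>n - 1\<close> and of subtracting the sample mean.\<close>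

lemma cov_error_eq:
  assumes "\<omega> \<in> space M" "u \<in> carrier_vec p" "v \<in> carrier_vec p"
  shows "cov_error u v \<omega> = (prod_mean u v \<omega> - cov u v)
     + ((prod_mean u v \<omega> - cov u v) - n * (form_mean u \<omega> * form_mean v \<omega>) + cov u v) / (real n - 1)"
proof -
  have "u \<bullet> (sample_cov p n (\<lambda>k. X k \<omega>) *\<^sub>v v) =
      (n * prod_mean u v \<omega> - n * (form_mean u \<omega> * form_mean v \<omega>)) / (real n - 1)"
    using sample_cov_form[of n "\<lambda>k. X k \<omega>" p u v] X_carrier assms n_ge_2
    by (simp add: prod_mean_def form_mean_def)
  also have "\<dots> = prod_mean u v \<omega> + (prod_mean u v \<omega> - n * (form_mean u \<omega> * form_mean v \<omega>)) / (real n - 1)"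
    using n_ge_2 by (simp add: field_simps)
  finally show ?thesis unfolding cov_error_def by simp
qed

lemma prod_mean_meas [measurable]: "prod_mean u v \<in> borel_measurable M"
  unfolding prod_mean_def[abs_def] by (intro borel_measurable_divide borel_measurable_sum borel_measurable_times form_meas borel_measurable_const)

lemma form_mean_meas [measurable]: "form_mean u \<in> borel_measurable M"
  unfolding form_mean_def[abs_def] by (intro borel_measurable_divide borel_measurable_sum form_meas borel_measurable_const)

lemma cov_error_meas [measurable]:
  assumes "u \<in> carrier_vec p" "v \<in> carrier_vec p"
  shows "cov_error u v \<in> borel_measurable M"
  by (subst measurable_cong[OF cov_error_eq[OF _ assms]]) auto

lemma form_indep: "indep_vars (\<lambda>_. borel) (\<lambda>k \<omega>. u \<bullet> X k \<omega>) {1..n}"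
  using X_indep by (rule indep_vars_compose2) auto

lemma product_indep: "indep_vars (\<lambda>_. borel) (\<lambda>k \<omega>. ((u \<bullet> X k \<omega>) * (v \<bullet> X k \<omega>) - c) / d) {1..n}"
  using X_indep by (rule indep_vars_compose2) auto

text \<open>The sum of the forms is again normal, with variance \<open>n\<close>.\<close>

lemma form_mean_moments:
  assumes u: "u \<in> carrier_vec p" and unit: "cov u u = 1"
  shows "integrable M (\<lambda>\<omega>. (form_mean u \<omega>)\<^sup>2)" "expectation (\<lambda>\<omega>. (form_mean u \<omega>)\<^sup>2) = 1 / n"
    and "integrable M (\<lambda>\<omega>. (form_mean u \<omega>) ^ 4)" "expectation (\<lambda>\<omega>. (form_mean u \<omega>) ^ 4) = 3 / (real n)\<^sup>2"
proof -
  have nz: "u \<noteq> 0\<^sub>v p" using unit \<Sigma>_carrier by auto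
  have ne: "{1..n} \<noteq> {}" using n_ge_2 by auto
  have "distributed M lborel (\<lambda>\<omega>. \<Sum>k=1..n. u \<bullet> X k \<omega>) (normal_density (\<Sum>k=1..n. 0) (sqrt (\<Sum>k=1..n. 1\<^sup>2)))"
    by (rule sum_indep_normal) (use ne form_indep form_normal[OF _ u nz] unit in auto)
  then have D: "distributed M lborel (\<lambda>\<omega>. \<Sum>k=1..n. u \<bullet> X k \<omega>) (normal_density 0 (sqrt n))" by simp
  have "sqrt n > 0" using n_ge_2 by simp
  note N = normal_even_moment[OF D this]
  show "integrable M (\<lambda>\<omega>. (form_mean u \<omega>)\<^sup>2)" "expectation (\<lambda>\<omega>. (form_mean u \<omega>)\<^sup>2) = 1 / n"
    using N[of 1] n_ge_2 by (auto simp: form_mean_def power_divide power2_eq_square)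
  show "integrable M (\<lambda>\<omega>. (form_mean u \<omega>) ^ 4)" "expectation (\<lambda>\<omega>. (form_mean u \<omega>) ^ 4) = 3 / (real n)\<^sup>2"
    using N[of 2] n_ge_2 by (auto simp: form_mean_def power_divide fact_numeral power2_eq_square power4_eq_xxxx)
qed

lemma prod_mean_variance:
  assumes u: "u \<in> carrier_vec p" and v: "v \<in> carrier_vec p" and unit: "cov u u = 1" "cov v v = 1"
  shows "integrable M (\<lambda>\<omega>. (prod_mean u v \<omega> - cov u v)\<^sup>2)"
    and "expectation (\<lambda>\<omega>. (prod_mean u v \<omega> - cov u v)\<^sup>2) \<le> 2 / n"
proof -
  let ?Y = "\<lambda>k \<omega>. ((u \<bullet> X k \<omega>) * (v \<bullet> X k \<omega>) - cov u v) / 1"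
  note m = product_moments[OF _ u v unit]
  have sq: "integrable M (\<lambda>\<omega>. (?Y k \<omega>)\<^sup>2)" "expectation (?Y k) = 0"
    "expectation (\<lambda>\<omega>. (?Y k \<omega>)\<^sup>2) = 1 + (cov u v)\<^sup>2" if "k \<in> {1..n}" for k
    using m[OF that] by (simp_all add: power2_diff prob_space) (simp add: power2_eq_square)
  note S = square_expectation_sum_indep[OF _ product_indep sq(1,2)]
  have eq: "(prod_mean u v \<omega> - cov u v)\<^sup>2 = (\<Sum>k=1..n. ?Y k \<omega>)\<^sup>2 / (real n)\<^sup>2" for \<omega>
    using n_ge_2 by (simp add: prod_mean_def sum_subtractf field_simps)
  show "integrable M (\<lambda>\<omega>. (prod_mean u v \<omega> - cov u v)\<^sup>2)"
    unfolding eq using S(1) by simp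
  have "expectation (\<lambda>\<omega>. (prod_mean u v \<omega> - cov u v)\<^sup>2) = (1 + (cov u v)\<^sup>2) / n"
  proof -
    have "(\<Sum>k=1..n. expectation (\<lambda>\<omega>. (?Y k \<omega>)\<^sup>2)) = (\<Sum>k=1..n. 1 + (cov u v)\<^sup>2)"
      by (intro sum.cong refl sq(3))
    then have "expectation (\<lambda>\<omega>. (\<Sum>k=1..n. ?Y k \<omega>)\<^sup>2) = n * (1 + (cov u v)\<^sup>2)"
      using S(2) by simp
    then show ?thesis
      unfolding eq using n_ge_2 by (simp add: power2_eq_square)
  qed
  also have "\<dots> \<le> 2 / n"
    using cov_le_1[OF u v unit] by (intro divide_right_mono) (auto simp: abs_square_le_1)
  finally show "expectation (\<lambda>\<omega>. (prod_mean u v \<omega> - cov u v)\<^sup>2) \<le> 2 / n" .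
qed

text \<open>The order \<open>1 / n\<close> is what matters: summed over the pairs of an orthonormal basis of an
  \<open>s\<close>-dimensional space it gives \<open>s\<^sup>2 / n\<close>, which vanishes for \<open>s = o(\<surd>n)\<close>.\<close>

lemma cov_error_second_moment:
  assumes u: "u \<in> carrier_vec p" and v: "v \<in> carrier_vec p" and unit: "cov u u = 1" "cov v v = 1"
  shows "integrable M (\<lambda>\<omega>. (cov_error u v \<omega>)\<^sup>2)" and "expectation (\<lambda>\<omega>. (cov_error u v \<omega>)\<^sup>2) \<le> 48 / n"
proof -
  let ?b = "\<lambda>\<omega>. 12 * (prod_mean u v \<omega> - cov u v)\<^sup>2 + 6 * (form_mean u \<omega>) ^ 4 + 6 * (form_mean v \<omega>) ^ 4 + 12 / (real n)\<^sup>2"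
  have le: "(cov_error u v \<omega>)\<^sup>2 \<le> ?b \<omega>" if "\<omega> \<in> space M" for \<omega>
  proof -
    define e where "e = prod_mean u v \<omega> - cov u v"
    define x where "x = form_mean u \<omega>" define y where "y = form_mean v \<omega>"
    \<comment> \<open>the factor that makes the sample covariance unbiased; at most \<open>2\<close> since \<open>n \<ge> 2\<close>\<close>
    define r where "r = n / (real n - 1)"
    have r: "0 \<le> r" "r \<le> 2" using n_ge_2 by (auto simp: r_def field_simps)
    have "cov_error u v \<omega> = r * (e - x * y + cov u v / n)"
      unfolding cov_error_eq[OF that u v] r_def e_def x_def y_def using n_ge_2 by (simp add: field_simps)
    then have "(cov_error u v \<omega>)\<^sup>2 = r\<^sup>2 * (e - x * y + cov u v / n)\<^sup>2" by (simp add: power_mult_distrib)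
    also have "\<dots> \<le> 4 * (e - x * y + cov u v / n)\<^sup>2"
      using power_mono[OF r(2,1), of 2] by (intro mult_right_mono) auto
    also have "(e - x * y + cov u v / n)\<^sup>2 \<le> 3 * (e\<^sup>2 + (x * y)\<^sup>2 + (cov u v / n)\<^sup>2)"
    proof -
      have "0 \<le> (e + x * y)\<^sup>2 + (e - cov u v / n)\<^sup>2 + (x * y + cov u v / n)\<^sup>2" by simp
      then show ?thesis by (simp add: power2_eq_square algebra_simps)
    qed
    also have "(x * y)\<^sup>2 \<le> (x ^ 4 + y ^ 4) / 2"
    proof -
      have "0 \<le> (x\<^sup>2 - y\<^sup>2)\<^sup>2" by simp
      then show ?thesis by (simp add: power2_diff power_mult_distrib flip: power_mult)
    qed
    also have "(cov u v / n)\<^sup>2 \<le> 1 / (real n)\<^sup>2"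
      using cov_le_1[OF u v unit] by (simp add: power_divide divide_right_mono abs_square_le_1)
    finally show ?thesis unfolding e_def x_def y_def by (simp add: add_divide_distrib)
  qed
  have int: "integrable M ?b"
    using prod_mean_variance[OF u v unit] form_mean_moments[OF u unit(1)] form_mean_moments[OF v unit(2)] by simp
  show i: "integrable M (\<lambda>\<omega>. (cov_error u v \<omega>)\<^sup>2)"
    by (rule Bochner_Integration.integrable_bound[OF int])
      (use le cov_error_meas[OF u v] in \<open>auto intro!: AE_I2 order_trans[OF _ abs_ge_self]\<close>)
  have "expectation (\<lambda>\<omega>. (cov_error u v \<omega>)\<^sup>2) \<le> expectation ?b"
    by (rule integral_mono[OF i int le])
  also have "\<dots> = 12 * expectation (\<lambda>\<omega>. (prod_mean u v \<omega> - cov u v)\<^sup>2) + 48 / (real n)\<^sup>2"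
    using prod_mean_variance[OF u v unit] form_mean_moments[OF u unit(1)] form_mean_moments[OF v unit(2)]
    by (simp add: prob_space)
  also have "\<dots> \<le> 24 / n + 24 / n"
  proof (rule add_mono)
    show "12 * expectation (\<lambda>\<omega>. (prod_mean u v \<omega> - cov u v)\<^sup>2) \<le> 24 / n"
      using prod_mean_variance(2)[OF u v unit] by simp
    show "48 / (real n)\<^sup>2 \<le> 24 / real n"
      using n_ge_2 by (simp add: power2_eq_square field_simps)
  qed
  finally show "expectation (\<lambda>\<omega>. (cov_error u v \<omega>)\<^sup>2) \<le> 48 / n" by simp
qed

lemma cov_error_linearization:
  assumes u: "u \<in> carrier_vec p" and v: "v \<in> carrier_vec p" and unit: "cov u u = 1" "cov v v = 1"
  shows "integrable M (\<lambda>\<omega>. \<bar>cov_error u v \<omega> - (prod_mean u v \<omega> - cov u v)\<bar>)"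
    and "expectation (\<lambda>\<omega>. \<bar>cov_error u v \<omega> - (prod_mean u v \<omega> - cov u v)\<bar>) \<le> 6 / n"
proof -
  let ?b = "\<lambda>\<omega>. (1 + (prod_mean u v \<omega> - cov u v)\<^sup>2) / n + (form_mean u \<omega>)\<^sup>2 + (form_mean v \<omega>)\<^sup>2 + 2 / n"
  have le: "\<bar>cov_error u v \<omega> - (prod_mean u v \<omega> - cov u v)\<bar> \<le> ?b \<omega>" if "\<omega> \<in> space M" for \<omega>
  proof -
    define e where "e = prod_mean u v \<omega> - cov u v"
    define x where "x = form_mean u \<omega>" define y where "y = form_mean v \<omega>"
    have "\<bar>cov_error u v \<omega> - e\<bar> = \<bar>e - n * (x * y) + cov u v\<bar> / (real n - 1)"
      unfolding cov_error_eq[OF that u v] e_def x_def y_def using n_ge_2 by simp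
    also have "\<dots> \<le> \<bar>e - n * (x * y) + cov u v\<bar> / (n / 2)"
      using n_ge_2 by (intro divide_left_mono) auto
    also have "\<dots> \<le> ((1 + e\<^sup>2) / 2 + n * ((x\<^sup>2 + y\<^sup>2) / 2) + 1) / (n / 2)"
    proof (intro divide_right_mono)
      have "\<bar>e\<bar> \<le> (1 + e\<^sup>2) / 2"
      proof -
        have "0 \<le> (\<bar>e\<bar> - 1)\<^sup>2" by simp
        then show ?thesis by (simp add: power2_diff)
      qed
      moreover have "\<bar>real n * (x * y)\<bar> \<le> n * ((x\<^sup>2 + y\<^sup>2) / 2)"
      proof -
        have "0 \<le> (\<bar>x\<bar> - \<bar>y\<bar>)\<^sup>2" by simp
        then have "\<bar>x * y\<bar> \<le> (x\<^sup>2 + y\<^sup>2) / 2" by (simp add: power2_diff abs_mult)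
        from mult_left_mono[OF this, of "real n"] show ?thesis by (simp add: abs_mult)
      qed
      ultimately show "\<bar>e - n * (x * y) + cov u v\<bar> \<le> (1 + e\<^sup>2) / 2 + n * ((x\<^sup>2 + y\<^sup>2) / 2) + 1"
        using cov_le_1[OF u v unit] by linarith
    qed simp
    also have "\<dots> = (1 + e\<^sup>2) / n + x\<^sup>2 + y\<^sup>2 + 2 / n"
      using n_ge_2 by (simp add: field_simps)
    finally show ?thesis unfolding e_def x_def y_def .
  qed
  have int: "integrable M ?b"
    using prod_mean_variance[OF u v unit] form_mean_moments[OF u unit(1)] form_mean_moments[OF v unit(2)] by simp
  show i: "integrable M (\<lambda>\<omega>. \<bar>cov_error u v \<omega> - (prod_mean u v \<omega> - cov u v)\<bar>)"
    by (rule Bochner_Integration.integrable_bound[OF int])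
      (use le cov_error_meas[OF u v] in \<open>auto intro!: AE_I2 order_trans[OF _ abs_ge_self]\<close>)
  have "expectation (\<lambda>\<omega>. \<bar>cov_error u v \<omega> - (prod_mean u v \<omega> - cov u v)\<bar>) \<le> expectation ?b"
    by (rule integral_mono[OF i int le])
  also have "\<dots> = (1 + expectation (\<lambda>\<omega>. (prod_mean u v \<omega> - cov u v)\<^sup>2)) / n + 4 / n"
    using prod_mean_variance[OF u v unit] form_mean_moments[OF u unit(1)] form_mean_moments[OF v unit(2)]
    by (simp add: prob_space)
  also have "\<dots> \<le> (1 + 1) / n + 4 / n"
  proof -
    have "2 / real n \<le> 1" using n_ge_2 by simp
    then have "expectation (\<lambda>\<omega>. (prod_mean u v \<omega> - cov u v)\<^sup>2) \<le> 1"
      using prod_mean_variance(2)[OF u v unit] by linarith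
    then show ?thesis by (intro add_right_mono divide_right_mono add_left_mono) auto
  qed
  finally show "expectation (\<lambda>\<omega>. \<bar>cov_error u v \<omega> - (prod_mean u v \<omega> - cov u v)\<bar>) \<le> 6 / n" by simp
qed

end

section \<open>Perturbation of the inverse and linearization of the estimator\<close>

lemma form_mult_cols:
  fixes E G :: "real mat"
  assumes "E \<in> carrier_mat r n" "G \<in> carrier_mat n c" "a \<in> carrier_vec r" "z \<in> carrier_vec c"
  shows "a \<bullet> (E *\<^sub>v (G *\<^sub>v z)) = (\<Sum>l<c. (a \<bullet> (E *\<^sub>v col G l)) * z $ l)"
proof -
  have "a \<bullet> (E *\<^sub>v (G *\<^sub>v z)) = a \<bullet> ((E * G) *\<^sub>v z)"
    using assms by (simp add: assoc_mult_mat_vec[of E r n G c z])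
  also have "\<dots> = (transpose_mat (E * G) *\<^sub>v a) \<bullet> z"
    by (rule scalar_prod_transpose_mult) (use assms in auto)
  also have "\<dots> = (\<Sum>l<c. (col (E * G) l \<bullet> a) * z $ l)"
    using assms by (simp add: scalar_prod_def[of _ z] atLeast0LessThan)
  also have "\<dots> = (\<Sum>l<c. (a \<bullet> (E *\<^sub>v col G l)) * z $ l)"
  proof (intro sum.cong refl)
    fix l assume "l \<in> {..<c}"
    then have l: "l < c" by simp
    have c: "col (E * G) l = E *\<^sub>v col G l" by (rule col_mult2[OF assms(1,2) l])
    have "E *\<^sub>v col G l \<in> carrier_vec r" using assms by (auto intro!: mult_mat_vec_carrier[of E r n])
    then show "(col (E * G) l \<bullet> a) * z $ l = (a \<bullet> (E *\<^sub>v col G l)) * z $ l"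
      unfolding c using comm_scalar_prod[OF assms(3)] by simp
  qed
  finally show ?thesis .
qed

text \<open>Passing to the selected coordinates amounts to restricting the bilinear form to the range of
  \<open>B\<close>.\<close>

lemma congruence_form:
  fixes B S :: "real mat"
  assumes "B \<in> carrier_mat p s" "S \<in> carrier_mat p p" "u \<in> carrier_vec s" "v \<in> carrier_vec s"
  shows "u \<bullet> ((transpose_mat B * S * B) *\<^sub>v v) = (B *\<^sub>v u) \<bullet> (S *\<^sub>v (B *\<^sub>v v))"
proof -
  have Bv: "B *\<^sub>v v \<in> carrier_vec p" "S *\<^sub>v (B *\<^sub>v v) \<in> carrier_vec p"
    using assms by (auto intro!: mult_mat_vec_carrier)
  have "(transpose_mat B * S * B) *\<^sub>v v = (transpose_mat B * S) *\<^sub>v (B *\<^sub>v v)"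
    using assms by (intro assoc_mult_mat_vec) auto
  also have "\<dots> = transpose_mat B *\<^sub>v (S *\<^sub>v (B *\<^sub>v v))"
    using assms Bv by (intro assoc_mult_mat_vec) auto
  finally have "(transpose_mat B * S * B) *\<^sub>v v = transpose_mat B *\<^sub>v (S *\<^sub>v (B *\<^sub>v v))" .
  then show ?thesis
    using scalar_prod_transpose_mult[of "transpose_mat B" s p u "S *\<^sub>v (B *\<^sub>v v)"] assms Bv by simp
qed

lemma pos_def_congruence:
  assumes B: "B \<in> carrier_mat p s" and \<Sigma>: "\<Sigma> \<in> carrier_mat p p" "pos_def_mat \<Sigma>"
    and inj: "\<And>v. v \<in> carrier_vec s \<Longrightarrow> v \<noteq> 0\<^sub>v s \<Longrightarrow> B *\<^sub>v v \<noteq> 0\<^sub>v p"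
  shows "pos_def_mat (transpose_mat B * \<Sigma> * B)"
  unfolding pos_def_mat_def
proof (intro conjI ballI impI)
  show "square_mat (transpose_mat B * \<Sigma> * B)" using B by auto
  have S: "transpose_mat \<Sigma> = \<Sigma>" using \<Sigma>(2) by (simp add: pos_def_mat_def)
  have "transpose_mat (transpose_mat B * \<Sigma> * B) = transpose_mat B * transpose_mat (transpose_mat B * \<Sigma>)"
    using B \<Sigma> by (intro transpose_mult) auto
  also have "transpose_mat (transpose_mat B * \<Sigma>) = \<Sigma> * B"
    using transpose_mult[of "transpose_mat B" s p \<Sigma> p] B \<Sigma> S by simp
  also have "transpose_mat B * (\<Sigma> * B) = transpose_mat B * \<Sigma> * B"
    using B \<Sigma> by (intro assoc_mult_mat[symmetric]) auto
  finally show "transpose_mat (transpose_mat B * \<Sigma> * B) = transpose_mat B * \<Sigma> * B" .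
  fix v :: "real vec"
  assume v: "v \<in> carrier_vec (dim_row (transpose_mat B * \<Sigma> * B))" "v \<noteq> 0\<^sub>v (dim_row (transpose_mat B * \<Sigma> * B))"
  then have v': "v \<in> carrier_vec s" "v \<noteq> 0\<^sub>v s" using B by auto
  have "B *\<^sub>v v \<in> carrier_vec p" using B v' by auto
  then show "v \<bullet> ((transpose_mat B * \<Sigma> * B) *\<^sub>v v) > 0"
    unfolding congruence_form[OF B \<Sigma>(1) v'(1) v'(1)] using \<Sigma> inj[OF v'] by (auto simp: pos_def_mat_def)
qed

text \<open>The columns of \<open>L\<^sup>-\<^sup>T\<close>, for the Cholesky factor \<open>L\<close> of \<open>A\<close>, are orthonormal for the inner product
  defined by \<open>A\<close>; the coordinates of \<open>v\<close> in this basis are \<open>L\<^sup>T v\<close>. Working in such a basis whitens the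
  data, and makes the estimates below independent of \<open>\<Sigma>\<close>.\<close>

lemma orthonormal_basis_exists:
  assumes A: "A \<in> carrier_mat s s" "pos_def_mat A"
  shows "\<exists>G \<in> carrier_mat s s. (\<forall>j<s. col G j \<bullet> (A *\<^sub>v col G j) = 1) \<and>
    (\<forall>v \<in> carrier_vec s. v = G *\<^sub>v vec s (\<lambda>j. col G j \<bullet> (A *\<^sub>v v)))"
proof -
  obtain L where L: "lower_triangular_pos s L" and AL: "A = L * transpose_mat L"
    using cholesky_decomposition[OF A] by blast
  have Lc: "L \<in> carrier_mat s s" and Ltc: "transpose_mat L \<in> carrier_mat s s"
    using L by (auto simp: lower_triangular_pos_def)
  have d: "det (transpose_mat L) \<noteq> 0" using det_lower_triangular_pos(2)[OF L] det_transpose[OF Lc] by simp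
  define G where "G = inv_mat (transpose_mat L)"
  have G: "G \<in> carrier_mat s s" and LG: "transpose_mat L * G = 1\<^sub>m s" and GL: "G * transpose_mat L = 1\<^sub>m s"
    using inv_mat_inverts[OF Ltc d] by (simp_all add: G_def)
  have cG: "col G j \<in> carrier_vec s" for j using G by auto
  have LGj: "transpose_mat L *\<^sub>v col G j = unit_vec s j" if "j < s" for j
    using col_mult2[OF Ltc G that] LG that by simp
  have z: "col G j \<bullet> (A *\<^sub>v v) = (transpose_mat L *\<^sub>v v) $ j" if "j < s" "v \<in> carrier_vec s" for j v
    unfolding AL mult_transpose_quadratic_form[OF Lc cG that(2)] LGj[OF that(1)]
    using that Lc by (subst scalar_prod_left_unit) auto
  show ?thesis
  proof (intro bexI[OF _ G] conjI allI ballI impI)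
    fix j assume j: "j < s"
    show "col G j \<bullet> (A *\<^sub>v col G j) = 1"
      unfolding z[OF j cG] LGj[OF j] using j by simp
  next
    fix v :: "real vec" assume v: "v \<in> carrier_vec s"
    have "vec s (\<lambda>j. col G j \<bullet> (A *\<^sub>v v)) = transpose_mat L *\<^sub>v v"
      by (rule eq_vecI) (use Lc v in \<open>auto simp: z simp del: index_mult_mat_vec\<close>)
    moreover have "G *\<^sub>v (transpose_mat L *\<^sub>v v) = v"
      using assoc_mult_mat_vec[OF G Ltc v] GL v by simp
    ultimately show "v = G *\<^sub>v vec s (\<lambda>j. col G j \<bullet> (A *\<^sub>v v))" by simp
  qed
qed

text \<open>Here \<open>E\<close> is the bilinear form of \<open>S - A\<close>, and \<open>G\<close> a basis which is orthonormal for \<open>A\<close>. With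
  \<open>d = S\<^sup>-\<^sup>1 A w - w\<close> one has \<open>S d = - (S - A) w\<close>, hence \<open>(A a) \<bullet> d = - E a w - E a d\<close>. In the basis \<open>G\<close>
  the matrix \<open>S\<close> is the identity plus an error of Frobenius norm at most \<open>1 / 2\<close>; so \<open>S\<close> is
  invertible, and the coordinate vector of \<open>d\<close> has at most twice the norm of the vector with entries
  \<open>E g\<^sub>j w\<close>, where \<open>g\<^sub>j\<close> are the columns of \<open>G\<close>. The term \<open>E a d\<close> is
  therefore quadratic in the error.\<close>

lemma inverse_perturbation:
  fixes A S G :: "real mat"
  assumes A: "A \<in> carrier_mat s s" "transpose_mat A = A" and S: "S \<in> carrier_mat s s"
    and G: "G \<in> carrier_mat s s"
    and basis: "\<And>v. v \<in> carrier_vec s \<Longrightarrow> v = G *\<^sub>v vec s (\<lambda>j. col G j \<bullet> (A *\<^sub>v v))"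
    and E: "\<And>u v. E u v = u \<bullet> (S *\<^sub>v v) - u \<bullet> (A *\<^sub>v v)"
    and small: "(\<Sum>j<s. \<Sum>l<s. (E (col G j) (col G l))\<^sup>2) \<le> 1 / 4"
    and a: "a \<in> carrier_vec s" and w: "w \<in> carrier_vec s"
  shows "\<bar>(A *\<^sub>v a) \<bullet> (inv_mat S *\<^sub>v (A *\<^sub>v w) - w) + E a w\<bar> \<le>
    (\<Sum>j<s. (E a (col G j))\<^sup>2) + (\<Sum>j<s. (E (col G j) w)\<^sup>2)"
proof -
  define c where "c v = vec s (\<lambda>j. col G j \<bullet> (A *\<^sub>v v))" for v
  have cc: "c v \<in> carrier_vec s" for v by (simp add: c_def)
  have cG: "col G j \<in> carrier_vec s" for j using G by auto
  have expand: "E u v = (\<Sum>l<s. E u (col G l) * c v $ l)"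
    if u: "u \<in> carrier_vec s" and v: "v \<in> carrier_vec s" for u v
  proof -
    have "E u v = E u (G *\<^sub>v c v)" using basis[OF v] by (simp add: c_def)
    also have "\<dots> = (\<Sum>l<s. (u \<bullet> (S *\<^sub>v col G l)) * c v $ l) - (\<Sum>l<s. (u \<bullet> (A *\<^sub>v col G l)) * c v $ l)"
      unfolding E form_mult_cols[OF S G u cc] form_mult_cols[OF A(1) G u cc] ..
    also have "\<dots> = (\<Sum>l<s. E u (col G l) * c v $ l)"
      by (simp add: E sum_subtractf left_diff_distrib)
    finally show ?thesis .
  qed
  \<comment> \<open>\<open>c v\<close> differs from the vector with entries \<open>g\<^sub>j \<bullet> (S v)\<close> by an error of at most half its own norm,
    which is absorbed into the left-hand side\<close>
  have stable: "(\<Sum>j<s. (c v $ j)\<^sup>2) \<le> 4 * (\<Sum>j<s. (col G j \<bullet> (S *\<^sub>v v))\<^sup>2)"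
    if v: "v \<in> carrier_vec s" for v
  proof -
    let ?r = "\<lambda>j. col G j \<bullet> (S *\<^sub>v v)"
    let ?z = "\<Sum>j<s. (c v $ j)\<^sup>2"
    have z0: "0 \<le> ?z" by (intro sum_nonneg) simp
    have "(\<Sum>j<s. (E (col G j) v)\<^sup>2) \<le> (\<Sum>j<s. (\<Sum>l<s. (E (col G j) (col G l))\<^sup>2) * ?z)"
      unfolding expand[OF cG v] by (intro sum_mono Cauchy_Schwarz_ineq_sum)
    also have "\<dots> \<le> 1 / 4 * ?z"
      unfolding sum_distrib_right[symmetric] by (rule mult_right_mono[OF small z0])
    finally have D: "(\<Sum>j<s. (E (col G j) v)\<^sup>2) \<le> 1 / 4 * ?z" .
    have "?z \<le> (\<Sum>j<s. 2 * (?r j)\<^sup>2 + 2 * (E (col G j) v)\<^sup>2)"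
    proof (intro sum_mono)
      fix j assume "j \<in> {..<s}"
      then have "c v $ j = ?r j - E (col G j) v" by (simp add: c_def E)
      moreover have "(x - y)\<^sup>2 \<le> 2 * x\<^sup>2 + 2 * y\<^sup>2" for x y :: real
      proof -
        have "0 \<le> (x + y)\<^sup>2" by simp
        then show ?thesis by (simp add: power2_sum power2_diff)
      qed
      ultimately show "(c v $ j)\<^sup>2 \<le> 2 * (?r j)\<^sup>2 + 2 * (E (col G j) v)\<^sup>2" by simp
    qed
    then have "?z \<le> 2 * (\<Sum>j<s. (?r j)\<^sup>2) + 2 * (\<Sum>j<s. (E (col G j) v)\<^sup>2)"
      by (simp add: sum.distrib sum_distrib_left)
    with D show ?thesis by linarith
  qed
  have "det S \<noteq> 0"
  proof
    assume "det S = 0"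
    then obtain v where v: "v \<in> carrier_vec s" "v \<noteq> 0\<^sub>v s" "S *\<^sub>v v = 0\<^sub>v s"
      using det_0_iff_vec_prod_zero[OF S] by blast
    have "(\<Sum>j<s. (c v $ j)\<^sup>2) \<le> 0"
      using stable[OF v(1)] v(3) cG by simp
    then have "c v $ j = 0" if "j < s" for j
      using sum_nonneg_eq_0_iff[of "{..<s}" "\<lambda>j. (c v $ j)\<^sup>2"] sum_nonneg[of "{..<s}" "\<lambda>j. (c v $ j)\<^sup>2"] that
      by auto
    then have "c v = 0\<^sub>v s" using cc by (intro eq_vecI) auto
    then have "v = G *\<^sub>v 0\<^sub>v s"
      using basis[OF v(1)] by (simp add: c_def)
    also have "\<dots> = 0\<^sub>v s"
      by (rule mult_mat_zero_vec[OF G])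
    finally have "v = 0\<^sub>v s" .
    with v show False by simp
  qed
  note Si = inv_mat_inverts[OF S this]
  define d where "d = inv_mat S *\<^sub>v (A *\<^sub>v w) - w"
  have Aw: "A *\<^sub>v w \<in> carrier_vec s" "S *\<^sub>v w \<in> carrier_vec s" using A S w by auto
  have d: "d \<in> carrier_vec s" using Si(1) Aw w by (auto simp: d_def)
  have "S *\<^sub>v (inv_mat S *\<^sub>v (A *\<^sub>v w)) = (S * inv_mat S) *\<^sub>v (A *\<^sub>v w)"
    using S Si(1) Aw by (intro assoc_mult_mat_vec[symmetric]) auto
  then have "S *\<^sub>v (inv_mat S *\<^sub>v (A *\<^sub>v w)) = A *\<^sub>v w" using Si(2) Aw by simp
  then have Sd: "S *\<^sub>v d = A *\<^sub>v w - S *\<^sub>v w"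
    unfolding d_def using mult_minus_distrib_mat_vec[OF S _ w] Si(1) Aw by simp
  have uSd: "u \<bullet> (S *\<^sub>v d) = - E u w" if "u \<in> carrier_vec s" for u
    unfolding Sd E using that Aw by (simp add: scalar_prod_minus_distrib[of _ s])
  have "(A *\<^sub>v a) \<bullet> d = a \<bullet> (A *\<^sub>v d)"
    using scalar_prod_transpose_mult[OF A(1) a d] A(2) by simp
  also have "\<dots> = - E a w - E a d"
    using uSd[OF a] by (simp add: E[of a d])
  finally have "\<bar>(A *\<^sub>v a) \<bullet> d + E a w\<bar> = \<bar>\<Sum>l<s. E a (col G l) * c d $ l\<bar>"
    using expand[OF a d] by simp
  also have "\<dots> \<le> (\<Sum>l<s. \<bar>E a (col G l) * c d $ l\<bar>)" by (rule sum_abs)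
  also have "\<dots> \<le> (\<Sum>l<s. (E a (col G l))\<^sup>2 + 1 / 4 * (c d $ l)\<^sup>2)"
  proof (intro sum_mono)
    fix l
    have "0 \<le> (\<bar>E a (col G l)\<bar> - \<bar>c d $ l\<bar> / 2)\<^sup>2" by simp
    then show "\<bar>E a (col G l) * c d $ l\<bar> \<le> (E a (col G l))\<^sup>2 + 1 / 4 * (c d $ l)\<^sup>2"
      by (simp add: power2_diff abs_mult power_divide)
  qed
  also have "\<dots> = (\<Sum>l<s. (E a (col G l))\<^sup>2) + 1 / 4 * (\<Sum>l<s. (c d $ l)\<^sup>2)"
    by (simp add: sum.distrib sum_distrib_left)
  also have "1 / 4 * (\<Sum>l<s. (c d $ l)\<^sup>2) \<le> (\<Sum>j<s. (E (col G j) w)\<^sup>2)"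
    using stable[OF d] by (simp add: uSd[OF cG])
  finally show ?thesis by (simp add: d_def)
qed

context gaussian_sample
begin

text \<open>Apart from the event that the Frobenius norm of the whitened error exceeds \<open>1 / 2\<close>, the
  deviation of the estimator from minus the centered average of products is bounded by a variable
  \<open>W\<close> made of \<open>2 s\<close> squared errors, each of mean at most \<open>48 / n\<close>, and of the remainder in
  \<open>cov_error_linearization\<close>. Both the event and the size of \<open>W\<close> are controlled by Markov's
  inequality.\<close>

lemma estimator_linearization:
  fixes B s
  defines "\<Sigma>\<^sub>B \<equiv> transpose_mat B * \<Sigma> * B"
  assumes B: "B \<in> carrier_mat p s"
    and inj: "\<And>v. v \<in> carrier_vec s \<Longrightarrow> v \<noteq> 0\<^sub>v s \<Longrightarrow> B *\<^sub>v v \<noteq> 0\<^sub>v p"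
    and a: "a \<in> carrier_vec s" and w: "w \<in> carrier_vec s"
    and unit: "cov (B *\<^sub>v a) (B *\<^sub>v a) = 1" "cov (B *\<^sub>v w) (B *\<^sub>v w) = 1"
    and t: "t > 0"
  shows "prob {\<omega> \<in> space M. t < \<bar>(\<Sigma>\<^sub>B *\<^sub>v a) \<bullet>
      (inv_mat (transpose_mat B * sample_cov p n (\<lambda>k. X k \<omega>) * B) *\<^sub>v (\<Sigma>\<^sub>B *\<^sub>v w) - w)
      + (prod_mean (B *\<^sub>v a) (B *\<^sub>v w) \<omega> - cov (B *\<^sub>v a) (B *\<^sub>v w))\<bar>}
    \<le> (6 + 96 * real s) / (real n * t) + 192 * (real s)\<^sup>2 / real n"
proof -
  have Sc: "\<Sigma>\<^sub>B \<in> carrier_mat s s" using B \<Sigma>_carrier by (auto simp: \<Sigma>\<^sub>B_def intro!: mult_carrier_mat)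
  have pd: "pos_def_mat \<Sigma>\<^sub>B"
    unfolding \<Sigma>\<^sub>B_def by (rule pos_def_congruence[OF B \<Sigma>_carrier \<Sigma>_pos_def inj])
  then have sym: "transpose_mat \<Sigma>\<^sub>B = \<Sigma>\<^sub>B" by (simp add: pos_def_mat_def)
  obtain G where G: "G \<in> carrier_mat s s" and G1: "\<And>j. j < s \<Longrightarrow> col G j \<bullet> (\<Sigma>\<^sub>B *\<^sub>v col G j) = 1"
    and basis: "\<And>v. v \<in> carrier_vec s \<Longrightarrow> v = G *\<^sub>v vec s (\<lambda>j. col G j \<bullet> (\<Sigma>\<^sub>B *\<^sub>v v))"
    using orthonormal_basis_exists[OF Sc pd] by blast
  have cG: "col G j \<in> carrier_vec s" for j using G by auto
  let ?u = "B *\<^sub>v a" and ?v = "B *\<^sub>v w"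
  define g where "g j = B *\<^sub>v col G j" for j
  have u: "?u \<in> carrier_vec p" and v: "?v \<in> carrier_vec p" and g: "g j \<in> carrier_vec p" for j
    using B a w cG[of j] by (auto simp: g_def)
  have g1: "cov (g j) (g j) = 1" if "j < s" for j
    using G1[OF that] congruence_form[OF B \<Sigma>_carrier cG cG] by (simp add: g_def \<Sigma>\<^sub>B_def)
  define T where "T \<omega> = (\<Sigma>\<^sub>B *\<^sub>v a) \<bullet>
      (inv_mat (transpose_mat B * sample_cov p n (\<lambda>k. X k \<omega>) * B) *\<^sub>v (\<Sigma>\<^sub>B *\<^sub>v w) - w)" for \<omega>
  define R where "R \<omega> = T \<omega> + (prod_mean ?u ?v \<omega> - cov ?u ?v)" for \<omega>
  define F where "F \<omega> = (\<Sum>j<s. \<Sum>l<s. (cov_error (g j) (g l) \<omega>)\<^sup>2)" for \<omega>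
  define W where "W \<omega> = \<bar>cov_error ?u ?v \<omega> - (prod_mean ?u ?v \<omega> - cov ?u ?v)\<bar>
      + (\<Sum>j<s. (cov_error ?u (g j) \<omega>)\<^sup>2) + (\<Sum>j<s. (cov_error (g j) ?v \<omega>)\<^sup>2)" for \<omega>
  have bound: "\<bar>R \<omega>\<bar> \<le> W \<omega>" if "F \<omega> \<le> 1 / 4" for \<omega>
  proof -
    have E: "cov_error (B *\<^sub>v x) (B *\<^sub>v y) \<omega> = x \<bullet> ((transpose_mat B * sample_cov p n (\<lambda>k. X k \<omega>) * B) *\<^sub>v y)
      - x \<bullet> (\<Sigma>\<^sub>B *\<^sub>v y)" if "x \<in> carrier_vec s" "y \<in> carrier_vec s" for x y
      unfolding cov_error_def \<Sigma>\<^sub>B_def congruence_form[OF B \<Sigma>_carrier that]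
      by (subst congruence_form[OF B sample_cov_carrier that]) simp
    let ?E = "\<lambda>x y. x \<bullet> ((transpose_mat B * sample_cov p n (\<lambda>k. X k \<omega>) * B) *\<^sub>v y) - x \<bullet> (\<Sigma>\<^sub>B *\<^sub>v y)"
    have "\<bar>T \<omega> + ?E a w\<bar> \<le> (\<Sum>j<s. (?E a (col G j))\<^sup>2) + (\<Sum>j<s. (?E (col G j) w)\<^sup>2)"
      unfolding T_def
    proof (rule inverse_perturbation[OF Sc sym _ G basis _ _ a w])
      show "transpose_mat B * sample_cov p n (\<lambda>k. X k \<omega>) * B \<in> carrier_mat s s"
        using B by (auto intro!: mult_carrier_mat)
      show "(\<Sum>j<s. \<Sum>l<s. (?E (col G j) (col G l))\<^sup>2) \<le> 1 / 4"
        using that by (simp add: F_def g_def E[OF cG cG])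
    qed auto
    then have "\<bar>T \<omega> + cov_error ?u ?v \<omega>\<bar> \<le> (\<Sum>j<s. (cov_error ?u (g j) \<omega>)\<^sup>2) + (\<Sum>j<s. (cov_error (g j) ?v \<omega>)\<^sup>2)"
      by (simp add: g_def E[OF a w] E[OF a cG] E[OF cG w])
    then show ?thesis unfolding R_def W_def by linarith
  qed
  have F_int: "integrable M F"
    unfolding F_def[abs_def] by (intro Bochner_Integration.integrable_sum cov_error_second_moment(1) g g1) auto
  have F_E: "expectation F \<le> 48 * (real s)\<^sup>2 / n"
  proof -
    have "expectation F = (\<Sum>j<s. \<Sum>l<s. expectation (\<lambda>\<omega>. (cov_error (g j) (g l) \<omega>)\<^sup>2))"
      unfolding F_def[abs_def]
      by (subst Bochner_Integration.integral_sum; (intro sum.cong refl Bochner_Integration.integral_sum Bochner_Integration.integrable_sum cov_error_second_moment(1) g g1)?) auto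
    also have "\<dots> \<le> (\<Sum>j<s. \<Sum>l<s. 48 / n)"
      by (intro sum_mono cov_error_second_moment(2) g g1) auto
    finally show ?thesis by (simp add: power2_eq_square mult_ac)
  qed
  have W_int: "integrable M W"
    unfolding W_def[abs_def]
    by (intro Bochner_Integration.integrable_add Bochner_Integration.integrable_sum
        cov_error_second_moment(1) cov_error_linearization(1) g g1 u v unit) auto
  have W_E: "expectation W \<le> (6 + 96 * real s) / n"
  proof -
    have "expectation W = expectation (\<lambda>\<omega>. \<bar>cov_error ?u ?v \<omega> - (prod_mean ?u ?v \<omega> - cov ?u ?v)\<bar>)
       + (\<Sum>j<s. expectation (\<lambda>\<omega>. (cov_error ?u (g j) \<omega>)\<^sup>2)) + (\<Sum>j<s. expectation (\<lambda>\<omega>. (cov_error (g j) ?v \<omega>)\<^sup>2))"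
    proof -
      have I1: "integrable M (\<lambda>\<omega>. \<bar>cov_error ?u ?v \<omega> - (prod_mean ?u ?v \<omega> - cov ?u ?v)\<bar>)"
        by (rule cov_error_linearization(1)[OF u v unit])
      have I2: "integrable M (\<lambda>\<omega>. (cov_error ?u (g j) \<omega>)\<^sup>2)" if "j \<in> {..<s}" for j
        using that by (intro cov_error_second_moment(1) g g1 u unit) auto
      have I3: "integrable M (\<lambda>\<omega>. (cov_error (g j) ?v \<omega>)\<^sup>2)" if "j \<in> {..<s}" for j
        using that by (intro cov_error_second_moment(1) g g1 v unit) auto
      have S2: "integrable M (\<lambda>\<omega>. \<Sum>j<s. (cov_error ?u (g j) \<omega>)\<^sup>2)"
        by (rule Bochner_Integration.integrable_sum) (rule I2)
      have S3: "integrable M (\<lambda>\<omega>. \<Sum>j<s. (cov_error (g j) ?v \<omega>)\<^sup>2)"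
        by (rule Bochner_Integration.integrable_sum) (rule I3)
      have E2: "expectation (\<lambda>\<omega>. \<Sum>j<s. (cov_error ?u (g j) \<omega>)\<^sup>2) = (\<Sum>j<s. expectation (\<lambda>\<omega>. (cov_error ?u (g j) \<omega>)\<^sup>2))"
        by (rule Bochner_Integration.integral_sum) (rule I2)
      have E3: "expectation (\<lambda>\<omega>. \<Sum>j<s. (cov_error (g j) ?v \<omega>)\<^sup>2) = (\<Sum>j<s. expectation (\<lambda>\<omega>. (cov_error (g j) ?v \<omega>)\<^sup>2))"
        by (rule Bochner_Integration.integral_sum) (rule I3)
      show ?thesis
        unfolding W_def[abs_def] E2[symmetric] E3[symmetric]
          Bochner_Integration.integral_add[OF Bochner_Integration.integrable_add[OF I1 S2] S3]
          Bochner_Integration.integral_add[OF I1 S2] ..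
    qed
    also have "\<dots> \<le> 6 / n + (\<Sum>j<s. 48 / n) + (\<Sum>j<s. 48 / n)"
      by (intro add_mono sum_mono cov_error_second_moment(2) cov_error_linearization(2) g g1 u v unit) auto
    finally show ?thesis by (simp add: add_divide_distrib mult_ac)
  qed
  have W0: "0 \<le> W \<omega>" and F0: "0 \<le> F \<omega>" for \<omega> by (auto simp: W_def F_def intro!: add_nonneg_nonneg sum_nonneg)
  have [measurable]: "W \<in> borel_measurable M" "F \<in> borel_measurable M" using W_int F_int by auto
  have "prob {\<omega> \<in> space M. t < \<bar>R \<omega>\<bar>} \<le> prob ({\<omega> \<in> space M. W \<omega> \<ge> t} \<union> {\<omega> \<in> space M. F \<omega> \<ge> 1 / 4})"
  proof (rule finite_measure_mono)
    show "{\<omega> \<in> space M. t < \<bar>R \<omega>\<bar>} \<subseteq> {\<omega> \<in> space M. W \<omega> \<ge> t} \<union> {\<omega> \<in> space M. F \<omega> \<ge> 1 / 4}"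
    proof
      fix \<omega> assume "\<omega> \<in> {\<omega> \<in> space M. t < \<bar>R \<omega>\<bar>}"
      then show "\<omega> \<in> {\<omega> \<in> space M. W \<omega> \<ge> t} \<union> {\<omega> \<in> space M. F \<omega> \<ge> 1 / 4}"
        using bound[of \<omega>] by (cases "F \<omega> \<le> 1 / 4") auto
    qed
    show "{\<omega> \<in> space M. W \<omega> \<ge> t} \<union> {\<omega> \<in> space M. F \<omega> \<ge> 1 / 4} \<in> events"
      by measurable
  qed
  also have "\<dots> \<le> prob {\<omega> \<in> space M. W \<omega> \<ge> t} + prob {\<omega> \<in> space M. F \<omega> \<ge> 1 / 4}"
    by (rule measure_Un_le) auto
  also have "prob {\<omega> \<in> space M. W \<omega> \<ge> t} \<le> expectation W / t"
    by (rule integral_Markov_inequality_measure[OF W_int]) (use W0 t in auto)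
  also have "prob {\<omega> \<in> space M. F \<omega> \<ge> 1 / 4} \<le> expectation F / (1 / 4)"
    by (rule integral_Markov_inequality_measure[OF F_int]) (use F0 in auto)
  also have "expectation W / t \<le> (6 + 96 * real s) / n / t"
    using W_E t by (intro divide_right_mono) auto
  also have "expectation F / (1 / 4) \<le> 192 * (real s)\<^sup>2 / n" using F_E by simp
  finally show ?thesis by (simp add: R_def T_def)
qed

end

section \<open>A triangular central limit theorem and its perturbation\<close>

lemma cmod_iexp_diff_le: "cmod (iexp a - iexp b) \<le> \<bar>a - b\<bar>"
proof -
  have "iexp a - iexp b = iexp b * (iexp (a - b) - 1)"
    by (simp add: algebra_simps flip: exp_add)
  then have "cmod (iexp a - iexp b) = cmod (iexp (a - b) - 1)"
    by (simp add: norm_mult)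
  also have "\<dots> \<le> \<bar>a - b\<bar>" using iexp_approx1[of "a - b" 0] by simp
  finally show ?thesis .
qed

text \<open>The integrand \<open>e\<^sup>i\<^sup>t\<^sup>Y - e\<^sup>i\<^sup>t\<^sup>Z\<close> is bounded by \<open>\<bar>t\<bar> \<epsilon>\<close> where \<open>\<bar>Y - Z\<bar> \<le> \<epsilon>\<close>, and by \<open>2\<close> elsewhere.\<close>

lemma (in prob_space) char_perturbation:
  assumes [measurable]: "random_variable borel Y" "random_variable borel Z" and "0 \<le> \<epsilon>"
  shows "cmod (char (distr M borel Y) t - char (distr M borel Z) t) \<le>
    \<bar>t\<bar> * \<epsilon> + 2 * prob {\<omega> \<in> space M. \<epsilon> < \<bar>Y \<omega> - Z \<omega>\<bar>}"
proof -
  let ?A = "{\<omega> \<in> space M. \<epsilon> < \<bar>Y \<omega> - Z \<omega>\<bar>}"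
  have int: "integrable M (\<lambda>\<omega>. iexp (t * Y \<omega>))" "integrable M (\<lambda>\<omega>. iexp (t * Z \<omega>))"
    by (auto intro!: integrable_iexp)
  have "char (distr M borel Y) t - char (distr M borel Z) t = (CLINT \<omega>|M. iexp (t * Y \<omega>) - iexp (t * Z \<omega>))"
    using int by (simp add: char_def integral_distr)
  also have "cmod \<dots> \<le> expectation (\<lambda>\<omega>. cmod (iexp (t * Y \<omega>) - iexp (t * Z \<omega>)))"
    by (rule integral_norm_bound)
  also have "\<dots> \<le> expectation (\<lambda>\<omega>. \<bar>t\<bar> * \<epsilon> + 2 * indicator ?A \<omega>)"
  proof (rule integral_mono)
    show "integrable M (\<lambda>\<omega>. \<bar>t\<bar> * \<epsilon> + 2 * indicator ?A \<omega>)"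
      by (intro Bochner_Integration.integrable_add integrable_const integrable_mult_right
          integrable_real_indicator) (auto simp: emeasure_eq_measure)
    fix \<omega> assume w: "\<omega> \<in> space M"
    show "cmod (iexp (t * Y \<omega>) - iexp (t * Z \<omega>)) \<le> \<bar>t\<bar> * \<epsilon> + 2 * indicator ?A \<omega>"
    proof (cases "\<omega> \<in> ?A")
      case True
      have "cmod (iexp (t * Y \<omega>) - iexp (t * Z \<omega>)) \<le> 2"
        using norm_triangle_ineq4[of "iexp (t * Y \<omega>)" "iexp (t * Z \<omega>)"] by simp
      then show ?thesis using True assms(3) by (simp add: add_increasing)
    next
      case False
      have "cmod (iexp (t * Y \<omega>) - iexp (t * Z \<omega>)) \<le> \<bar>t\<bar> * \<bar>Y \<omega> - Z \<omega>\<bar>"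
        using cmod_iexp_diff_le[of "t * Y \<omega>" "t * Z \<omega>"] by (simp add: abs_mult flip: right_diff_distrib)
      also have "\<dots> \<le> \<bar>t\<bar> * \<epsilon>" using False w by (intro mult_left_mono) auto
      finally show ?thesis using False by simp
    qed
  qed (use int in auto)
  also have "\<dots> = \<bar>t\<bar> * \<epsilon> + 2 * prob ?A"
  proof -
    have "integrable M (\<lambda>\<omega>. 2 * indicator ?A \<omega> :: real)"
      by (intro integrable_mult_right integrable_real_indicator) (auto simp: emeasure_eq_measure)
    then have "expectation (\<lambda>\<omega>. \<bar>t\<bar> * \<epsilon> + 2 * indicator ?A \<omega>) =
        expectation (\<lambda>\<omega>. \<bar>t\<bar> * \<epsilon>) + expectation (\<lambda>\<omega>. 2 * indicator ?A \<omega>)"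
      by (intro Bochner_Integration.integral_add integrable_const)
    also have "expectation (\<lambda>\<omega>. 2 * indicator ?A \<omega>) = 2 * prob ?A"
      by (simp add: Int_absorb2)
    finally show ?thesis by (simp add: prob_space)
  qed
  finally show ?thesis .
qed

text \<open>A quantitative central limit theorem for one row of a triangular array. The characteristic
  function of the sum is a product, each factor is \<open>1 - t\<^sup>2 / (2 n)\<close> up to
  \<open>\<bar>t\<bar>\<^sup>3 K / (6 n\<^sup>3\<^sup>/\<^sup>2)\<close>, and the errors add up because all factors lie in the unit disc,
  as \<open>t\<^sup>2 / (2 n) \<le> 2\<close>. Since the bound
  is explicit, the law of the summands may change with \<open>n\<close> as long as \<open>K\<close> stays fixed.\<close>

lemma (in prob_space) char_normalized_sum:
  fixes Y :: "nat \<Rightarrow> 'a \<Rightarrow> real"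
  assumes n: "n > 0" and indep: "indep_vars (\<lambda>_. borel) Y {1..n}"
    and sq: "\<And>k. k \<in> {1..n} \<Longrightarrow> integrable M (\<lambda>\<omega>. (Y k \<omega>)\<^sup>2)"
    and mean: "\<And>k. k \<in> {1..n} \<Longrightarrow> expectation (Y k) = 0"
    and var: "\<And>k. k \<in> {1..n} \<Longrightarrow> expectation (\<lambda>\<omega>. (Y k \<omega>)\<^sup>2) = 1"
    and cube: "\<And>k. k \<in> {1..n} \<Longrightarrow> integrable M (\<lambda>\<omega>. \<bar>Y k \<omega>\<bar> ^ 3)"
    and K: "\<And>k. k \<in> {1..n} \<Longrightarrow> expectation (\<lambda>\<omega>. \<bar>Y k \<omega>\<bar> ^ 3) \<le> K"
    and t: "t\<^sup>2 / 4 \<le> n"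
  shows "cmod (char (distr M borel (\<lambda>\<omega>. (\<Sum>k=1..n. Y k \<omega>) / sqrt n)) t - complex_of_real ((1 - t\<^sup>2 / 2 / real n) ^ n)) \<le>
    \<bar>t\<bar> ^ 3 * K / 6 / sqrt n"
proof -
  let ?t = "t / sqrt n"
  have meas [measurable]: "random_variable borel (Y k)" if "k \<in> {1..n}" for k
    using indep that by (auto simp: indep_vars_def2)
  have t2: "?t\<^sup>2 = t\<^sup>2 / n" using n by (simp add: power_divide)
  have "char (distr M borel (\<lambda>\<omega>. (\<Sum>k=1..n. Y k \<omega>) / sqrt n)) t = char (distr M borel (\<lambda>\<omega>. \<Sum>k=1..n. Y k \<omega>)) ?t"
  proof -
    have "random_variable borel (\<lambda>\<omega>. \<Sum>k=1..n. Y k \<omega>)" by (intro borel_measurable_sum meas)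
    then show ?thesis by (simp add: char_def integral_distr)
  qed
  also have "\<dots> = (\<Prod>k=1..n. char (distr M borel (Y k)) ?t)"
    by (rule char_distr_sum[OF indep])
  finally have prod: "char (distr M borel (\<lambda>\<omega>. (\<Sum>k=1..n. Y k \<omega>) / sqrt n)) t = (\<Prod>k=1..n. char (distr M borel (Y k)) ?t)" .
  have approx: "cmod (char (distr M borel (Y k)) ?t - complex_of_real (1 - t\<^sup>2 / 2 / n)) \<le> t\<^sup>2 / n / 6 * (\<bar>?t\<bar> * K)"
    if k: "k \<in> {1..n}" for k
  proof -
    have int: "integrable M (Y k)"
      using square_integrable_imp_integrable[OF meas[OF k] sq[OF k]] .
    have "variance (Y k) = 1" using mean[OF k] var[OF k] by simp
    from char_approx3'[OF meas[OF k] int sq[OF k] mean[OF k] this refl, of ?t]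
    have "cmod (char (distr M borel (Y k)) ?t - (1 - complex_of_real (?t\<^sup>2) / 2))
      \<le> ?t\<^sup>2 / 6 * expectation (\<lambda>\<omega>. min (6 * (Y k \<omega>)\<^sup>2) (\<bar>?t\<bar> * \<bar>Y k \<omega>\<bar> ^ 3))" by simp
    also have "\<dots> \<le> ?t\<^sup>2 / 6 * (\<bar>?t\<bar> * K)"
    proof (rule mult_left_mono)
      have "expectation (\<lambda>\<omega>. min (6 * (Y k \<omega>)\<^sup>2) (\<bar>?t\<bar> * \<bar>Y k \<omega>\<bar> ^ 3)) \<le> expectation (\<lambda>\<omega>. \<bar>?t\<bar> * \<bar>Y k \<omega>\<bar> ^ 3)"
      proof (rule integral_mono)
        show i: "integrable M (\<lambda>\<omega>. \<bar>?t\<bar> * \<bar>Y k \<omega>\<bar> ^ 3)" using cube[OF k] by simp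
        show "integrable M (\<lambda>\<omega>. min (6 * (Y k \<omega>)\<^sup>2) (\<bar>?t\<bar> * \<bar>Y k \<omega>\<bar> ^ 3))"
          using sq[OF k] cube[OF k] by (intro integrable_min) auto
      qed simp
      also have "\<dots> \<le> \<bar>?t\<bar> * K" using K[OF k] by (simp add: mult_left_mono divide_right_mono)
      finally show "expectation (\<lambda>\<omega>. min (6 * (Y k \<omega>)\<^sup>2) (\<bar>?t\<bar> * \<bar>Y k \<omega>\<bar> ^ 3)) \<le> \<bar>?t\<bar> * K" .
    qed simp
    finally show ?thesis by (simp add: t2 mult_ac)
  qed
  have "cmod ((\<Prod>k=1..n. char (distr M borel (Y k)) ?t) - (\<Prod>k=1..n. complex_of_real (1 - t\<^sup>2 / 2 / n)))
    \<le> (\<Sum>k=1..n. cmod (char (distr M borel (Y k)) ?t - complex_of_real (1 - t\<^sup>2 / 2 / n)))"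
  proof (rule norm_prod_diff)
    fix k assume k: "k \<in> {1..n}"
    show "cmod (char (distr M borel (Y k)) ?t) \<le> 1"
      by (rule real_distribution.cmod_char_le_1[OF real_distribution_distr[OF meas[OF k]]])
    have "\<bar>1 - t\<^sup>2 / 2 / n\<bar> \<le> 1" using t n by (auto simp: abs_le_iff field_simps)
    then show "cmod (complex_of_real (1 - t\<^sup>2 / 2 / n)) \<le> 1" unfolding norm_of_real .
  qed
  also have "\<dots> \<le> (\<Sum>k=1..n. t\<^sup>2 / n / 6 * (\<bar>?t\<bar> * K))" by (rule sum_mono[OF approx])
  also have "\<dots> = \<bar>t\<bar> ^ 3 * K / 6 / sqrt n"
    using n by (simp add: power3_eq_cube power2_eq_square abs_mult_self_eq mult.assoc)
  finally show ?thesis unfolding prod by simp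
qed

lemma tendsto_power_std_normal_char:
  "(\<lambda>n. complex_of_real ((1 - t\<^sup>2 / 2 / real n) ^ n)) \<longlonglongrightarrow> char std_normal_distribution t"
proof -
  have "(\<lambda>n. complex_of_real ((1 + (-(t^2) / 2) / n)^n)) \<longlonglongrightarrow> complex_of_real (exp (-(t^2) / 2))"
    by (rule isCont_tendsto_compose [OF _ tendsto_exp_limit_sequentially]) auto
  then show ?thesis by (simp add: char_std_normal_distribution)
qed

text \<open>Slutsky's theorem for an additive perturbation, on the level of characteristic functions.\<close>

lemma weak_conv_std_normal_perturbation:
  fixes M :: "nat \<Rightarrow> 'a measure"
  assumes M: "\<And>n. prob_space (M n)"
    and Y: "\<And>n. Y n \<in> borel_measurable (M n)" and Z: "\<And>n. Z n \<in> borel_measurable (M n)"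
    and char: "\<And>t. (\<lambda>n. char (distr (M n) borel (Z n)) t) \<longlonglongrightarrow> char std_normal_distribution t"
    and small: "\<And>\<epsilon>. 0 < \<epsilon> \<Longrightarrow> (\<lambda>n. measure (M n) {\<omega> \<in> space (M n). \<epsilon> < \<bar>Y n \<omega> - Z n \<omega>\<bar>}) \<longlonglongrightarrow> 0"
  shows "weak_conv_m (\<lambda>n. distr (M n) borel (Y n)) std_normal_distribution"
proof (rule levy_continuity)
  show "real_distribution (distr (M n) borel (Y n))" for n
    by (rule prob_space.real_distribution_distr[OF M Y])
  show "real_distribution std_normal_distribution" by (rule real_dist_normal_dist)
  fix t
  have "(\<lambda>n. char (distr (M n) borel (Y n)) t - char (distr (M n) borel (Z n)) t) \<longlonglongrightarrow> 0"
  proof (rule tendstoI)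
    fix e :: real assume e: "e > 0"
    define \<epsilon> where "\<epsilon> = e / (2 * (\<bar>t\<bar> + 1))"
    have \<epsilon>: "\<epsilon> > 0" "\<bar>t\<bar> * \<epsilon> \<le> e / 2" using e by (auto simp: \<epsilon>_def field_simps)
    from tendstoD[OF small[OF \<epsilon>(1)], of "e / 4"] e
    have "\<forall>\<^sub>F n in sequentially. measure (M n) {\<omega> \<in> space (M n). \<epsilon> < \<bar>Y n \<omega> - Z n \<omega>\<bar>} < e / 4" by simp
    then show "\<forall>\<^sub>F n in sequentially. dist (char (distr (M n) borel (Y n)) t - char (distr (M n) borel (Z n)) t) 0 < e"
    proof eventually_elim
      case (elim n)
      show ?case
        using prob_space.char_perturbation[OF M Y Z, of \<epsilon> n t] \<epsilon> elim by (simp add: dist_norm)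
    qed
  qed
  from tendsto_add[OF this char[of t]]
  show "(\<lambda>n. char (distr (M n) borel (Y n)) t) \<longlonglongrightarrow> char std_normal_distribution t" by simp
qed

context gaussian_sample
begin

lemma product_variance:
  assumes k: "k \<in> {1..n}" and u: "u \<in> carrier_vec p" and v: "v \<in> carrier_vec p"
    and unit: "cov u u = 1" "cov v v = 1"
  shows "variance (\<lambda>\<omega>. (u \<bullet> X k \<omega>) * (v \<bullet> X k \<omega>)) = 1 + (cov u v)\<^sup>2"
  using product_moments[OF k u v unit]
  by (subst variance_eq) auto

text \<open>The variance of a product is \<open>1 + c\<^sup>2 \<ge> 1\<close> with \<open>c = cov u v\<close>, so normalization does not increase
  moments. For the third absolute moment, \<open>\<bar>y\<bar>\<^sup>3 \<le> 1 + y\<^sup>4\<close> and \<open>(x - c)\<^sup>4 \<le> 8 x\<^sup>4 + 8\<close> give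
  \<open>849 = 9 + 8 \<cdot> 105\<close>. The sign is that of the linear term of the estimator.\<close>

lemma char_prod_mean:
  assumes u: "u \<in> carrier_vec p" and v: "v \<in> carrier_vec p" and unit: "cov u u = 1" "cov v v = 1"
    and t: "t\<^sup>2 / 4 \<le> n"
  shows "cmod (char (distr M borel (\<lambda>\<omega>. - (sqrt n / sqrt (1 + (cov u v)\<^sup>2) * (prod_mean u v \<omega> - cov u v)))) t
      - complex_of_real ((1 - t\<^sup>2 / 2 / real n) ^ n)) \<le> \<bar>t\<bar> ^ 3 * 849 / 6 / sqrt n"
proof -
  \<comment> \<open>negative, so that the normalized sum of the \<open>Y k\<close> carries the sign\<close>
  define d where "d = - sqrt (1 + (cov u v)\<^sup>2)"
  have d2: "d\<^sup>2 = 1 + (cov u v)\<^sup>2" by (simp add: d_def)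
  have d1: "1 \<le> d\<^sup>2" by (simp add: d2)
  then have d0: "d \<noteq> 0" by auto
  define Y where "Y k \<omega> = ((u \<bullet> X k \<omega>) * (v \<bullet> X k \<omega>) - cov u v) / d" for k \<omega>
  note m = product_moments[OF _ u v unit]
  have sq: "integrable M (\<lambda>\<omega>. (Y k \<omega>)\<^sup>2)" "expectation (Y k) = 0"
    "expectation (\<lambda>\<omega>. (Y k \<omega>)\<^sup>2) = 1" if "k \<in> {1..n}" for k
  proof -
    have eq: "(Y k \<omega>)\<^sup>2 = (((u \<bullet> X k \<omega>) * (v \<bullet> X k \<omega>))\<^sup>2 - 2 * cov u v * ((u \<bullet> X k \<omega>) * (v \<bullet> X k \<omega>)) + (cov u v)\<^sup>2) / d\<^sup>2" for \<omega>
      by (simp add: Y_def power_divide power2_diff mult_ac)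
    show "integrable M (\<lambda>\<omega>. (Y k \<omega>)\<^sup>2)" unfolding eq using m[OF that] by simp
    show "expectation (Y k) = 0" unfolding Y_def[abs_def] using m[OF that] by (simp add: prob_space)
    have "expectation (\<lambda>\<omega>. (Y k \<omega>)\<^sup>2) = (1 + 2 * (cov u v)\<^sup>2 - 2 * cov u v * cov u v + (cov u v)\<^sup>2) / d\<^sup>2"
      unfolding eq using m[OF that] by (simp add: prob_space)
    also have "1 + 2 * (cov u v)\<^sup>2 - 2 * cov u v * cov u v + (cov u v)\<^sup>2 = d\<^sup>2"
      unfolding d2 by (simp add: power2_eq_square)
    also have "d\<^sup>2 / d\<^sup>2 = 1" using d0 by simp
    finally show "expectation (\<lambda>\<omega>. (Y k \<omega>)\<^sup>2) = 1" .
  qed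
  have Y_meas: "Y k \<in> borel_measurable M" if "k \<in> {1..n}" for k
    unfolding Y_def[abs_def] using that by simp
  have le: "\<bar>Y k \<omega>\<bar> ^ 3 \<le> 1 + (8 * ((u \<bullet> X k \<omega>) * (v \<bullet> X k \<omega>)) ^ 4 + 8)" for k \<omega>
  proof -
    let ?x = "(u \<bullet> X k \<omega>) * (v \<bullet> X k \<omega>)"
    have "\<bar>Y k \<omega>\<bar> ^ 3 \<le> 1 + Y k \<omega> ^ 4" using le_one_plus_even_power[of 3 2 "Y k \<omega>"] by simp
    also have "Y k \<omega> ^ 4 \<le> (?x - cov u v) ^ 4"
    proof -
      have "Y k \<omega> ^ 4 = (?x - cov u v) ^ 4 / (d\<^sup>2)\<^sup>2" by (simp add: Y_def power_divide)
      also have "\<dots> \<le> (?x - cov u v) ^ 4"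
        using one_le_power[OF d1, of 2] by (simp add: divide_le_eq mult_right_mono zero_le_even_power mult_le_cancel_left1)
      finally show ?thesis .
    qed
    also have "(?x - cov u v) ^ 4 \<le> 8 * ?x ^ 4 + 8 * cov u v ^ 4"
    proof -
      have sq2: "(x - y)\<^sup>2 \<le> 2 * x\<^sup>2 + 2 * y\<^sup>2" for x y :: real
      proof -
        have "0 \<le> (x + y)\<^sup>2" by simp
        then show ?thesis by (simp add: power2_sum power2_diff)
      qed
      have "(?x - cov u v) ^ 4 = ((?x - cov u v)\<^sup>2)\<^sup>2" by simp
      also have "\<dots> \<le> (2 * ?x\<^sup>2 - - (2 * (cov u v)\<^sup>2))\<^sup>2" using sq2 by (intro power_mono) auto
      also have "\<dots> \<le> 2 * (2 * ?x\<^sup>2)\<^sup>2 + 2 * (- (2 * (cov u v)\<^sup>2))\<^sup>2" by (rule sq2)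
      also have "\<dots> = 8 * ?x ^ 4 + 8 * cov u v ^ 4" by (simp add: power_mult_distrib flip: power_mult)
      finally show ?thesis .
    qed
    also have "cov u v ^ 4 \<le> 1"
      using power_le_one[of "\<bar>cov u v\<bar>" 4] cov_le_1[OF u v unit] by (simp add: power_even_abs)
    finally show ?thesis by simp
  qed
  have int: "integrable M (\<lambda>\<omega>. 1 + (8 * ((u \<bullet> X k \<omega>) * (v \<bullet> X k \<omega>)) ^ 4 + 8))" if "k \<in> {1..n}" for k
    using m[OF that] by simp
  have cube: "integrable M (\<lambda>\<omega>. \<bar>Y k \<omega>\<bar> ^ 3)" if "k \<in> {1..n}" for k
    by (rule Bochner_Integration.integrable_bound[OF int[OF that]])
      (use le Y_meas[OF that] in \<open>auto intro!: AE_I2 order_trans[OF _ abs_ge_self]\<close>)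
  have K: "expectation (\<lambda>\<omega>. \<bar>Y k \<omega>\<bar> ^ 3) \<le> 849" if "k \<in> {1..n}" for k
  proof -
    have "expectation (\<lambda>\<omega>. \<bar>Y k \<omega>\<bar> ^ 3) \<le> expectation (\<lambda>\<omega>. 1 + (8 * ((u \<bullet> X k \<omega>) * (v \<bullet> X k \<omega>)) ^ 4 + 8))"
      by (rule integral_mono[OF cube[OF that] int[OF that] le])
    also have "\<dots> = 9 + 8 * expectation (\<lambda>\<omega>. ((u \<bullet> X k \<omega>) * (v \<bullet> X k \<omega>)) ^ 4)"
      using m[OF that] by (simp add: prob_space)
    also have "\<dots> \<le> 849" using m(6)[OF that] by simp
    finally show ?thesis .
  qed
  have eq: "- (sqrt n / sqrt (1 + (cov u v)\<^sup>2) * (prod_mean u v \<omega> - cov u v)) = (\<Sum>k=1..n. Y k \<omega>) / sqrt n" for \<omega>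
  proof -
    have "prod_mean u v \<omega> - cov u v = (d / n) * (\<Sum>k=1..n. Y k \<omega>)"
      using d0 n_ge_2 by (simp add: prod_mean_def Y_def sum_subtractf field_simps flip: sum_divide_distrib)
    then have "- (sqrt n / sqrt (1 + (cov u v)\<^sup>2) * (prod_mean u v \<omega> - cov u v)) =
        (sqrt n / d) * ((d / n) * (\<Sum>k=1..n. Y k \<omega>))"
      by (simp add: d_def)
    also have "\<dots> = (sqrt n / n) * (\<Sum>k=1..n. Y k \<omega>)" using d0 by simp
    also have "sqrt n / n = 1 / sqrt n" using n_ge_2 by (simp add: field_simps)
    finally show ?thesis by simp
  qed
  have n0: "n > 0" using n_ge_2 by simp
  have indep: "indep_vars (\<lambda>_. borel) Y {1..n}"
    unfolding Y_def[abs_def] by (rule product_indep)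
  show ?thesis
    unfolding eq by (rule char_normalized_sum[OF n0 indep _ _ _ _ _ t]) (fact sq cube K)+
qed

end

section \<open>Measurability of the inverse and the selection matrix\<close>

lemma borel_measurable_det:
  fixes A :: "'a \<Rightarrow> real mat"
  assumes "\<And>\<omega>. A \<omega> \<in> carrier_mat n n"
    and "\<And>i j. i < n \<Longrightarrow> j < n \<Longrightarrow> (\<lambda>\<omega>. A \<omega> $$ (i, j)) \<in> borel_measurable M"
  shows "(\<lambda>\<omega>. det (A \<omega>)) \<in> borel_measurable M"
proof -
  have perm: "q i < n" if "q permutes {0..<n}" "i \<in> {0..<n}" for q i
    using permutes_in_image[OF that(1), of i] that(2) by simp
  show ?thesis
    unfolding det_def'[OF assms(1)]
    by (intro borel_measurable_sum borel_measurable_times borel_measurable_prod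
        borel_measurable_const assms(2)) (simp_all add: perm)
qed

lemma borel_measurable_inv_mat:
  fixes A :: "'a \<Rightarrow> real mat"
  assumes A: "\<And>\<omega>. A \<omega> \<in> carrier_mat n n"
    and ent: "\<And>i j. i < n \<Longrightarrow> j < n \<Longrightarrow> (\<lambda>\<omega>. A \<omega> $$ (i, j)) \<in> borel_measurable M"
    and ij: "i < n" "j < n"
  shows "(\<lambda>\<omega>. inv_mat (A \<omega>) $$ (i, j)) \<in> borel_measurable M"
proof -
  have [measurable]: "(\<lambda>\<omega>. det (A \<omega>)) \<in> borel_measurable M"
    by (rule borel_measurable_det[OF A ent])
  have "(\<lambda>\<omega>. det (mat_delete (A \<omega>) j i)) \<in> borel_measurable M"
  proof (rule borel_measurable_det)
    show "mat_delete (A \<omega>) j i \<in> carrier_mat (n - 1) (n - 1)" for \<omega>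
      using A[of \<omega>] by (simp add: mat_delete_def)
    fix k l assume kl: "k < n - 1" "l < n - 1"
    have "mat_delete (A \<omega>) j i $$ (k, l) = A \<omega> $$ (if k < j then k else Suc k, if l < i then l else Suc l)" for \<omega>
      using A[of \<omega>] kl by (simp add: mat_delete_def)
    then show "(\<lambda>\<omega>. mat_delete (A \<omega>) j i $$ (k, l)) \<in> borel_measurable M"
      using kl ent by simp
  qed
  then have [measurable]: "(\<lambda>\<omega>. cofactor (A \<omega>) j i) \<in> borel_measurable M"
    unfolding cofactor_def by simp
  show ?thesis
    unfolding inv_mat_entry[OF A ij] by measurable
qed

lemma distinct_supp_list: "distinct (supp_list w)"
  by (simp add: supp_list_def)

lemma set_supp_list: "set (supp_list w) = {r. r < dim_vec w \<and> w $ r \<noteq> 0}"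
  by (auto simp: supp_list_def)

lemma length_supp_list: "length (supp_list w) = card {r. r < dim_vec w \<and> w $ r \<noteq> 0}"
  using distinct_card[OF distinct_supp_list[of w]] by (simp only: set_supp_list)

lemma selection_mat_carrier: "selection_mat w \<in> carrier_mat (dim_vec w) (length (supp_list w))"
  using mat_of_cols_carrier(1)[of "dim_vec w" "map (unit_vec (dim_vec w)) (supp_list w)"]
  by (simp add: selection_mat_def)

lemma nonzero_part_carrier: "nonzero_part w \<in> carrier_vec (length (supp_list w))"
  by (rule carrier_vecI) (simp add: nonzero_part_def)

lemma selection_mat_mult_index:
  assumes v: "v \<in> carrier_vec (length (supp_list w))" and r: "r < dim_vec w"
  shows "(selection_mat w *\<^sub>v v) $ r = (\<Sum>l<length (supp_list w). if supp_list w ! l = r then v $ l else 0)"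
proof -
  have "selection_mat w $$ (r, l) = (if supp_list w ! l = r then 1 else 0)" if l: "l < length (supp_list w)" for l
  proof -
    have "supp_list w ! l \<in> set (supp_list w)" using l by simp
    then have "supp_list w ! l < dim_vec w" by (simp add: set_supp_list)
    then show ?thesis using l r by (simp add: selection_mat_def mat_of_cols_index unit_vec_def)
  qed
  then have "(\<Sum>l<length (supp_list w). selection_mat w $$ (r, l) * v $ l) =
      (\<Sum>l<length (supp_list w). if supp_list w ! l = r then v $ l else 0)"
    by (intro sum.cong refl) simp
  then show ?thesis
    using selection_mat_carrier[of w] v r by (simp add: scalar_prod_def atLeast0LessThan)
qed

text \<open>Reading off the support positions inverts the selection matrix, so it is injective.\<close>

lemma selection_mat_mult_nth:
  assumes v: "v \<in> carrier_vec (length (supp_list w))" and l: "l < length (supp_list w)"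
  shows "(selection_mat w *\<^sub>v v) $ (supp_list w ! l) = v $ l"
proof -
  have "supp_list w ! l \<in> set (supp_list w)" using l by simp
  then have r: "supp_list w ! l < dim_vec w" by (simp add: set_supp_list)
  have "(selection_mat w *\<^sub>v v) $ (supp_list w ! l) = (\<Sum>k<length (supp_list w). if k = l then v $ k else 0)"
    unfolding selection_mat_mult_index[OF v r]
    using nth_eq_iff_index_eq[OF distinct_supp_list] l by (intro sum.cong refl) auto
  then show ?thesis using l by simp
qed

lemma selection_mat_inj:
  assumes v: "v \<in> carrier_vec (length (supp_list w))" "v \<noteq> 0\<^sub>v (length (supp_list w))"
  shows "selection_mat w *\<^sub>v v \<noteq> 0\<^sub>v (dim_vec w)"
proof
  assume z: "selection_mat w *\<^sub>v v = 0\<^sub>v (dim_vec w)"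
  have "v $ l = 0" if "l < length (supp_list w)" for l
  proof -
    have "supp_list w ! l \<in> set (supp_list w)" using that by simp
    then have "supp_list w ! l < dim_vec w" by (simp add: set_supp_list)
    then show ?thesis using selection_mat_mult_nth[OF v(1) that] by (simp add: z)
  qed
  then have "v = 0\<^sub>v (length (supp_list w))"
    using v(1) by (intro eq_vecI) simp_all
  with v(2) show False by simp
qed

lemma selection_mat_nonzero_part: "selection_mat w *\<^sub>v nonzero_part w = w"
proof (rule eq_vecI[OF _ trans[OF dim_mult_mat_vec carrier_matD(1)[OF selection_mat_carrier]]])
  fix r assume r: "r < dim_vec w"
  show "(selection_mat w *\<^sub>v nonzero_part w) $ r = w $ r"
  proof (cases "w $ r = 0")
    case True
    have "supp_list w ! l \<noteq> r" if "l < length (supp_list w)" for l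
      using nth_mem[OF that] True by (auto simp: set_supp_list)
    then show ?thesis unfolding selection_mat_mult_index[OF nonzero_part_carrier r] using True by simp
  next
    case False
    then have "r \<in> set (supp_list w)" using r by (simp add: set_supp_list)
    then obtain l where l: "l < length (supp_list w)" "supp_list w ! l = r"
      by (auto simp: in_set_conv_nth)
    have "(selection_mat w *\<^sub>v nonzero_part w) $ r = nonzero_part w $ l"
      using selection_mat_mult_nth[OF nonzero_part_carrier l(1)] l(2) by simp
    also have "\<dots> = w $ r"
      using l by (simp add: nonzero_part_def vec_of_list_index)
    finally show ?thesis .
  qed
qed

lemma outer_prod_mult_vec:
  assumes "x \<in> carrier_vec n" "y \<in> carrier_vec k" "v \<in> carrier_vec k"
  shows "outer_prod x y *\<^sub>v v = (y \<bullet> v) \<cdot>\<^sub>v x"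
proof (rule eq_vecI)
  fix i assume "i < dim_vec ((y \<bullet> v) \<cdot>\<^sub>v x)"
  then have i: "i < n" using assms by simp
  have "(outer_prod x y *\<^sub>v v) $ i = (\<Sum>j<k. x $ i * y $ j * v $ j)"
    using i assms by (simp add: outer_prod_def scalar_prod_def atLeast0LessThan)
  also have "\<dots> = (\<Sum>j<k. y $ j * v $ j) * x $ i"
    unfolding sum_distrib_right by (intro sum.cong refl) simp
  also have "\<dots> = ((y \<bullet> v) \<cdot>\<^sub>v x) $ i"
    using i assms by (simp add: scalar_prod_def atLeast0LessThan)
  finally show "(outer_prod x y *\<^sub>v v) $ i = ((y \<bullet> v) \<cdot>\<^sub>v x) $ i" .
qed (use assms in \<open>simp add: outer_prod_def\<close>)

section \<open>Comparison of the estimator with a normalized sum\<close>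

context gaussian_sample
begin

text \<open>Everything is bilinear in \<open>a\<close> and \<open>w\<close>, and \<open>\<surd>h\<close> scales in the same way. So \<open>a\<close> and \<open>w\<close> may be
  normalized to unit variance; then \<open>h \<ge> 1\<close>, and the linearization error is multiplied by at most
  \<open>\<surd>n\<close>. The variable \<open>Z\<close> is the normalized sum of independent products.\<close>

lemma estimator_approximation:
  fixes B s a w
  defines "\<Sigma>\<^sub>B \<equiv> transpose_mat B * \<Sigma> * B"
  defines "h \<equiv> variance (\<lambda>\<omega>. ((B *\<^sub>v a) \<bullet> X 1 \<omega>) * ((B *\<^sub>v w) \<bullet> X 1 \<omega>))"
  defines "T \<equiv> \<lambda>\<omega>. sqrt n / sqrt h * ((\<Sigma>\<^sub>B *\<^sub>v a) \<bullet>
      (inv_mat (transpose_mat B * sample_cov p n (\<lambda>k. X k \<omega>) * B) *\<^sub>v (\<Sigma>\<^sub>B *\<^sub>v w) - w))"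
  assumes B: "B \<in> carrier_mat p s"
    and inj: "\<And>v. v \<in> carrier_vec s \<Longrightarrow> v \<noteq> 0\<^sub>v s \<Longrightarrow> B *\<^sub>v v \<noteq> 0\<^sub>v p"
    and a: "a \<in> carrier_vec s" "a \<noteq> 0\<^sub>v s" and w: "w \<in> carrier_vec s" "w \<noteq> 0\<^sub>v s"
  shows "T \<in> borel_measurable M"
    and "\<exists>Z \<in> borel_measurable M.
      (\<forall>t. t\<^sup>2 / 4 \<le> n \<longrightarrow> cmod (char (distr M borel Z) t - complex_of_real ((1 - t\<^sup>2 / 2 / real n) ^ n)) \<le> \<bar>t\<bar> ^ 3 * 849 / 6 / sqrt n) \<and>
      (\<forall>\<epsilon>>0. prob {\<omega> \<in> space M. \<epsilon> < \<bar>T \<omega> - Z \<omega>\<bar>} \<le>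
        (6 + 96 * real s) / (sqrt n * \<epsilon>) + 192 * (real s)\<^sup>2 / real n)"
proof -
  let ?S = "\<lambda>\<omega>. transpose_mat B * sample_cov p n (\<lambda>k. X k \<omega>) * B"
  have Sc: "\<Sigma>\<^sub>B \<in> carrier_mat s s" using B \<Sigma>_carrier by (auto simp: \<Sigma>\<^sub>B_def intro!: mult_carrier_mat)
  have Sn: "?S \<omega> \<in> carrier_mat s s" for \<omega> using B by (auto intro!: mult_carrier_mat)
  have Ba: "B *\<^sub>v a \<in> carrier_vec p" and Bw: "B *\<^sub>v w \<in> carrier_vec p" using B a w by auto
  have ent: "(\<lambda>\<omega>. ?S \<omega> $$ (j, l)) \<in> borel_measurable M" if jl: "j < s" "l < s" for j l
  proof -
    have c: "B *\<^sub>v unit_vec s j \<in> carrier_vec p" "B *\<^sub>v unit_vec s l \<in> carrier_vec p" using B by auto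
    have "?S \<omega> $$ (j, l) = cov_error (B *\<^sub>v unit_vec s j) (B *\<^sub>v unit_vec s l) \<omega> + cov (B *\<^sub>v unit_vec s j) (B *\<^sub>v unit_vec s l)" for \<omega>
    proof -
      have "?S \<omega> $$ (j, l) = unit_vec s j \<bullet> (?S \<omega> *\<^sub>v unit_vec s l)"
        using Sn[of \<omega>] jl by (subst scalar_prod_left_unit) (auto simp: mult_mat_vec_def)
      also have "\<dots> = (B *\<^sub>v unit_vec s j) \<bullet> (sample_cov p n (\<lambda>k. X k \<omega>) *\<^sub>v (B *\<^sub>v unit_vec s l))"
        by (rule congruence_form[OF B sample_cov_carrier]) auto
      finally show ?thesis by (simp add: cov_error_def)
    qed
    then show ?thesis using cov_error_meas[OF c] by simp
  qed
  note inv_meas = borel_measurable_inv_mat[OF Sn ent]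
  have meas: "(\<lambda>\<omega>. x \<bullet> (inv_mat (?S \<omega>) *\<^sub>v y - z)) \<in> borel_measurable M"
    if "x \<in> carrier_vec s" "y \<in> carrier_vec s" "z \<in> carrier_vec s" for x y z
  proof -
    have "x \<bullet> (inv_mat (?S \<omega>) *\<^sub>v y - z) = (\<Sum>j<s. x $ j * ((\<Sum>l<s. inv_mat (?S \<omega>) $$ (j, l) * y $ l) - z $ j))" for \<omega>
      using that inv_mat_carrier[OF Sn[of \<omega>]] by (simp add: scalar_prod_def atLeast0LessThan)
    then show ?thesis
      by (simp, intro borel_measurable_sum borel_measurable_times borel_measurable_diff borel_measurable_const inv_meas) auto
  qed
  have SBx: "\<Sigma>\<^sub>B *\<^sub>v x \<in> carrier_vec s" if "x \<in> carrier_vec s" for x using Sc that by auto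
  show T_meas: "T \<in> borel_measurable M"
    unfolding T_def by (intro borel_measurable_times borel_measurable_const meas SBx a w)
  define \<alpha> where "\<alpha> = sqrt (cov (B *\<^sub>v a) (B *\<^sub>v a))"
  define \<beta> where "\<beta> = sqrt (cov (B *\<^sub>v w) (B *\<^sub>v w))"
  have \<alpha>: "\<alpha> > 0" "\<alpha>\<^sup>2 = cov (B *\<^sub>v a) (B *\<^sub>v a)"
    using cov_pos[OF Ba inj[OF a]] by (auto simp: \<alpha>_def)
  have \<beta>: "\<beta> > 0" "\<beta>\<^sup>2 = cov (B *\<^sub>v w) (B *\<^sub>v w)"
    using cov_pos[OF Bw inj[OF w]] by (auto simp: \<beta>_def)
  define a' where "a' = (1 / \<alpha>) \<cdot>\<^sub>v a"
  define w' where "w' = (1 / \<beta>) \<cdot>\<^sub>v w"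
  have a': "a' \<in> carrier_vec s" and w': "w' \<in> carrier_vec s" using a w by (auto simp: a'_def w'_def)
  have aa: "a = \<alpha> \<cdot>\<^sub>v a'" and ww: "w = \<beta> \<cdot>\<^sub>v w'"
    using \<alpha> \<beta> by (auto simp: a'_def w'_def smult_smult_assoc)
  have smult: "E *\<^sub>v (c \<cdot>\<^sub>v x) = c \<cdot>\<^sub>v (E *\<^sub>v x)" if "E \<in> carrier_mat r s" "x \<in> carrier_vec s" for E :: "real mat" and c x r
    using mult_mat_vec[OF that] by simp
  define u where "u = B *\<^sub>v a'"
  define v where "v = B *\<^sub>v w'"
  have u: "u \<in> carrier_vec p" and v: "v \<in> carrier_vec p" using B a' w' by (auto simp: u_def v_def)
  have Bau: "B *\<^sub>v a = \<alpha> \<cdot>\<^sub>v u" and Bwv: "B *\<^sub>v w = \<beta> \<cdot>\<^sub>v v"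
    by (simp_all add: u_def v_def aa[symmetric] ww[symmetric] smult[OF B a', symmetric] smult[OF B w', symmetric])
  have scale: "cov (c \<cdot>\<^sub>v x) (c \<cdot>\<^sub>v x) = c\<^sup>2 * cov x x" if "x \<in> carrier_vec p" for c x
    using that \<Sigma>_carrier mult_mat_vec[OF \<Sigma>_carrier that, of c] by (simp add: power2_eq_square)
  have unit: "cov u u = 1" "cov v v = 1"
    using \<alpha> \<beta> scale[OF u, of \<alpha>] scale[OF v, of \<beta>] by (simp_all add: Bau Bwv)
  define c where "c = cov u v"
  have one: "1 \<in> {1..n}" using n_ge_2 by simp
  have h: "h = (\<alpha> * \<beta>)\<^sup>2 * (1 + c\<^sup>2)"
  proof -
    have eq: "((B *\<^sub>v a) \<bullet> X 1 \<omega>) * ((B *\<^sub>v w) \<bullet> X 1 \<omega>) = (\<alpha> * \<beta>) * ((u \<bullet> X 1 \<omega>) * (v \<bullet> X 1 \<omega>))"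
      if "\<omega> \<in> space M" for \<omega>
      using X_carrier[OF one that] u v by (simp add: Bau Bwv)
    have "h = variance (\<lambda>\<omega>. (\<alpha> * \<beta>) * ((u \<bullet> X 1 \<omega>) * (v \<bullet> X 1 \<omega>)))"
    proof -
      have E: "expectation (\<lambda>\<omega>. ((B *\<^sub>v a) \<bullet> X 1 \<omega>) * ((B *\<^sub>v w) \<bullet> X 1 \<omega>)) =
          expectation (\<lambda>\<omega>. (\<alpha> * \<beta>) * ((u \<bullet> X 1 \<omega>) * (v \<bullet> X 1 \<omega>)))"
        by (rule Bochner_Integration.integral_cong[OF refl eq])
      show ?thesis
        unfolding h_def E by (rule Bochner_Integration.integral_cong[OF refl]) (simp only: eq)
    qed
    also have "\<dots> = (\<alpha> * \<beta>)\<^sup>2 * variance (\<lambda>\<omega>. (u \<bullet> X 1 \<omega>) * (v \<bullet> X 1 \<omega>))"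
      by (simp add: power_mult_distrib flip: right_diff_distrib)
    also have "\<dots> = (\<alpha> * \<beta>)\<^sup>2 * (1 + c\<^sup>2)"
      by (simp only: product_variance[OF one u v unit] c_def)
    finally show ?thesis .
  qed
  have sh: "sqrt h = \<alpha> * \<beta> * sqrt (1 + c\<^sup>2)"
    using \<alpha> \<beta> by (simp add: h real_sqrt_mult)
  define T' where "T' \<omega> = (\<Sigma>\<^sub>B *\<^sub>v a') \<bullet> (inv_mat (?S \<omega>) *\<^sub>v (\<Sigma>\<^sub>B *\<^sub>v w') - w')" for \<omega>
  have TT': "T \<omega> = sqrt n / sqrt (1 + c\<^sup>2) * T' \<omega>" for \<omega>
  proof -
    have i: "inv_mat (?S \<omega>) *\<^sub>v (\<Sigma>\<^sub>B *\<^sub>v w') - w' \<in> carrier_vec s"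
      using inv_mat_carrier[OF Sn[of \<omega>]] SBx[OF w'] w' by auto
    have "inv_mat (?S \<omega>) *\<^sub>v (\<Sigma>\<^sub>B *\<^sub>v w) - w = \<beta> \<cdot>\<^sub>v (inv_mat (?S \<omega>) *\<^sub>v (\<Sigma>\<^sub>B *\<^sub>v w') - w')"
      unfolding ww smult[OF Sc w'] smult[OF inv_mat_carrier[OF Sn] SBx[OF w']]
      using inv_mat_carrier[OF Sn[of \<omega>]] SBx[OF w'] w'
      by (intro eq_vecI) (auto simp: right_diff_distrib)
    moreover have "\<Sigma>\<^sub>B *\<^sub>v a = \<alpha> \<cdot>\<^sub>v (\<Sigma>\<^sub>B *\<^sub>v a')"
      unfolding aa smult[OF Sc a'] ..
    ultimately have "(\<Sigma>\<^sub>B *\<^sub>v a) \<bullet> (inv_mat (?S \<omega>) *\<^sub>v (\<Sigma>\<^sub>B *\<^sub>v w) - w) = \<alpha> * \<beta> * T' \<omega>"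
      using i SBx[OF a'] by (simp add: T'_def)
    then show ?thesis using \<alpha> \<beta> by (simp add: T_def sh)
  qed
  define Z where "Z \<omega> = - (sqrt n / sqrt (1 + c\<^sup>2) * (prod_mean u v \<omega> - c))" for \<omega>
  have Z: "Z \<in> borel_measurable M" unfolding Z_def[abs_def] by measurable
  have "cmod (char (distr M borel Z) t - complex_of_real ((1 - t\<^sup>2 / 2 / real n) ^ n)) \<le> \<bar>t\<bar> ^ 3 * 849 / 6 / sqrt n" if "t\<^sup>2 / 4 \<le> n" for t
    unfolding Z_def[abs_def] c_def by (rule char_prod_mean[OF u v unit that])
  moreover have "prob {\<omega> \<in> space M. \<epsilon> < \<bar>T \<omega> - Z \<omega>\<bar>} \<le>
        (6 + 96 * real s) / (sqrt n * \<epsilon>) + 192 * (real s)\<^sup>2 / real n" if \<epsilon>: "\<epsilon> > 0" for \<epsilon>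
  proof -
    have n0: "sqrt n > 0" using n_ge_2 by simp
    have R: "T \<omega> - Z \<omega> = sqrt n / sqrt (1 + c\<^sup>2) * (T' \<omega> + (prod_mean u v \<omega> - c))" for \<omega>
      by (simp add: TT' Z_def algebra_simps add_divide_distrib diff_divide_distrib)
    have "\<bar>T \<omega> - Z \<omega>\<bar> \<le> sqrt n * \<bar>T' \<omega> + (prod_mean u v \<omega> - c)\<bar>" for \<omega>
    proof -
      have "sqrt n / sqrt (1 + c\<^sup>2) \<le> sqrt n"
        using divide_left_mono[of 1 "sqrt (1 + c\<^sup>2)" "sqrt n"] n0 by (simp add: add_pos_nonneg)
      then show ?thesis unfolding R abs_mult by (intro mult_right_mono) auto
    qed
    then have sub: "\<epsilon> / sqrt n < \<bar>T' \<omega> + (prod_mean u v \<omega> - c)\<bar>" if "\<epsilon> < \<bar>T \<omega> - Z \<omega>\<bar>" for \<omega>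
      using that n0 order_less_le_trans[OF that] by (simp add: divide_less_eq mult.commute)
    have "T' \<in> borel_measurable M" unfolding T'_def[abs_def] by (intro meas SBx a' w')
    then have "prob {\<omega> \<in> space M. \<epsilon> < \<bar>T \<omega> - Z \<omega>\<bar>} \<le>
        prob {\<omega> \<in> space M. \<epsilon> / sqrt n < \<bar>T' \<omega> + (prod_mean u v \<omega> - c)\<bar>}"
      using sub by (intro finite_measure_mono) auto
    also have "\<dots> \<le> (6 + 96 * real s) / (real n * (\<epsilon> / sqrt n)) + 192 * (real s)\<^sup>2 / real n"
      unfolding T'_def c_def u_def v_def \<Sigma>\<^sub>B_def
      by (rule estimator_linearization[OF B inj a' w']) (use unit \<epsilon> n0 in \<open>auto simp: u_def v_def\<close>)
    also have "real n * (\<epsilon> / sqrt n) = sqrt n * \<epsilon>"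
      using n0 by (simp add: field_simps)
    finally show ?thesis .
  qed
  ultimately show "\<exists>Z \<in> borel_measurable M.
      (\<forall>t. t\<^sup>2 / 4 \<le> n \<longrightarrow> cmod (char (distr M borel Z) t - complex_of_real ((1 - t\<^sup>2 / 2 / real n) ^ n)) \<le> \<bar>t\<bar> ^ 3 * 849 / 6 / sqrt n) \<and>
      (\<forall>\<epsilon>>0. prob {\<omega> \<in> space M. \<epsilon> < \<bar>T \<omega> - Z \<omega>\<bar>} \<le>
        (6 + 96 * real s) / (sqrt n * \<epsilon>) + 192 * (real s)\<^sup>2 / real n)"
    using Z by (intro bexI[of _ Z]) auto
qed

end

section \<open>Asymptotic normality of the estimator\<close>

theorem theorem4:
  fixes M :: "nat \<Rightarrow> 'a measure"
    and p s i :: "nat \<Rightarrow> nat"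
    and \<Sigma> \<Omega> B \<Sigma>\<^sub>i \<Omega>\<^sub>i :: "nat \<Rightarrow> real mat"
    and X :: "nat \<Rightarrow> nat \<Rightarrow> 'a \<Rightarrow> real vec"
    and S S\<^sub>i :: "nat \<Rightarrow> 'a \<Rightarrow> real mat"
    and w w1 f m a :: "nat \<Rightarrow> real vec"
    and w1_hat :: "nat \<Rightarrow> 'a \<Rightarrow> real vec"
    and X\<^sub>B :: "nat \<Rightarrow> nat \<Rightarrow> 'a \<Rightarrow> real vec"
    and h :: "nat \<Rightarrow> real"
    and C\<^sub>0 K\<^sub>1 A :: real
  assumes \<Sigma>_carrier: "\<And>n. \<Sigma> n \<in> carrier_mat (p n) (p n)"
    and \<Sigma>_pos_def: "\<And>n. pos_def_mat (\<Sigma> n)"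
    and \<Omega>: "\<And>n. \<Omega> n = inv_mat (\<Sigma> n)"
    and s_pos: "\<And>n. 1 \<le> s n"
    and sparsity: "\<And>n j. j < p n \<Longrightarrow> card {r. r < p n \<and> col (\<Omega> n) j $ r \<noteq> 0} = s n"
    and prob: "\<And>n. prob_space (M n)"
    and X_indep: "\<And>n. prob_space.indep_vars (M n) (\<lambda>_. lborel_vec (p n)) (X n) {1..n}"
    and X_normal: "\<And>n k. k \<in> {1..n} \<Longrightarrow>
          distributed (M n) (lborel_vec (p n)) (X n k) (\<lambda>x. ennreal (mvn_density (\<Sigma> n) x))"
    and i: "\<And>n. i n < p n"
    and w: "\<And>n. w n = col (\<Omega> n) (i n)"
    and w1: "\<And>n. w1 n = nonzero_part (w n)"
    and B: "\<And>n. B n = selection_mat (w n)"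
    and f: "\<And>n. f n = transpose_mat (B n) *\<^sub>v unit_vec (p n) (i n)"
    and \<Sigma>\<^sub>i: "\<And>n. \<Sigma>\<^sub>i n = transpose_mat (B n) * \<Sigma> n * B n"
    and \<Omega>\<^sub>i: "\<And>n. \<Omega>\<^sub>i n = inv_mat (\<Sigma>\<^sub>i n)"
    and X\<^sub>B: "\<And>n k \<omega>. X\<^sub>B n k \<omega> = transpose_mat (B n) *\<^sub>v X n k \<omega>"
    and S: "\<And>n \<omega>. S n \<omega> = sample_cov (p n) n (\<lambda>k. X n k \<omega>)"
    and S\<^sub>i: "\<And>n \<omega>. S\<^sub>i n \<omega> = transpose_mat (B n) * S n \<omega> * B n"
    and w1_hat: "\<And>n \<omega>. w1_hat n \<omega> = inv_mat (S\<^sub>i n \<omega>) *\<^sub>v f n"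
    and s_small: "(\<lambda>n. real (s n)) \<in> o(\<lambda>n. sqrt (real n))"
    and C\<^sub>0_pos: "C\<^sub>0 > 0"
    and eigenvalues: "\<And>n e. eigenvalue (\<Sigma> n) e \<Longrightarrow> C\<^sub>0 \<le> e \<and> e \<le> inverse C\<^sub>0"
    and K\<^sub>1_pos: "K\<^sub>1 > 0"
    and \<Sigma>_norm: "\<And>n. max_col_sum (\<Sigma> n) \<le> K\<^sub>1"
    and m_carrier: "\<And>n. m n \<in> carrier_vec (s n)"
    and m_nonzero: "\<And>n. m n \<noteq> 0\<^sub>v (s n)"
    and a: "\<And>n. a n = transpose_mat (\<Omega>\<^sub>i n) *\<^sub>v m n"
    and a_bounded: "\<And>n k. k < s n \<Longrightarrow> \<bar>a n $ k\<bar> \<le> A"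
    and h: "\<And>n. h n = prob_space.variance (M n)
          (\<lambda>\<omega>. m n \<bullet> ((\<Omega>\<^sub>i n * outer_prod (X\<^sub>B n 1 \<omega>) (X\<^sub>B n 1 \<omega>) * \<Omega>\<^sub>i n) *\<^sub>v f n))"
  shows "weak_conv_m
    (\<lambda>n. distr (M n) borel (\<lambda>\<omega>. sqrt (real n) / sqrt (h n) * (m n \<bullet> (w1_hat n \<omega> - w1 n))))
    std_normal_distribution"
proof -
  have p_col: "\<Omega> n \<in> carrier_mat (p n) (p n)" for n
    unfolding \<Omega> using \<Sigma>_carrier by simp
  have w_carrier: "w n \<in> carrier_vec (p n)" for n
    by (rule carrier_vecI) (simp add: w carrier_matD(1)[OF p_col])
  have len: "length (supp_list (w n)) = s n" for n
    using length_supp_list[of "w n"] sparsity[OF i, of n] by (simp add: w carrier_matD(1)[OF p_col])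
  have B_carrier: "B n \<in> carrier_mat (p n) (s n)" for n
    using selection_mat_carrier[of "w n"] w_carrier[of n] len[of n] by (simp add: B)
  have B_inj: "B n *\<^sub>v v \<noteq> 0\<^sub>v (p n)" if "v \<in> carrier_vec (s n)" "v \<noteq> 0\<^sub>v (s n)" for n v
    using selection_mat_inj[of v "w n"] that w_carrier[of n] len[of n] by (simp add: B)
  have w1_carrier: "w1 n \<in> carrier_vec (s n)" for n
    using nonzero_part_carrier[of "w n"] len[of n] by (simp add: w1)
  have Bw1: "B n *\<^sub>v w1 n = w n" for n
    unfolding B w1 by (rule selection_mat_nonzero_part)
  have \<Sigma>w: "\<Sigma> n *\<^sub>v w n = unit_vec (p n) (i n)" for n
  proof -
    have "\<Sigma> n * \<Omega> n = 1\<^sub>m (p n)"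
      unfolding \<Omega> by (rule inv_mat_inverts(2)[OF \<Sigma>_carrier det_pos_def_nonzero[OF \<Sigma>_carrier \<Sigma>_pos_def]])
    then show ?thesis
      using col_mult2[OF \<Sigma>_carrier p_col i, of n] i[of n] by (simp add: w)
  qed
  have w1_nonzero: "w1 n \<noteq> 0\<^sub>v (s n)" for n
  proof
    assume "w1 n = 0\<^sub>v (s n)"
    then have "w n = 0\<^sub>v (p n)"
      using Bw1[of n] mult_mat_zero_vec[OF B_carrier, of n] by simp
    then have "unit_vec (p n) (i n) = \<Sigma> n *\<^sub>v 0\<^sub>v (p n)"
      using \<Sigma>w[of n] by simp
    also have "\<dots> = 0\<^sub>v (p n)"
      by (rule mult_mat_zero_vec[OF \<Sigma>_carrier])
    finally show False
      using i[of n] by (metis index_unit_vec(2) index_zero_vec(1) zero_neq_one)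
  qed
  have \<Sigma>\<^sub>i_carrier: "\<Sigma>\<^sub>i n \<in> carrier_mat (s n) (s n)" for n
    unfolding \<Sigma>\<^sub>i using B_carrier[of n] \<Sigma>_carrier[of n] by (auto intro!: mult_carrier_mat)
  have \<Sigma>\<^sub>i_pos_def: "pos_def_mat (\<Sigma>\<^sub>i n)" for n
    unfolding \<Sigma>\<^sub>i by (rule pos_def_congruence[OF B_carrier \<Sigma>_carrier \<Sigma>_pos_def B_inj])
  \<comment> \<open>the true nonzero entries solve the reduced system whose empirical version defines the estimator\<close>
  have f_eq: "f n = \<Sigma>\<^sub>i n *\<^sub>v w1 n" for n
  proof -
    have Bt: "transpose_mat (B n) \<in> carrier_mat (s n) (p n)" using B_carrier by simp
    have "\<Sigma>\<^sub>i n *\<^sub>v w1 n = (transpose_mat (B n) * \<Sigma> n) *\<^sub>v (B n *\<^sub>v w1 n)"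
      unfolding \<Sigma>\<^sub>i by (rule assoc_mult_mat_vec[OF mult_carrier_mat[OF Bt \<Sigma>_carrier] B_carrier w1_carrier])
    also have "\<dots> = transpose_mat (B n) *\<^sub>v (\<Sigma> n *\<^sub>v w n)"
      unfolding Bw1 by (rule assoc_mult_mat_vec[OF Bt \<Sigma>_carrier w_carrier])
    finally show ?thesis by (simp add: f \<Sigma>w)
  qed
  have \<Omega>\<^sub>i_inv: "\<Omega>\<^sub>i n \<in> carrier_mat (s n) (s n)" "\<Omega>\<^sub>i n * \<Sigma>\<^sub>i n = 1\<^sub>m (s n)" for n
    unfolding \<Omega>\<^sub>i using inv_mat_inverts[OF \<Sigma>\<^sub>i_carrier det_pos_def_nonzero[OF \<Sigma>\<^sub>i_carrier \<Sigma>\<^sub>i_pos_def]] by auto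
  have \<Omega>\<^sub>if: "\<Omega>\<^sub>i n *\<^sub>v f n = w1 n" for n
    using assoc_mult_mat_vec[OF \<Omega>\<^sub>i_inv(1) \<Sigma>\<^sub>i_carrier w1_carrier, of n] w1_carrier[of n]
    by (simp add: f_eq \<Omega>\<^sub>i_inv(2))
  have a_carrier: "a n \<in> carrier_vec (s n)" for n
    unfolding a using \<Omega>\<^sub>i_inv(1)[of n] m_carrier[of n] by auto
  have m_eq: "m n = \<Sigma>\<^sub>i n *\<^sub>v a n" for n
  proof -
    have "\<Sigma>\<^sub>i n * transpose_mat (\<Omega>\<^sub>i n) = transpose_mat (\<Omega>\<^sub>i n * \<Sigma>\<^sub>i n)"
      using transpose_mult[OF \<Omega>\<^sub>i_inv(1) \<Sigma>\<^sub>i_carrier, of n] \<Sigma>\<^sub>i_pos_def[of n] by (simp add: pos_def_mat_def)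
    then have "\<Sigma>\<^sub>i n * transpose_mat (\<Omega>\<^sub>i n) = 1\<^sub>m (s n)" by (simp add: \<Omega>\<^sub>i_inv(2))
    then show ?thesis
      unfolding a using assoc_mult_mat_vec[of "\<Sigma>\<^sub>i n" "s n" "s n" "transpose_mat (\<Omega>\<^sub>i n)" "s n" "m n"]
        \<Sigma>\<^sub>i_carrier[of n] \<Omega>\<^sub>i_inv(1)[of n] m_carrier[of n] by simp
  qed
  have a_nonzero: "a n \<noteq> 0\<^sub>v (s n)" for n
  proof
    assume "a n = 0\<^sub>v (s n)"
    then have "m n = 0\<^sub>v (s n)"
      using m_eq[of n] mult_mat_zero_vec[OF \<Sigma>\<^sub>i_carrier, of n] by simp
    with m_nonzero show False by simp
  qed
  \<comment> \<open>for \<open>n \<ge> 2\<close> the divisor \<open>n - 1\<close> of the sample covariance is positive; the limit only involves such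
    \<open>n\<close>\<close>
  have sample: "gaussian_sample (M n) (p n) n (\<Sigma> n) (X n)" if "2 \<le> n" for n
    using prob[of n] \<Sigma>_carrier \<Sigma>_pos_def X_indep X_normal that
    by (simp add: gaussian_sample_def gaussian_sample_axioms_def)
  define Y where "Y n \<omega> = sqrt (real n) / sqrt (h n) * (m n \<bullet> (w1_hat n \<omega> - w1 n))" for n \<omega>
  let ?good = "\<lambda>n Z. Z \<in> borel_measurable (M n) \<and>
      (\<forall>t. t\<^sup>2 / 4 \<le> real n \<longrightarrow> cmod (char (distr (M n) borel Z) t - complex_of_real ((1 - t\<^sup>2 / 2 / real n) ^ n))
        \<le> \<bar>t\<bar> ^ 3 * 849 / 6 / sqrt (real n)) \<and>
      (\<forall>\<epsilon>>0. measure (M n) {\<omega> \<in> space (M n). \<epsilon> < \<bar>Y n \<omega> - Z \<omega>\<bar>} \<le>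
        (6 + 96 * real (s n)) / (sqrt (real n) * \<epsilon>) + 192 * (real (s n))\<^sup>2 / real n)"
  have main: "Y n \<in> borel_measurable (M n) \<and> (\<exists>Z. ?good n Z)" if n: "2 \<le> n" for n
  proof -
    interpret gaussian_sample "M n" "p n" n "\<Sigma> n" "X n" by (rule sample[OF n])
    have h_eq: "h n = variance (\<lambda>\<omega>. ((B n *\<^sub>v a n) \<bullet> X n 1 \<omega>) * ((B n *\<^sub>v w1 n) \<bullet> X n 1 \<omega>))"
    proof -
      have eq: "m n \<bullet> ((\<Omega>\<^sub>i n * outer_prod (X\<^sub>B n 1 \<omega>) (X\<^sub>B n 1 \<omega>) * \<Omega>\<^sub>i n) *\<^sub>v f n) =
          ((B n *\<^sub>v a n) \<bullet> X n 1 \<omega>) * ((B n *\<^sub>v w1 n) \<bullet> X n 1 \<omega>)" if "\<omega> \<in> space (M n)" for \<omega>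
      proof -
        have X1: "X n 1 \<omega> \<in> carrier_vec (p n)" using X_carrier[of 1 \<omega>] that n by simp
        define x where "x = X\<^sub>B n 1 \<omega>"
        have x: "x \<in> carrier_vec (s n)" unfolding x_def X\<^sub>B using B_carrier[of n] X1 by auto
        have o: "outer_prod x x \<in> carrier_mat (s n) (s n)" using x by (simp add: outer_prod_def)
        have fc: "f n \<in> carrier_vec (s n)" unfolding f_eq using \<Sigma>\<^sub>i_carrier[of n] w1_carrier[of n] by auto
        have lin: "v \<bullet> x = (B n *\<^sub>v v) \<bullet> X n 1 \<omega>" if "v \<in> carrier_vec (s n)" for v
          unfolding x_def X\<^sub>B
          using scalar_prod_transpose_mult[of "transpose_mat (B n)" "s n" "p n" v "X n 1 \<omega>"] B_carrier[of n] that X1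
          by simp
        have "(\<Omega>\<^sub>i n * outer_prod x x * \<Omega>\<^sub>i n) *\<^sub>v f n = (\<Omega>\<^sub>i n * outer_prod x x) *\<^sub>v w1 n"
          using assoc_mult_mat_vec[OF mult_carrier_mat[OF \<Omega>\<^sub>i_inv(1) o] \<Omega>\<^sub>i_inv(1) fc] by (simp add: \<Omega>\<^sub>if)
        also have "\<dots> = \<Omega>\<^sub>i n *\<^sub>v ((x \<bullet> w1 n) \<cdot>\<^sub>v x)"
          using assoc_mult_mat_vec[OF \<Omega>\<^sub>i_inv(1) o w1_carrier] outer_prod_mult_vec[OF x x w1_carrier] by simp
        finally have "m n \<bullet> ((\<Omega>\<^sub>i n * outer_prod x x * \<Omega>\<^sub>i n) *\<^sub>v f n) = a n \<bullet> ((x \<bullet> w1 n) \<cdot>\<^sub>v x)"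
          using scalar_prod_transpose_mult[OF \<Omega>\<^sub>i_inv(1) m_carrier, of "(x \<bullet> w1 n) \<cdot>\<^sub>v x"] x by (simp add: a)
        also have "\<dots> = (a n \<bullet> x) * (w1 n \<bullet> x)"
          using x a_carrier[of n] comm_scalar_prod[OF x w1_carrier] by simp
        finally show ?thesis
          unfolding lin[OF a_carrier] lin[OF w1_carrier] unfolding x_def .
      qed
      have E: "expectation (\<lambda>\<omega>. m n \<bullet> ((\<Omega>\<^sub>i n * outer_prod (X\<^sub>B n 1 \<omega>) (X\<^sub>B n 1 \<omega>) * \<Omega>\<^sub>i n) *\<^sub>v f n)) =
          expectation (\<lambda>\<omega>. ((B n *\<^sub>v a n) \<bullet> X n 1 \<omega>) * ((B n *\<^sub>v w1 n) \<bullet> X n 1 \<omega>))"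
        by (rule Bochner_Integration.integral_cong[OF refl eq])
      show ?thesis
        unfolding h E by (rule Bochner_Integration.integral_cong[OF refl]) (simp only: eq)
    qed
    have Y_eq: "Y n = (\<lambda>\<omega>. sqrt n / sqrt (variance (\<lambda>\<omega>. ((B n *\<^sub>v a n) \<bullet> X n 1 \<omega>) * ((B n *\<^sub>v w1 n) \<bullet> X n 1 \<omega>))) *
      (((transpose_mat (B n) * \<Sigma> n * B n) *\<^sub>v a n) \<bullet>
      (inv_mat (transpose_mat (B n) * sample_cov (p n) n (\<lambda>k. X n k \<omega>) * B n) *\<^sub>v ((transpose_mat (B n) * \<Sigma> n * B n) *\<^sub>v w1 n) - w1 n)))"
      unfolding Y_def[abs_def] h_eq m_eq w1_hat f_eq S\<^sub>i S \<Sigma>\<^sub>i ..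
    note approx = estimator_approximation[OF B_carrier B_inj a_carrier a_nonzero w1_carrier w1_nonzero]
    show ?thesis
      unfolding Y_eq using approx by blast
  qed
  have Y_meas: "Y n \<in> borel_measurable (M n)" if "2 \<le> n" for n
    using main[OF that] by (rule conjunct1)
  have "\<forall>n. \<exists>Z. 2 \<le> n \<longrightarrow> ?good n Z"
    using main by blast
  then have "\<exists>Z. \<forall>n. 2 \<le> n \<longrightarrow> ?good n (Z n)"
    by (rule choice)
  then obtain Z where Z: "\<And>n. 2 \<le> n \<Longrightarrow> ?good n (Z n)"
    by blast
  note Z_meas = Z[THEN conjunct1]
    and Z_char = Z[THEN conjunct2, THEN conjunct1, rule_format]
    and Z_close = Z[THEN conjunct2, THEN conjunct2, rule_format]
  have inv_sqrt: "(\<lambda>n. c / sqrt (real n)) \<longlonglongrightarrow> 0" for c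
    by real_asymp
  have s_lim: "(\<lambda>n. real (s n) / sqrt (real n)) \<longlonglongrightarrow> 0"
    using s_small by (rule smalloD_tendsto)
  have "weak_conv_m (\<lambda>n. distr (M (n + 2)) borel (Y (n + 2))) std_normal_distribution"
  proof (rule weak_conv_std_normal_perturbation)
    show "prob_space (M (n + 2))" for n by (rule prob)
    show "Y (n + 2) \<in> borel_measurable (M (n + 2))" for n by (rule Y_meas) simp
    show "Z (n + 2) \<in> borel_measurable (M (n + 2))" for n by (rule Z_meas) simp
  next
    fix t :: real
    have "(\<lambda>n. char (distr (M n) borel (Z n)) t - complex_of_real ((1 - t\<^sup>2 / 2 / real n) ^ n)) \<longlonglongrightarrow> 0"
    proof (rule Lim_null_comparison[OF _ inv_sqrt])
      show "\<forall>\<^sub>F n in sequentially. cmod (char (distr (M n) borel (Z n)) t - complex_of_real ((1 - t\<^sup>2 / 2 / real n) ^ n))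
          \<le> (\<bar>t\<bar> ^ 3 * 849 / 6) / sqrt n"
        using eventually_ge_at_top[of 2] eventually_ge_at_top[of "nat \<lceil>t\<^sup>2 / 4\<rceil>"]
      proof eventually_elim
        case (elim n)
        then have "t\<^sup>2 / 4 \<le> n" by (subst nat_ceiling_le_eq[symmetric])
        with elim show ?case by (intro Z_char)
      qed
    qed
    from tendsto_add[OF this tendsto_power_std_normal_char[of t]]
    have "(\<lambda>n. char (distr (M n) borel (Z n)) t) \<longlonglongrightarrow> char std_normal_distribution t" by simp
    then show "(\<lambda>n. char (distr (M (n + 2)) borel (Z (n + 2))) t) \<longlonglongrightarrow> char std_normal_distribution t"
      by (rule LIMSEQ_ignore_initial_segment)
  next
    fix \<epsilon> :: real assume \<epsilon>: "0 < \<epsilon>"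
    have "(\<lambda>n. (6 / \<epsilon>) / sqrt n + 96 / \<epsilon> * (real (s n) / sqrt n) + 192 * (real (s n) / sqrt n)\<^sup>2) \<longlonglongrightarrow> 0 + 96 / \<epsilon> * 0 + 192 * 0\<^sup>2"
      by (intro tendsto_intros inv_sqrt s_lim)
    then have lim: "(\<lambda>n. (6 / \<epsilon>) / sqrt n + 96 / \<epsilon> * (real (s n) / sqrt n) + 192 * (real (s n) / sqrt n)\<^sup>2) \<longlonglongrightarrow> 0" by simp
    have "(\<lambda>n. measure (M n) {\<omega> \<in> space (M n). \<epsilon> < \<bar>Y n \<omega> - Z n \<omega>\<bar>}) \<longlonglongrightarrow> 0"
    proof (rule Lim_null_comparison[OF _ lim])
      show "\<forall>\<^sub>F n in sequentially. norm (measure (M n) {\<omega> \<in> space (M n). \<epsilon> < \<bar>Y n \<omega> - Z n \<omega>\<bar>})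
          \<le> (6 / \<epsilon>) / sqrt n + 96 / \<epsilon> * (real (s n) / sqrt n) + 192 * (real (s n) / sqrt n)\<^sup>2"
        using eventually_ge_at_top[of 2]
      proof eventually_elim
        case (elim n)
        have "(6 + 96 * real (s n)) / (sqrt n * \<epsilon>) + 192 * (real (s n))\<^sup>2 / real n =
            (6 / \<epsilon>) / sqrt n + 96 / \<epsilon> * (real (s n) / sqrt n) + 192 * (real (s n) / sqrt n)\<^sup>2"
          using \<epsilon> elim by (simp add: power_divide add_divide_distrib mult.commute)
        with Z_close[OF elim \<epsilon>] show ?case by simp
      qed
    qed
    then show "(\<lambda>n. measure (M (n + 2)) {\<omega> \<in> space (M (n + 2)). \<epsilon> < \<bar>Y (n + 2) \<omega> - Z (n + 2) \<omega>\<bar>}) \<longlonglongrightarrow> 0"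
      by (rule LIMSEQ_ignore_initial_segment)
  qed
  then have "weak_conv_m (\<lambda>n. distr (M n) borel (Y n)) std_normal_distribution"
    unfolding weak_conv_m_def weak_conv_def
    using LIMSEQ_offset[where k = 2 and f = "\<lambda>n. cdf (distr (M n) borel (Y n)) x" for x] by blast
  then show ?thesis unfolding Y_def[abs_def] .
qed

end
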